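(* Let $D$ be an integral domain that is not a field. (a) Suppose $D$ is completely integrally closed. Then (1) $D$ is a Krull domain if and only if $I_t(D)\vartriangleleft P$ for $P=$ "is a proper divisorial ideal"; (2) $D$ is a locally factorial Krull domain if and only if $I_t(D)\vartriangleleft P$ for $P=$ "is a proper invertible integral ideal of $D$"; (3) $D$ is a Krull domain if and only if $I_t(D)\vartriangleleft P$ for $P=$ "is a proper $t$-invertible $t$-ideal of $D$". (b) (4) Suppose $D_M$ is a Krull domain for each maximal ideal $M$ of $D$. Then $D$ is a Krull domain if and only if $I_t(D)\vartriangleleft P$ for $P=$ "is a proper divisorial ideal of $D$". (5) Suppose $D$ is an intersection of rank one valuation domains. Then $D$ is a Krull domain if and only if $I_t(D)\vartriangleleft P$ for $P=$ "is a proper divisorial ideal of $D$". (6) Suppose $D$ is an almost Dedekind domain. Then $D$ is a Dedekind domain if and only if $I(D)\vartriangleleft P$ for $P=$ "is a proper divisorial ideal of $D$".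
   Context: Let $K$ be the quotient field of $D$. For a nonzero fractional ideal $I$ of $D$: $I^{-1}=\{x\in K: xI\subseteq D\}$, $I_v=(I^{-1})^{-1}$, and $I_t=\bigcup\{J_v: J\subseteq I \text{ a nonzero finitely generated ideal}\}$. $I$ is divisorial if $I=I_v$, a $t$-ideal if $I=I_t$, and $t$-invertible if $(II^{-1})_t=D$. $I(D)$ is the set of nonzero proper integral ideals of $D$, and $I_t(D)$ is the set of (nonzero) proper integral $t$-ideals of $D$. For $S(D)=I(D)$ or $I_t(D)$ and a property $P$ of ideals, $S(D)\vartriangleleft P$ means that every $s\in S(D)$ is contained in some $\gamma\in S(D)$ satisfying $P$. $D$ is completely integrally closed if whenever $x\in K$, $0\neq r\in D$ and $rx^n\in D$ for all $n\ge 1$, then $x\in D$. $D$ is locally factorial if $D_M$ is a UFD for each maximal ideal $M$; $D$ is almost Dedekind if $D_M$ is a discrete rank one valuation domain for each maximal ideal $M$. *)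

theory Defs
  imports "HOL-Algebra.Algebra"
begin

text \<open>
  An integral domain \<open>D\<close> with quotient field \<open>K\<close> is given by a field \<open>K\<close> and a subring
  \<open>D \<subseteq> carrier K\<close>; overrings of \<open>D\<close>, such as its localizations, are then subsets
  of \<open>carrier K\<close> as well. A subring \<open>A\<close> is viewed as a ring in its own right as
  \<open>K\<lparr>carrier := A\<rparr>\<close>.
\<close>

definition quotient_field :: "('a, 'b) ring_scheme \<Rightarrow> 'a set \<Rightarrow> bool" where
  "quotient_field K D \<longleftrightarrow> field K \<and> subring D K \<and>
     (\<forall>x\<in>carrier K. \<exists>a\<in>D. \<exists>b\<in>D - {\<zero>\<^bsub>K\<^esub>}. x = a \<otimes>\<^bsub>K\<^esub> inv\<^bsub>K\<^esub> b)"

definition localization_at :: "('a, 'b) ring_scheme \<Rightarrow> 'a set \<Rightarrow> 'a set \<Rightarrow> 'a set" where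
  "localization_at K D M = {a \<otimes>\<^bsub>K\<^esub> inv\<^bsub>K\<^esub> s | a s. a \<in> D \<and> s \<in> D - M}"

text \<open>Only nonzero fractional ideals are considered.\<close>

definition fractional_ideal :: "('a, 'b) ring_scheme \<Rightarrow> 'a set \<Rightarrow> 'a set \<Rightarrow> bool" where
  "fractional_ideal K D I \<longleftrightarrow>
     additive_subgroup I K \<and>
     (\<forall>d\<in>D. \<forall>x\<in>I. d \<otimes>\<^bsub>K\<^esub> x \<in> I) \<and>
     I \<noteq> {\<zero>\<^bsub>K\<^esub>} \<and>
     (\<exists>d\<in>D - {\<zero>\<^bsub>K\<^esub>}. \<forall>x\<in>I. d \<otimes>\<^bsub>K\<^esub> x \<in> D)"

text \<open>
  \<^const>\<open>ideal_prod\<close> forms the set of nonempty finite sums of products and does not require its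
  arguments to be ideals. Hence \<open>D \<cdot>\<^bsub>K\<^esub> S\<close> is the \<open>D\<close>-submodule of \<open>K\<close> generated by a nonempty
  \<open>S\<close> (it is empty for empty \<open>S\<close>, but then not a fractional ideal), and \<open>I \<cdot>\<^bsub>K\<^esub> J\<close> is the
  usual product of fractional ideals.
\<close>

definition fg_fractional_ideal :: "('a, 'b) ring_scheme \<Rightarrow> 'a set \<Rightarrow> 'a set \<Rightarrow> bool" where
  "fg_fractional_ideal K D J \<longleftrightarrow>
     fractional_ideal K D J \<and> (\<exists>S. finite S \<and> S \<subseteq> carrier K \<and> J = D \<cdot>\<^bsub>K\<^esub> S)"

definition inverse_ideal :: "('a, 'b) ring_scheme \<Rightarrow> 'a set \<Rightarrow> 'a set \<Rightarrow> 'a set" where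
  "inverse_ideal K D I = {x \<in> carrier K. \<forall>y\<in>I. x \<otimes>\<^bsub>K\<^esub> y \<in> D}"

definition v_closure :: "('a, 'b) ring_scheme \<Rightarrow> 'a set \<Rightarrow> 'a set \<Rightarrow> 'a set" where
  "v_closure K D I = inverse_ideal K D (inverse_ideal K D I)"

definition t_closure :: "('a, 'b) ring_scheme \<Rightarrow> 'a set \<Rightarrow> 'a set \<Rightarrow> 'a set" where
  "t_closure K D I = \<Union> {v_closure K D J | J. fg_fractional_ideal K D J \<and> J \<subseteq> I}"

definition proper_ideals :: "('a, 'b) ring_scheme \<Rightarrow> 'a set \<Rightarrow> 'a set set" where
  "proper_ideals K D = {I. ideal I (K\<lparr>carrier := D\<rparr>) \<and> I \<noteq> {\<zero>\<^bsub>K\<^esub>} \<and> I \<noteq> D}"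

definition proper_t_ideals :: "('a, 'b) ring_scheme \<Rightarrow> 'a set \<Rightarrow> 'a set set" where
  "proper_t_ideals K D = {I \<in> proper_ideals K D. I = t_closure K D I}"

definition each_contained_in ::
    "'a set set \<Rightarrow> ('a set \<Rightarrow> bool) \<Rightarrow> bool" (infix \<open>\<triangleleft>\<close> 50) where
  "S \<triangleleft> P \<longleftrightarrow> (\<forall>s\<in>S. \<exists>\<gamma>\<in>S. s \<subseteq> \<gamma> \<and> P \<gamma>)"

definition proper_divisorial_ideal :: "('a, 'b) ring_scheme \<Rightarrow> 'a set \<Rightarrow> 'a set \<Rightarrow> bool" where
  "proper_divisorial_ideal K D I \<longleftrightarrow> I \<in> proper_ideals K D \<and> I = v_closure K D I"

definition proper_invertible_ideal :: "('a, 'b) ring_scheme \<Rightarrow> 'a set \<Rightarrow> 'a set \<Rightarrow> bool" where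
  "proper_invertible_ideal K D I \<longleftrightarrow>
     I \<in> proper_ideals K D \<and> I \<cdot>\<^bsub>K\<^esub> inverse_ideal K D I = D"

definition proper_t_invertible_t_ideal :: "('a, 'b) ring_scheme \<Rightarrow> 'a set \<Rightarrow> 'a set \<Rightarrow> bool" where
  "proper_t_invertible_t_ideal K D I \<longleftrightarrow>
     I \<in> proper_t_ideals K D \<and> t_closure K D (I \<cdot>\<^bsub>K\<^esub> inverse_ideal K D I) = D"

definition valuation_domain :: "('a, 'b) ring_scheme \<Rightarrow> 'a set \<Rightarrow> bool" where
  "valuation_domain K V \<longleftrightarrow>
     subring V K \<and> (\<forall>x\<in>carrier K - {\<zero>\<^bsub>K\<^esub>}. x \<in> V \<or> inv\<^bsub>K\<^esub> x \<in> V)"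

text \<open>The rank is the Krull dimension, that is, the number of nonzero prime ideals of \<open>V\<close>.\<close>

definition rank_one_valuation_domain :: "('a, 'b) ring_scheme \<Rightarrow> 'a set \<Rightarrow> bool" where
  "rank_one_valuation_domain K V \<longleftrightarrow>
     valuation_domain K V \<and> (\<exists>!P. primeideal P (K\<lparr>carrier := V\<rparr>) \<and> P \<noteq> {\<zero>\<^bsub>K\<^esub>})"

text \<open>A normalized discrete valuation; the value of \<open>v\<close> at zero is irrelevant.\<close>

definition discrete_valuation :: "('a, 'b) ring_scheme \<Rightarrow> ('a \<Rightarrow> int) \<Rightarrow> bool" where
  "discrete_valuation K v \<longleftrightarrow>
     v ` (carrier K - {\<zero>\<^bsub>K\<^esub>}) = UNIV \<and>
     (\<forall>x\<in>carrier K - {\<zero>\<^bsub>K\<^esub>}. \<forall>y\<in>carrier K - {\<zero>\<^bsub>K\<^esub>}.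
        v (x \<otimes>\<^bsub>K\<^esub> y) = v x + v y \<and>
        (x \<oplus>\<^bsub>K\<^esub> y \<noteq> \<zero>\<^bsub>K\<^esub> \<longrightarrow> min (v x) (v y) \<le> v (x \<oplus>\<^bsub>K\<^esub> y)))"

definition discrete_rank_one_valuation_domain :: "('a, 'b) ring_scheme \<Rightarrow> 'a set \<Rightarrow> bool" where
  "discrete_rank_one_valuation_domain K V \<longleftrightarrow>
     (\<exists>v. discrete_valuation K v \<and> V = {x \<in> carrier K. x = \<zero>\<^bsub>K\<^esub> \<or> 0 \<le> v x})"

definition completely_integrally_closed :: "('a, 'b) ring_scheme \<Rightarrow> 'a set \<Rightarrow> bool" where
  "completely_integrally_closed K D \<longleftrightarrow>
     (\<forall>x\<in>carrier K. \<forall>r\<in>D - {\<zero>\<^bsub>K\<^esub>}.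
        (\<forall>n::nat. n \<ge> 1 \<longrightarrow> r \<otimes>\<^bsub>K\<^esub> (x [^]\<^bsub>K\<^esub> n) \<in> D) \<longrightarrow> x \<in> D)"

text \<open>
  A Krull domain is a locally finite intersection of discrete rank one valuation overrings: a
  nonzero element of \<open>D\<close> is a unit in all but finitely many of them. The empty intersection is
  \<open>carrier K\<close>.
\<close>

definition krull_domain :: "('a, 'b) ring_scheme \<Rightarrow> 'a set \<Rightarrow> bool" where
  "krull_domain K D \<longleftrightarrow>
     (\<exists>F. (\<forall>V\<in>F. discrete_rank_one_valuation_domain K V) \<and>
          D = {x \<in> carrier K. \<forall>V\<in>F. x \<in> V} \<and>
          (\<forall>d\<in>D - {\<zero>\<^bsub>K\<^esub>}. finite {V \<in> F. d \<notin> Units (K\<lparr>carrier := V\<rparr>)}))"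

definition locally_krull :: "('a, 'b) ring_scheme \<Rightarrow> 'a set \<Rightarrow> bool" where
  "locally_krull K D \<longleftrightarrow>
     (\<forall>M. maximalideal M (K\<lparr>carrier := D\<rparr>) \<longrightarrow> krull_domain K (localization_at K D M))"

definition locally_factorial :: "('a, 'b) ring_scheme \<Rightarrow> 'a set \<Rightarrow> bool" where
  "locally_factorial K D \<longleftrightarrow>
     (\<forall>M. maximalideal M (K\<lparr>carrier := D\<rparr>) \<longrightarrow>
        factorial_domain (K\<lparr>carrier := localization_at K D M\<rparr>))"

definition intersection_of_rank_one_valuation_domains ::
    "('a, 'b) ring_scheme \<Rightarrow> 'a set \<Rightarrow> bool" where
  "intersection_of_rank_one_valuation_domains K D \<longleftrightarrow>
     (\<exists>F. (\<forall>V\<in>F. rank_one_valuation_domain K V) \<and> D = {x \<in> carrier K. \<forall>V\<in>F. x \<in> V})"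

definition almost_dedekind_domain :: "('a, 'b) ring_scheme \<Rightarrow> 'a set \<Rightarrow> bool" where
  "almost_dedekind_domain K D \<longleftrightarrow>
     (\<forall>M. maximalideal M (K\<lparr>carrier := D\<rparr>) \<longrightarrow>
        discrete_rank_one_valuation_domain K (localization_at K D M))"

definition integrally_closed :: "('a, 'b) ring_scheme \<Rightarrow> 'a set \<Rightarrow> bool" where
  "integrally_closed K D \<longleftrightarrow>
     (\<forall>x\<in>carrier K.
        (\<exists>p. p \<noteq> [] \<and> set p \<subseteq> D \<and> lead_coeff p = \<one>\<^bsub>K\<^esub> \<and> ring.eval K p x = \<zero>\<^bsub>K\<^esub>) \<longrightarrow> x \<in> D)"

definition dedekind_domain :: "('a, 'b) ring_scheme \<Rightarrow> 'a set \<Rightarrow> bool" where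
  "dedekind_domain K D \<longleftrightarrow>
     noetherian_domain (K\<lparr>carrier := D\<rparr>) \<and>
     integrally_closed K D \<and>
     (\<forall>P. primeideal P (K\<lparr>carrier := D\<rparr>) \<and> P \<noteq> {\<zero>\<^bsub>K\<^esub>} \<longrightarrow>
        maximalideal P (K\<lparr>carrier := D\<rparr>))"

end

theory Submission
  imports Defs
begin

text \<open>
  Every class of domains in question is completely integrally closed, so the point is to show that a
  completely integrally closed domain whose maximal t-ideals are all divisorial is a Krull domain.
  If \<open>M\<close> is such a t-ideal, then \<open>M\<^sup>-\<^sup>1 M\<close> is not contained in \<open>M\<close>: otherwise
  \<open>M\<^sup>-\<^sup>1\<close> would consist of almost integral elements and \<open>M\<close> would not be proper. Hence some
  \<open>x \<in> M\<^sup>-\<^sup>1\<close> behaves like the inverse of a uniformizer, and complete integral closedness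
  excludes that \<open>a x\<^sup>n \<in> D\<close> for all \<open>n\<close>; so the localization at \<open>M\<close> is a discrete valuation
  ring. For finite character one considers, for \<open>0 \<noteq> d \<in> D\<close>, the t-ideal of those elements of \<open>D\<close>
  which are locally divisible by \<open>d\<close> at all but finitely many maximal t-ideals. It contains \<open>d x\<^sup>n\<close>,
  which for suitable \<open>n\<close> avoids a given maximal t-ideal, and therefore it contains 1. Conversely, in a
  Krull domain every t-ideal \<open>I\<close> is divisorial, since finitely many elements of \<open>I\<close> of minimal value
  have the same inverse as \<open>I\<close>.
\<close>

text \<open>A maximal t-ideal \<open>M\<close> need not be invertible:
  \<open>M M\<^sup>-\<^sup>1\<close> may lie in a maximal ideal of \<open>D\<close>, and only its
  t-closure is \<open>D\<close>. So \<open>M\<close> cannot be handled through generators;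
  \<open>x\<close> is used only through the fact that \<open>a x\<^sup>n \<in> M\<close> implies
  \<open>a x\<^sup>n\<^sup>+\<^sup>1 \<in> D\<close>. The first \<open>n\<close> at which
  \<open>a x\<^sup>n\<close> leaves \<open>M\<close> is the value of \<open>a\<close>. Finite
  character needs such an \<open>x\<close> at every maximal t-ideal \<open>N\<close>, because any of
  them might contain the t-ideal attached to \<open>d\<close>. At a maximal t-ideal \<open>M\<close>
  other than \<open>N\<close> this \<open>x\<close> is harmless, since \<open>p x \<in> D\<close>
  for any \<open>p\<close> in \<open>N\<close> outside \<open>M\<close>. That the attached ideal is
  t-closed rests on common denominators of finitely many fractions. In (2), invertibility makes a
  maximal t-ideal locally principal, so that irreducible elements of a localization become
  generators of such primes. In (6) the condition concerns all ideals and forces nonzero maximal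
  ideals to be maximal t-ideals; finite character then yields finite generation.\<close>

locale ambient_field = field K for K (structure)
begin

subsection \<open>Fractions, ideals and valuation rings inside a field\<close>

text \<open>A symbol for quotients that rewriting can target: \<open>dv_simps\<close> collects
  products of quotients and inverses into single quotients and clears them by cross multiplication,
  as \<open>field_simps\<close> does for fields given by a type class.\<close>

definition dv :: "'a \<Rightarrow> 'a \<Rightarrow> 'a" where "dv x y = x \<otimes> inv y"

lemma inv_closed_nonzero [simp, intro]: "x \<in> carrier K \<Longrightarrow> x \<noteq> \<zero> \<Longrightarrow> inv x \<in> carrier K"
  using field_Units by auto

lemma inv_nonzero [simp]: "x \<in> carrier K \<Longrightarrow> x \<noteq> \<zero> \<Longrightarrow> inv x \<noteq> \<zero>"
  by (metis Diff_iff Units_inv_Units field_Units insertI1 singletonD)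

lemma r_inv' [simp]: "x \<in> carrier K \<Longrightarrow> x \<noteq> \<zero> \<Longrightarrow> x \<otimes> inv x = \<one>"
  using field_Units by auto

lemma l_inv' [simp]: "x \<in> carrier K \<Longrightarrow> x \<noteq> \<zero> \<Longrightarrow> inv x \<otimes> x = \<one>"
  using field_Units by auto

lemma inv_inv' [simp]: "x \<in> carrier K \<Longrightarrow> x \<noteq> \<zero> \<Longrightarrow> inv (inv x) = x"
  using field_Units by auto

lemma mult_nonzero [simp]:
  "x \<in> carrier K \<Longrightarrow> y \<in> carrier K \<Longrightarrow> x \<otimes> y = \<zero> \<longleftrightarrow> x = \<zero> \<or> y = \<zero>"
  using integral_iff by blast

lemma dv_closed [simp, intro]:
  "x \<in> carrier K \<Longrightarrow> y \<in> carrier K \<Longrightarrow> y \<noteq> \<zero> \<Longrightarrow> dv x y \<in> carrier K"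
  by (simp add: dv_def)

lemma dv_eq_zero [simp]:
  "x \<in> carrier K \<Longrightarrow> y \<in> carrier K \<Longrightarrow> y \<noteq> \<zero> \<Longrightarrow> dv x y = \<zero> \<longleftrightarrow> x = \<zero>"
  by (simp add: dv_def)

lemma inv_dv: "x \<in> carrier K \<Longrightarrow> x \<noteq> \<zero> \<Longrightarrow> inv x = dv \<one> x"
  by (simp add: dv_def)

lemma dv_one [simp]: "x \<in> carrier K \<Longrightarrow> dv x \<one> = x"
  by (simp add: dv_def)

lemma dv_self [simp]: "x \<in> carrier K \<Longrightarrow> x \<noteq> \<zero> \<Longrightarrow> dv x x = \<one>"
  by (simp add: dv_def)

lemma dv_zero [simp]: "x \<in> carrier K \<Longrightarrow> x \<noteq> \<zero> \<Longrightarrow> dv \<zero> x = \<zero>"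
  by (simp add: dv_def)

lemma dv_eq_iff:
  assumes "x \<in> carrier K" "y \<in> carrier K" "y \<noteq> \<zero>" "z \<in> carrier K"
  shows "dv x y = z \<longleftrightarrow> x = z \<otimes> y"
proof
  assume "dv x y = z"
  then have "z \<otimes> y = x \<otimes> (inv y \<otimes> y)"
    using assms unfolding dv_def by (metis inv_closed_nonzero m_assoc)
  then show "x = z \<otimes> y" using assms by simp
next
  assume "x = z \<otimes> y"
  then show "dv x y = z" using assms by (simp add: dv_def m_assoc)
qed

lemma eq_dv_iff:
  assumes "x \<in> carrier K" "y \<in> carrier K" "y \<noteq> \<zero>" "z \<in> carrier K"
  shows "z = dv x y \<longleftrightarrow> z \<otimes> y = x"
  using dv_eq_iff[OF assms] by metis

lemma mult_dv:
  assumes "x \<in> carrier K" "y \<in> carrier K" "z \<in> carrier K" "z \<noteq> \<zero>"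
  shows "x \<otimes> dv y z = dv (x \<otimes> y) z"
  using assms by (simp add: dv_def m_assoc)

lemma dv_mult:
  assumes "x \<in> carrier K" "y \<in> carrier K" "z \<in> carrier K" "z \<noteq> \<zero>"
  shows "dv y z \<otimes> x = dv (y \<otimes> x) z"
  using assms by (simp add: dv_def m_ac)

lemma dv_dv:
  assumes "x \<in> carrier K" "y \<in> carrier K" "z \<in> carrier K" "z \<noteq> \<zero>" "y \<noteq> \<zero>"
  shows "dv (dv x y) z = dv x (y \<otimes> z)"
  using assms by (simp add: dv_eq_iff eq_dv_iff mult_dv dv_mult m_ac)

lemma dv_dv':
  assumes "x \<in> carrier K" "y \<in> carrier K" "z \<in> carrier K" "z \<noteq> \<zero>" "y \<noteq> \<zero>"
  shows "dv x (dv y z) = dv (x \<otimes> z) y"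
  using assms by (simp add: dv_eq_iff eq_dv_iff mult_dv dv_mult m_ac)

lemma dv_add:
  assumes "x \<in> carrier K" "y \<in> carrier K" "z \<in> carrier K" "z \<noteq> \<zero>"
  shows "dv (x \<oplus> y) z = dv x z \<oplus> dv y z"
  using assms by (simp add: dv_def l_distr)

lemma pow_nonzero [simp]: "x \<in> carrier K \<Longrightarrow> x \<noteq> \<zero> \<Longrightarrow> x [^] (n::nat) \<noteq> \<zero>"
  by (induction n) auto

lemmas dv_simps = inv_dv dv_eq_iff eq_dv_iff mult_dv dv_mult dv_dv dv_dv' m_ac

section \<open>Ideals, prime ideals and maximal ideals of a subring\<close>

definition ideal_in :: "'a set \<Rightarrow> 'a set \<Rightarrow> bool" where
  "ideal_in A I \<longleftrightarrow> I \<subseteq> A \<and> \<zero> \<in> I \<and> (\<forall>x\<in>I. \<forall>y\<in>I. x \<oplus> y \<in> I) \<and> (\<forall>a\<in>A. \<forall>x\<in>I. a \<otimes> x \<in> I)"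

lemma ideal_inI:
  assumes "I \<subseteq> A" "\<zero> \<in> I" "\<And>x y. x \<in> I \<Longrightarrow> y \<in> I \<Longrightarrow> x \<oplus> y \<in> I"
    "\<And>a x. a \<in> A \<Longrightarrow> x \<in> I \<Longrightarrow> a \<otimes> x \<in> I"
  shows "ideal_in A I"
  using assms by (auto simp: ideal_in_def)

lemma ideal_inD:
  assumes "ideal_in A I"
  shows "I \<subseteq> A" "\<zero> \<in> I" "\<And>x y. x \<in> I \<Longrightarrow> y \<in> I \<Longrightarrow> x \<oplus> y \<in> I"
    "\<And>a x. a \<in> A \<Longrightarrow> x \<in> I \<Longrightarrow> a \<otimes> x \<in> I"
  using assms by (auto simp: ideal_in_def)

lemma ideal_in_one:
  assumes "subring A K" "ideal_in A I" "\<one> \<in> I" shows "I = A"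
proof -
  have "x \<in> I" if "x \<in> A" for x
    using ideal_inD(4)[OF assms(2) that assms(3)] subringE(1)[OF assms(1)] that by auto
  then show ?thesis using ideal_inD(1)[OF assms(2)] by auto
qed

lemma subring_minus_one: "subring A K \<Longrightarrow> x \<in> A \<Longrightarrow> \<ominus> \<one> \<otimes> x = \<ominus> x"
  using subringE(1) by (metis l_minus l_one one_closed subsetD)

text \<open>Negation is absent from \<open>ideal_in\<close> because \<open>\<ominus> x\<close> is
  the multiple of \<open>x\<close> by \<open>\<ominus> \<one>\<close>, which lies in every
  subring.\<close>

lemma ideal_iff:
  assumes A: "subring A K"
  shows "ideal I (K\<lparr>carrier := A\<rparr>) \<longleftrightarrow> ideal_in A I"
proof
  let ?R = "K\<lparr>carrier := A\<rparr>"
  interpret R: ring ?R using A subring_is_ring by blast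
  {
    assume "ideal I ?R"
    then interpret ideal I ?R .
    show "ideal_in A I"
      using a_subset a_closed zero_closed I_l_closed
      by (intro ideal_inI) auto
  }
  {
    assume I: "ideal_in A I"
    show "ideal I ?R"
    proof (rule idealI[OF R.ring_axioms])
      show "subgroup I (add_monoid ?R)"
      proof (rule R.add.subgroupI)
        show "I \<subseteq> carrier ?R" "I \<noteq> {}" using ideal_inD[OF I] by auto
        show "\<ominus>\<^bsub>?R\<^esub> x \<in> I" if "x \<in> I" for x
        proof -
          have xA: "x \<in> A" using that ideal_inD(1)[OF I] by auto
          have "\<ominus>\<^bsub>?R\<^esub> x = \<ominus> x"
          proof (rule R.minus_equality)
            show "\<ominus> x \<oplus>\<^bsub>?R\<^esub> x = \<zero>\<^bsub>?R\<^esub>"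
              using xA subringE(1)[OF A] by (auto simp: l_neg)
          qed (use xA subringE(5)[OF A xA] in auto)
          moreover have "\<ominus> x = \<ominus> \<one> \<otimes> x" using subring_minus_one[OF A xA] by simp
          moreover have "\<ominus> \<one> \<in> A" using subringE(3,5)[OF A] by auto
          ultimately show ?thesis
            using ideal_inD(4)[OF I] that by metis
        qed
        show "x \<oplus>\<^bsub>?R\<^esub> y \<in> I" if "x \<in> I" "y \<in> I" for x y
          using that ideal_inD(3)[OF I] by auto
      qed
      show "x \<otimes>\<^bsub>?R\<^esub> a \<in> I" if "a \<in> I" "x \<in> carrier ?R" for a x
        using that ideal_inD(4)[OF I] by auto
      show "a \<otimes>\<^bsub>?R\<^esub> x \<in> I" if "a \<in> I" "x \<in> carrier ?R" for a x
      proof -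
        have "a \<in> carrier K" "x \<in> carrier K"
          using that ideal_inD(1)[OF I] subringE(1)[OF A] by auto
        then show ?thesis using that ideal_inD(4)[OF I, of x a] by (simp add: m_comm)
      qed
    qed
  }
qed

lemma subring_cring: "subring A K \<Longrightarrow> cring (K\<lparr>carrier := A\<rparr>)"
  by (metis subcringI' subcring_iff subringE(1))

definition prime_in :: "'a set \<Rightarrow> 'a set \<Rightarrow> bool" where
  "prime_in A P \<longleftrightarrow> ideal_in A P \<and> \<one> \<notin> P \<and> (\<forall>a\<in>A. \<forall>b\<in>A. a \<otimes> b \<in> P \<longrightarrow> a \<in> P \<or> b \<in> P)"

lemma prime_iff:
  assumes A: "subring A K"
  shows "primeideal P (K\<lparr>carrier := A\<rparr>) \<longleftrightarrow> prime_in A P"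
proof
  let ?R = "K\<lparr>carrier := A\<rparr>"
  interpret R: cring ?R using subring_cring[OF A] .
  {
    assume "primeideal P ?R"
    then interpret primeideal P ?R .
    have "ideal_in A P" using ideal_iff[OF A] ideal_axioms by blast
    moreover from this have "\<one> \<notin> P" using ideal_in_one[OF A, of P] I_notcarr by auto
    ultimately show "prime_in A P" using I_prime by (auto simp: prime_in_def)
  }
  {
    assume P: "prime_in A P"
    then show "primeideal P ?R"
      using subringE(3)[OF A]
      by (intro primeidealI) (auto simp: prime_in_def ideal_iff[OF A] R.is_cring)
  }
qed

definition maximal_in :: "'a set \<Rightarrow> 'a set \<Rightarrow> bool" where
  "maximal_in A M \<longleftrightarrow> ideal_in A M \<and> \<one> \<notin> M \<and> (\<forall>J. ideal_in A J \<and> M \<subseteq> J \<and> \<one> \<notin> J \<longrightarrow> J = M)"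

lemma maximal_iff:
  assumes A: "subring A K"
  shows "maximalideal M (K\<lparr>carrier := A\<rparr>) \<longleftrightarrow> maximal_in A M"
proof
  let ?R = "K\<lparr>carrier := A\<rparr>"
  interpret R: cring ?R using subring_cring[OF A] .
  {
    assume "maximalideal M ?R"
    then interpret maximalideal M ?R .
    have 1: "ideal_in A M" using ideal_iff[OF A] ideal_axioms by blast
    have 2: "\<one> \<notin> M" using ideal_in_one[OF A 1] I_notcarr by auto
    have "J = M" if "ideal_in A J" "M \<subseteq> J" "\<one> \<notin> J" for J
      using I_maximal[of J] that ideal_iff[OF A, of J] ideal_inD(1)[OF that(1)] subringE(3)[OF A]
      by auto
    with 1 2 show "maximal_in A M" by (auto simp: maximal_in_def)
  }
  {
    assume M: "maximal_in A M"
    show "maximalideal M ?R"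
    proof (rule maximalidealI)
      show "ideal M ?R" "carrier ?R \<noteq> M"
        using M subringE(3)[OF A] by (auto simp: maximal_in_def ideal_iff[OF A])
      show "J = M \<or> J = carrier ?R" if "ideal J ?R" "M \<subseteq> J" "J \<subseteq> carrier ?R" for J
        using that M ideal_in_one[OF A, of J] by (auto simp: maximal_in_def ideal_iff[OF A])
    qed
  }
qed

lemma maximal_prime:
  assumes A: "subring A K" and "maximal_in A M" shows "prime_in A M"
  using cring.maximalideal_prime[OF subring_cring[OF A]] assms(2)
  unfolding maximal_iff[OF A] prime_iff[OF A] .

lemma units_iff:
  assumes V: "subring V K"
  shows "x \<in> Units (K\<lparr>carrier := V\<rparr>) \<longleftrightarrow> x \<in> V \<and> x \<noteq> \<zero> \<and> inv x \<in> V"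
proof
  assume "x \<in> Units (K\<lparr>carrier := V\<rparr>)"
  then obtain y where y: "y \<in> V" "x \<in> V" "x \<otimes> y = \<one>" unfolding Units_def by auto
  then have c: "x \<in> carrier K" "y \<in> carrier K" using subringE(1)[OF V] by auto
  then have "x \<noteq> \<zero>" using y by auto
  then have "inv x = y" using y c by (simp add: dv_simps)
  then show "x \<in> V \<and> x \<noteq> \<zero> \<and> inv x \<in> V" using y \<open>x \<noteq> \<zero>\<close> by auto
next
  assume x: "x \<in> V \<and> x \<noteq> \<zero> \<and> inv x \<in> V"
  then have "x \<in> carrier K" using subringE(1)[OF V] by auto
  then show "x \<in> Units (K\<lparr>carrier := V\<rparr>)" using x unfolding Units_def by (auto intro!: bexI[of _ "inv x"])
qed


section \<open>Discrete valuation rings inside the field\<close>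

abbreviation dvr :: "'a set \<Rightarrow> bool" where "dvr \<equiv> discrete_rank_one_valuation_domain K"

lemma subring_pow: "subring V K \<Longrightarrow> x \<in> V \<Longrightarrow> x [^] (n::nat) \<in> V"
  by (induction n) (auto simp: subringE)

lemma inv_mult': 
  "x \<in> carrier K \<Longrightarrow> y \<in> carrier K \<Longrightarrow> x \<noteq> \<zero> \<Longrightarrow> y \<noteq> \<zero> \<Longrightarrow> inv (x \<otimes> y) = inv x \<otimes> inv y"
  by (simp add: dv_simps)

lemma pow_inv: "x \<in> carrier K \<Longrightarrow> x \<noteq> \<zero> \<Longrightarrow> inv x [^] (n::nat) = inv (x [^] n)"
  by (induction n) (auto simp: inv_mult')

lemma dv_pow: 
  "x \<in> carrier K \<Longrightarrow> y \<in> carrier K \<Longrightarrow> y \<noteq> \<zero> \<Longrightarrow> dv x y [^] (n::nat) = dv (x [^] n) (y [^] n)"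
  by (simp add: dv_def nat_pow_distrib pow_inv)

lemma discrete_valuation_facts:
  assumes v: "discrete_valuation K v"
  shows "x \<in> carrier K \<Longrightarrow> x \<noteq> \<zero> \<Longrightarrow> y \<in> carrier K \<Longrightarrow> y \<noteq> \<zero> \<Longrightarrow> v (x \<otimes> y) = v x + v y"
    and "v \<one> = 0"
    and "x \<in> carrier K \<Longrightarrow> x \<noteq> \<zero> \<Longrightarrow> v (inv x) = - v x"
    and "x \<in> carrier K \<Longrightarrow> x \<noteq> \<zero> \<Longrightarrow> y \<in> carrier K \<Longrightarrow> y \<noteq> \<zero> \<Longrightarrow> v (dv x y) = v x - v y"
    and "x \<in> carrier K \<Longrightarrow> x \<noteq> \<zero> \<Longrightarrow> v (x [^] (n::nat)) = int n * v x"
proof -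
  show m: "v (x \<otimes> y) = v x + v y"
    if "x \<in> carrier K" "x \<noteq> \<zero>" "y \<in> carrier K" "y \<noteq> \<zero>" for x y
    using v that by (auto simp: discrete_valuation_def)
  show one: "v \<one> = 0" using m[of \<one> \<one>] by simp
  show i: "v (inv x) = - v x" if "x \<in> carrier K" "x \<noteq> \<zero>" for x
    using m[of x "inv x"] that one by simp
  show "v (dv x y) = v x - v y"
    if "x \<in> carrier K" "x \<noteq> \<zero>" "y \<in> carrier K" "y \<noteq> \<zero>" for x y
    using that m[of x "inv y"] i[of y] by (simp add: dv_def)
  show "v (x [^] n) = int n * v x"
    if "x \<in> carrier K" "x \<noteq> \<zero>" for x and n :: nat
  proof (induction n)
    case 0 then show ?case using one by simp
  next
    case (Suc n)
    have "v (x [^] Suc n) = v (x [^] n) + v x" using m[of "x [^] n" x] that by simp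
    then show ?case using Suc by (simp add: algebra_simps)
  qed
qed

lemma dvrE:
  assumes "dvr V"
  obtains v where "discrete_valuation K v" "\<And>x. x \<in> carrier K \<Longrightarrow> x \<noteq> \<zero> \<Longrightarrow> x \<in> V \<longleftrightarrow> 0 \<le> v x"
  using assms unfolding discrete_rank_one_valuation_domain_def by blast

lemma dvr_subring:
  assumes "dvr V" shows "subring V K"
proof -
  obtain v where v: "discrete_valuation K v" "V = {x \<in> carrier K. x = \<zero> \<or> 0 \<le> v x}"
    using assms unfolding discrete_rank_one_valuation_domain_def by blast
  note f = discrete_valuation_facts[OF v(1)]
  have m1: "v (\<ominus> \<one>) = 0"
  proof -
    have n: "\<ominus> \<one> \<noteq> \<zero>" by (metis add.inv_eq_1_iff one_closed one_not_zero)
    have "\<ominus> \<one> \<otimes> \<ominus> \<one> = \<one>" using l_minus r_minus by simp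
    then have "v (\<ominus> \<one>) + v (\<ominus> \<one>) = 0" using f(1)[of "\<ominus> \<one>" "\<ominus> \<one>"] n f(2) by simp
    then show ?thesis by simp
  qed
  have neg: "v (\<ominus> x) = v x" if "x \<in> carrier K" "x \<noteq> \<zero>" for x
  proof -
    have n: "\<ominus> \<one> \<noteq> \<zero>" by (metis add.inv_eq_1_iff one_closed one_not_zero)
    have "\<ominus> x = \<ominus> \<one> \<otimes> x" using that l_minus by simp
    then show ?thesis using f(1)[of "\<ominus> \<one>" x] n that m1 by simp
  qed
  show ?thesis
  proof (rule subringI)
    show "V \<subseteq> carrier K" "\<one> \<in> V" using v(2) f(2) by auto
    show "\<ominus> h \<in> V" if "h \<in> V" for h using that neg v(2) by auto
    show "h1 \<otimes> h2 \<in> V" if "h1 \<in> V" "h2 \<in> V" for h1 h2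
      using that v(2) f(1)[of h1 h2] by auto
    show "h1 \<oplus> h2 \<in> V" if "h1 \<in> V" "h2 \<in> V" for h1 h2
    proof (cases "h1 = \<zero> \<or> h2 = \<zero> \<or> h1 \<oplus> h2 = \<zero>")
      case True then show ?thesis using that v(2) by auto
    next
      case False
      then have "min (v h1) (v h2) \<le> v (h1 \<oplus> h2)"
        using v(1) that v(2) unfolding discrete_valuation_def by auto
      then show ?thesis using False that v(2) by auto
    qed
  qed
qed

lemma dvr_total:
  assumes "dvr V" "x \<in> carrier K" "x \<noteq> \<zero>" "x \<notin> V" shows "inv x \<in> V"
proof -
  obtain v where v: "discrete_valuation K v" "\<And>x. x \<in> carrier K \<Longrightarrow> x \<noteq> \<zero> \<Longrightarrow> x \<in> V \<longleftrightarrow> 0 \<le> v x"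
    using dvrE[OF assms(1)] by blast
  show ?thesis using discrete_valuation_facts(3)[OF v(1)] v(2) assms by auto
qed

text \<open>The values on \<open>I\<close> are nonnegative integers, so the least one is attained
  and \<open>nat\<close> loses nothing. Such a \<open>b\<close> serves as a local generator wherever
  a finite set has to replace an ideal.\<close>

lemma dvr_min:
  assumes V: "dvr V" and I: "I \<subseteq> V" "a \<in> I" "a \<noteq> \<zero>"
  obtains b where "b \<in> I" "b \<noteq> \<zero>" "\<And>q. q \<in> I \<Longrightarrow> dv q b \<in> V"
proof -
  obtain v where v: "discrete_valuation K v" "\<And>x. x \<in> carrier K \<Longrightarrow> x \<noteq> \<zero> \<Longrightarrow> x \<in> V \<longleftrightarrow> 0 \<le> v x"
    using dvrE[OF V] by blast
  note f = discrete_valuation_facts[OF v(1)]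
  have c: "x \<in> carrier K" if "x \<in> I" for x using that I(1) subringE(1)[OF dvr_subring[OF V]] by auto
  obtain b where b: "b \<in> I \<and> b \<noteq> \<zero>" "\<And>q. q \<in> I \<and> q \<noteq> \<zero> \<Longrightarrow> nat (v b) \<le> nat (v q)"
    using ex_has_least_nat[of "\<lambda>b. b \<in> I \<and> b \<noteq> \<zero>" a "\<lambda>b. nat (v b)"] I
    by metis
  show ?thesis
  proof (rule that[of b])
    show "dv q b \<in> V" if "q \<in> I" for q
    proof (cases "q = \<zero>")
      case True then show ?thesis using b c subringE(2)[OF dvr_subring[OF V]] by simp
    next
      case False
      have "0 \<le> v q" "0 \<le> v b" using v(2) c False b(1) that I(1) by auto
      then have "0 \<le> v (dv q b)" using b(2)[of q] that False f(4) c b(1) by simp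
      then show ?thesis using v(2) c b(1) that False by auto
    qed
  qed (use b in auto)
qed

lemma dvr_archimedean:
  assumes V: "dvr V" and a: "a \<in> V" "a \<noteq> \<zero>" "inv a \<notin> V" and d: "d \<in> carrier K" "d \<noteq> \<zero>"
  obtains k :: nat where "dv (a [^] k) d \<in> V"
proof -
  obtain v where v: "discrete_valuation K v" "\<And>x. x \<in> carrier K \<Longrightarrow> x \<noteq> \<zero> \<Longrightarrow> x \<in> V \<longleftrightarrow> 0 \<le> v x"
    using dvrE[OF V] by blast
  note f = discrete_valuation_facts[OF v(1)]
  have c: "a \<in> carrier K" using a subringE(1)[OF dvr_subring[OF V]] by auto
  have "v a > 0" using a c v(2)[of "inv a"] f(3)[of a] by auto
  \<comment> \<open>Since \<open>v a \<ge> 1\<close>, the exponent \<open>\<bar>v d\<bar>\<close>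
    suffices; the absolute value makes it a natural number, as \<open>d\<close> may lie outside
    \<open>V\<close>.\<close>
  obtain k where k: "int k = \<bar>v d\<bar>" using zero_le_imp_eq_int[OF abs_ge_zero] by metis
  have "int k * 1 \<le> int k * v a" using \<open>v a > 0\<close> by (intro mult_left_mono) auto
  then have "v (dv (a [^] k) d) \<ge> 0" using f(4,5) c a d k by simp
  then have "dv (a [^] k) d \<in> V" using v(2) a c d by auto
  then show ?thesis using that by blast
qed

text \<open>If \<open>x\<close> is outside \<open>V\<close>, then some power
  \<open>inv x [^] k\<close> is a multiple of \<open>r\<close> in \<open>V\<close>. Multiplying
  \<open>r \<otimes> x [^] Suc k\<close> by the cofactor leaves exactly one factor \<open>x\<close>,
  which would then be in \<open>V\<close>.\<close>

lemma dvr_cic: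
  assumes V: "dvr V" and x: "x \<in> carrier K" and r: "r \<in> carrier K" "r \<noteq> \<zero>"
    and *: "\<And>n::nat. n \<ge> 1 \<Longrightarrow> r \<otimes> x [^] n \<in> V"
  shows "x \<in> V"
proof (rule ccontr)
  assume nx: "x \<notin> V"
  note sub = dvr_subring[OF V]
  have x0: "x \<noteq> \<zero>" using nx subringE(2)[OF sub] by auto
  have i: "inv x \<in> V" using dvr_total[OF V x x0 nx] .
  obtain k :: nat where k: "dv (inv x [^] k) r \<in> V"
    using dvr_archimedean[OF V i] x x0 nx r by auto
  have "dv (inv x [^] k) r \<otimes> (r \<otimes> x [^] Suc k) \<in> V"
    using k *[of "Suc k"] subringE(6)[OF sub] by auto
  moreover have "dv (inv x [^] k) r \<otimes> (r \<otimes> x [^] Suc k) = x"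
    using x x0 r by (simp add: dv_simps dv_pow)
  ultimately show False using nx by simp
qed

text \<open>Here \<open>x\<close> is the inverse of a uniformizer; working with \<open>x\<close> avoids integer exponents.\<close>

lemma dvr_intro:
  assumes V: "subring V K" and x: "x \<in> carrier K" "x \<noteq> \<zero>" "x \<notin> V" "inv x \<in> V"
    and gen: "\<And>z. z \<in> carrier K \<Longrightarrow> z \<noteq> \<zero> \<Longrightarrow>
      \<exists>(i::nat) (j::nat) u. u \<in> V \<and> u \<noteq> \<zero> \<and> inv u \<in> V \<and> z \<otimes> x [^] i = u \<otimes> x [^] j"
  shows "dvr V"
proof -
  define U where "U = {u \<in> V. u \<noteq> \<zero> \<and> inv u \<in> V}"
  \<comment> \<open>With \<open>x\<close> of value -1, the equation says that \<open>z\<close> has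
    value \<open>i - j\<close>. It is only a relation at first: independence of \<open>i\<close>,
    \<open>j\<close> and \<open>u\<close> is shown in \<open>uniq\<close>.\<close>
  define val where "val z n \<longleftrightarrow> (\<exists>i j u. n = int i - int j \<and> u \<in> U \<and> z \<otimes> x [^] i = u \<otimes> x [^] j)"
    for z n
  have VK: "a \<in> carrier K" if "a \<in> V" for a using that subringE(1)[OF V] by auto
  have UK: "u \<in> carrier K" "u \<noteq> \<zero>" if "u \<in> U" for u using that VK by (auto simp: U_def)
  have Um: "u \<otimes> w \<in> U" if "u \<in> U" "w \<in> U" for u w
    using that VK subringE(6)[OF V] by (auto simp: U_def inv_mult')
  have Ui: "inv u \<in> U" if "u \<in> U" for u
    using that VK by (auto simp: U_def)
  have ex: "\<exists>n. val z n" if "z \<in> carrier K" "z \<noteq> \<zero>" for z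
    using gen[OF that] unfolding val_def U_def by blast
  have mult: "val (z \<otimes> w) (n + m)" if zw: "z \<in> carrier K" "w \<in> carrier K" and "val z n" "val w m" for z w n m
  proof -
    obtain i j u where 1: "n = int i - int j" "u \<in> U" "z \<otimes> x [^] i = u \<otimes> x [^] j"
      using \<open>val z n\<close> by (auto simp: val_def)
    obtain i' j' u' where 2: "m = int i' - int j'" "u' \<in> U" "w \<otimes> x [^] i' = u' \<otimes> x [^] j'"
      using \<open>val w m\<close> by (auto simp: val_def)
    have "(z \<otimes> w) \<otimes> x [^] (i + i') = (z \<otimes> x [^] i) \<otimes> (w \<otimes> x [^] i')"
      using zw x by (simp add: nat_pow_mult[symmetric] m_ac)
    also have "\<dots> = (u \<otimes> u') \<otimes> x [^] (j + j')"
      using x UK[OF 1(2)] UK[OF 2(2)] unfolding 1(3) 2(3) by (simp add: nat_pow_mult[symmetric] m_ac)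
    finally show ?thesis using 1 2 Um unfolding val_def
      by (intro exI[of _ "i + i'"] exI[of _ "j + j'"] exI[of _ "u \<otimes> u'"]) auto
  qed
  have minv: "val (inv z) (- n)" if z: "z \<in> carrier K" "z \<noteq> \<zero>" and "val z n" for z n
  proof -
    obtain i j u where 1: "n = int i - int j" "u \<in> U" "z \<otimes> x [^] i = u \<otimes> x [^] j"
      using \<open>val z n\<close> by (auto simp: val_def)
    have "inv z \<otimes> x [^] j = inv u \<otimes> x [^] i"
      using 1(3) UK[OF 1(2)] z x by (simp add: dv_simps)
    then show ?thesis using 1 Ui unfolding val_def
      by (intro exI[of _ j] exI[of _ i] exI[of _ "inv u"]) auto
  qed
  \<comment> \<open>Powers of \<open>inv x\<close> stay in \<open>V\<close>, so a positive power of
    \<open>x\<close> in \<open>V\<close> could be brought down to \<open>x\<close> itself.\<close>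
  have xpow: "k = 0" if "x [^] (k::nat) \<in> V" for k
  proof (rule ccontr)
    assume "k \<noteq> 0"
    then obtain l where l: "k = Suc l" using not0_implies_Suc by blast
    have "inv x [^] l \<otimes> x [^] k \<in> V" using that subring_pow[OF V x(4)] subringE(6)[OF V] by auto
    moreover have "inv x [^] l \<otimes> x [^] k = x" using x unfolding l by (simp add: dv_simps dv_pow)
    ultimately show False using x by simp
  qed
  have nonneg: "z \<in> V \<longleftrightarrow> 0 \<le> n" if z: "z \<in> carrier K" "z \<noteq> \<zero>" and "val z n" for z n
  proof -
    obtain i j u where 1: "n = int i - int j" "u \<in> U" "z \<otimes> x [^] i = u \<otimes> x [^] j"
      using \<open>val z n\<close> by (auto simp: val_def)
    note u = UK[OF 1(2)]
    show ?thesis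
    proof
      assume zV: "z \<in> V"
      show "0 \<le> n"
      proof (rule ccontr)
        assume "\<not> 0 \<le> n"
        then obtain k where k: "j = i + k" "k > 0" using 1(1) less_imp_add_positive[of i j] by auto
        have "z \<otimes> x [^] i = (u \<otimes> x [^] k) \<otimes> x [^] i"
          unfolding 1(3) k(1) using x u by (simp add: nat_pow_mult[symmetric] m_ac)
        then have "z = u \<otimes> x [^] k"
          using z x u by (metis m_rcancel m_closed nat_pow_closed pow_nonzero)
        then have "x [^] k = inv u \<otimes> z" using z x u by (simp add: dv_simps)
        then have "x [^] k \<in> V" using zV 1(2) subringE(6)[OF V] by (auto simp: U_def)
        then show False using xpow k by auto
      qed
    next
      assume "0 \<le> n"
      then obtain k where k: "i = j + k" using 1(1) le_Suc_ex[of j i] by auto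
      have "(z \<otimes> x [^] k) \<otimes> x [^] j = u \<otimes> x [^] j"
        unfolding 1(3)[symmetric] k(1) using x z by (simp add: nat_pow_mult[symmetric] m_ac)
      then have "z \<otimes> x [^] k = u"
        using z x u by (metis m_rcancel m_closed nat_pow_closed pow_nonzero)
      then have "z = u \<otimes> inv x [^] k" using z x u by (simp add: dv_simps dv_pow)
      then show "z \<in> V" using subring_pow[OF V x(4)] 1(2) subringE(6)[OF V] by (auto simp: U_def)
    qed
  qed
  \<comment> \<open>Two values of \<open>z\<close> make both of their differences values of
    \<open>\<one>\<close>, and elements of \<open>V\<close> have only nonnegative values.\<close>
  have uniq: "n = m" if z: "z \<in> carrier K" "z \<noteq> \<zero>" and "val z n" "val z m" for z n m
  proof -
    have "val \<one> (n - m)" "val \<one> (m - n)"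
      using mult[of z "inv z" n "- m"] mult[of z "inv z" m "- n"] minv[OF z] that by auto
    then have "0 \<le> n - m" "0 \<le> m - n" using nonneg[of \<one> "n - m"] nonneg[of \<one> "m - n"] subringE(3)[OF V] by auto
    then show ?thesis by simp
  qed
  define v where "v z = (THE n. val z n)" for z
  have v: "val z (v z)" if "z \<in> carrier K" "z \<noteq> \<zero>" for z
    unfolding v_def using ex[OF that] uniq[OF that] by (metis theI)
  have vV: "z \<in> V \<longleftrightarrow> 0 \<le> v z" if "z \<in> carrier K" "z \<noteq> \<zero>" for z
    using nonneg[OF that v[OF that]] .
  have vm: "v (z \<otimes> w) = v z + v w"
    if "z \<in> carrier K" "z \<noteq> \<zero>" "w \<in> carrier K" "w \<noteq> \<zero>" for z w
    using uniq[OF _ _ v mult[OF _ _ v v]] that by auto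
  have vi: "v (inv z) = - v z" if "z \<in> carrier K" "z \<noteq> \<zero>" for z
    using uniq[OF _ _ v minv[OF _ _ v]] that by auto
  have one: "\<one> \<in> U" using subringE(3)[OF V] by (auto simp: U_def)
  have vadd: "v z \<le> v (z \<oplus> w)"
    if zw: "z \<in> carrier K" "z \<noteq> \<zero>" "w \<in> carrier K" "w \<noteq> \<zero>" "z \<oplus> w \<noteq> \<zero>" "v z \<le> v w" for z w
  proof -
    have "w \<otimes> inv z \<in> V" using vV[of "w \<otimes> inv z"] vm[of w "inv z"] vi[of z] zw by simp
    then have 1: "\<one> \<oplus> w \<otimes> inv z \<in> V" using subringE(3,7)[OF V] by auto
    have "(z \<oplus> w) \<otimes> inv z = \<one> \<oplus> w \<otimes> inv z" using zw by (simp add: l_distr)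
    moreover have "(z \<oplus> w) \<otimes> inv z \<noteq> \<zero>" using zw by (subst mult_nonzero) auto
    ultimately have "0 \<le> v ((z \<oplus> w) \<otimes> inv z)"
      using 1 vV[of "(z \<oplus> w) \<otimes> inv z"] zw(1,2,3) by (metis a_closed inv_closed_nonzero m_closed)
    then show ?thesis using vm[of "z \<oplus> w" "inv z"] vi[of z] zw by simp
  qed
  have "discrete_valuation K v"
    unfolding discrete_valuation_def
  proof (intro conjI ballI impI)
    have "n \<in> v ` (carrier K - {\<zero>})" for n
    proof -
      \<comment> \<open>The uniformizer is \<open>inv x\<close>; its powers and their inverses reach
        every integer.\<close>
      have pos: "v (inv x [^] k) = int k" for k
      proof -
        have "val (inv x [^] k) (int k)" unfolding val_def using one x
          by (intro exI[of _ k] exI[of _ 0] exI[of _ \<one>]) (simp add: pow_inv)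
        then show ?thesis using uniq[OF _ _ v] x by simp
      qed
      show ?thesis
      proof (cases n rule: int_cases2)
        case (nonneg k)
        then show ?thesis using pos[of k] x by (intro image_eqI[of _ _ "inv x [^] k"]) auto
      next
        case (nonpos k)
        then show ?thesis using pos[of k] vi[of "inv x [^] k"] x
          by (intro image_eqI[of _ _ "inv (inv x [^] k)"]) auto
      qed
    qed
    then show "v ` (carrier K - {\<zero>}) = UNIV" by auto
  next
    fix z w assume "z \<in> carrier K - {\<zero>}" "w \<in> carrier K - {\<zero>}"
    then show "v (z \<otimes> w) = v z + v w" using vm by auto
  next
    fix z w assume "z \<in> carrier K - {\<zero>}" "w \<in> carrier K - {\<zero>}" "z \<oplus> w \<noteq> \<zero>"
    then show "min (v z) (v w) \<le> v (z \<oplus> w)"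
      using vadd[of z w] vadd[of w z] by (cases "v z \<le> v w") (auto simp: a_comm)
  qed
  moreover have "V = {z \<in> carrier K. z = \<zero> \<or> 0 \<le> v z}"
    using vV VK subringE(2)[OF V] by blast
  ultimately show ?thesis unfolding discrete_rank_one_valuation_domain_def by blast
qed


section \<open>Rank one valuation domains\<close>

text \<open>For \<open>x\<close> outside \<open>V\<close> put \<open>y = inv x\<close>. The elements
  divisible by all powers of \<open>y\<close> form a prime ideal \<open>Q\<close>, which contains
  \<open>r\<close> and hence is nonzero, but does not contain \<open>y\<close>. The nonunits form a
  prime ideal \<open>m\<close> containing \<open>y\<close>. Two different nonzero primes contradict
  rank one.\<close>

lemma rank_one_cic:
  assumes V: "rank_one_valuation_domain K V" and x: "x \<in> carrier K" and r: "r \<in> carrier K" "r \<noteq> \<zero>"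
    and *: "\<And>n::nat. n \<ge> 1 \<Longrightarrow> r \<otimes> x [^] n \<in> V"
  shows "x \<in> V"
proof (rule ccontr)
  assume nx: "x \<notin> V"
  have sub: "subring V K" and tot: "\<And>x. x \<in> carrier K \<Longrightarrow> x \<noteq> \<zero> \<Longrightarrow> x \<in> V \<or> inv x \<in> V"
    and uniq: "\<exists>!P. primeideal P (K\<lparr>carrier := V\<rparr>) \<and> P \<noteq> {\<zero>}"
    using V by (auto simp: rank_one_valuation_domain_def valuation_domain_def)
  note VE = subringE[OF sub]
  have VK: "a \<in> carrier K" if "a \<in> V" for a using that VE(1) by auto
  define y where "y = inv x"
  have x0: "x \<noteq> \<zero>" using nx VE(2) by auto
  have y: "y \<in> V" "y \<in> carrier K" "y \<noteq> \<zero>" "inv y = x"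
    using tot[OF x x0] x x0 nx by (auto simp: y_def)
  define Q where "Q = {z \<in> V. \<forall>n::nat. dv z (y [^] n) \<in> V}"
  define m where "m = {z \<in> V. z = \<zero> \<or> inv z \<notin> V}"
  have dvy: "dv \<one> y = x" using y by (simp add: dv_def x)
  have "prime_in V Q"
    unfolding prime_in_def
  proof (intro conjI ballI impI)
    show "ideal_in V Q"
    proof (rule ideal_inI)
      show "Q \<subseteq> V" "\<zero> \<in> Q" using VE y by (auto simp: Q_def)
      show "z \<oplus> w \<in> Q" if "z \<in> Q" "w \<in> Q" for z w
        using that VE(7) y VK by (auto simp: Q_def dv_add)
      show "a \<otimes> z \<in> Q" if "a \<in> V" "z \<in> Q" for a z
        using that VE(6) y VK by (auto simp: Q_def mult_dv[symmetric])
    qed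
    show "\<one> \<notin> Q"
    proof
      assume "\<one> \<in> Q"
      then have "dv \<one> (y [^] (1::nat)) \<in> V" unfolding Q_def by blast
      then show False using dvy nx y by simp
    qed
    show "a \<in> Q \<or> b \<in> Q" if ab: "a \<in> V" "b \<in> V" "a \<otimes> b \<in> Q" for a b
    proof (rule ccontr)
      assume "\<not> (a \<in> Q \<or> b \<in> Q)"
      then obtain k l :: nat where kl: "dv a (y [^] k) \<notin> V" "dv b (y [^] l) \<notin> V"
        using ab by (auto simp: Q_def)
      then have nz: "a \<noteq> \<zero>" "b \<noteq> \<zero>" using VE(2) y by auto
      have "inv (dv a (y [^] k)) \<in> V" "inv (dv b (y [^] l)) \<in> V"
        using tot[of "dv a (y [^] k)"] tot[of "dv b (y [^] l)"] kl nz VK ab y(1-3) by auto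
      \<comment> \<open>The extra 1 in the exponent leaves one factor \<open>inv y\<close>, that is
        \<open>x\<close>, once the two inverted quotients have cancelled the rest.\<close>
      moreover have "dv (a \<otimes> b) (y [^] (k + l + 1)) \<in> V" using ab(3) unfolding Q_def by blast
      ultimately have "inv (dv a (y [^] k)) \<otimes> inv (dv b (y [^] l)) \<otimes> dv (a \<otimes> b) (y [^] (k + l + 1)) \<in> V"
        using VE(6) by blast
      moreover have "inv (dv a (y [^] k)) \<otimes> inv (dv b (y [^] l)) \<otimes> dv (a \<otimes> b) (y [^] (k + l + 1)) = x"
        unfolding y(4)[symmetric] using nz VK[OF ab(1)] VK[OF ab(2)] y(2,3)
        by (simp add: dv_simps nat_pow_mult[symmetric])
      ultimately show False using nx by simp
    qed
  qed
  moreover have "r \<in> Q"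
  proof -
    \<comment> \<open>The hypothesis starts at exponent 1, so \<open>r \<in> V\<close>, the case of
      exponent 0, is recovered by multiplying back with \<open>y\<close>.\<close>
    have "y \<otimes> (r \<otimes> x [^] (1::nat)) \<in> V" using *[of 1] y VE(6) by auto
    moreover have "y \<otimes> (r \<otimes> x [^] (1::nat)) = r" using x x0 r by (simp add: y_def dv_simps)
    ultimately have r': "r \<in> V" by simp
    have "dv r (y [^] n) = r \<otimes> x [^] n" for n :: nat
      using x x0 r by (simp add: y_def dv_simps dv_pow)
    then have "dv r (y [^] n) \<in> V" for n :: nat
      using *[of n] r' r by (cases "n = 0") auto
    then show ?thesis using r' by (auto simp: Q_def)
  qed
  moreover have "prime_in V m"
    unfolding prime_in_def
  proof (intro conjI ballI impI)
    \<comment> \<open>If \<open>z\<close> divides \<open>w\<close>, then \<open>z \<oplus> w\<close>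
      is a multiple of \<open>z\<close> and can only be a unit if \<open>z\<close> is one. By
      totality one of two nonzero elements always divides the other.\<close>
    have aux: "inv (z \<oplus> w) \<notin> V"
      if "z \<in> m" "w \<in> m" "z \<noteq> \<zero>" "z \<oplus> w \<noteq> \<zero>" "dv w z \<in> V" for z w
    proof
      assume "inv (z \<oplus> w) \<in> V"
      have zw: "z \<in> carrier K" "w \<in> carrier K" using that VK by (auto simp: m_def)
      have "\<one> \<oplus> dv w z \<in> V" using that VE by auto
      moreover have "dv (z \<oplus> w) z = \<one> \<oplus> dv w z" using zw that by (simp add: dv_add)
      ultimately have "inv (z \<oplus> w) \<otimes> dv (z \<oplus> w) z \<in> V" using \<open>inv (z \<oplus> w) \<in> V\<close> VE(6) by auto
      moreover have "inv (z \<oplus> w) \<otimes> dv (z \<oplus> w) z = inv z"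
      proof -
        define t where "t = z \<oplus> w"
        have "t \<in> carrier K" using zw by (simp add: t_def)
        then show ?thesis unfolding t_def[symmetric] using that(4) zw that(3)
          by (simp add: t_def[symmetric] dv_simps)
      qed
      ultimately show False using that by (auto simp: m_def)
    qed
    show "ideal_in V m"
    proof (rule ideal_inI)
      show "m \<subseteq> V" "\<zero> \<in> m" using VE by (auto simp: m_def)
      show "z \<oplus> w \<in> m" if zw: "z \<in> m" "w \<in> m" for z w
      proof (cases "z = \<zero> \<or> w = \<zero> \<or> z \<oplus> w = \<zero>")
        case True then show ?thesis using zw VK VE(2) by (auto simp: m_def)
      next
        case False
        have c: "z \<in> carrier K" "w \<in> carrier K" using zw VK by (auto simp: m_def)
        have "inv (dv w z) = dv z w" using c False by (simp add: dv_simps)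
        then have "dv w z \<in> V \<or> dv z w \<in> V" using tot[of "dv w z"] c False by auto
        then have "inv (z \<oplus> w) \<notin> V"
          using aux[of z w] aux[of w z] zw False c by (auto simp: a_comm)
        then show ?thesis using zw VE(7) by (auto simp: m_def)
      qed
      show "a \<otimes> z \<in> m" if az: "a \<in> V" "z \<in> m" for a z
      proof (cases "a \<otimes> z = \<zero>")
        case True then show ?thesis using VE(2) by (simp add: m_def)
      next
        case False
        have c: "a \<in> carrier K" "z \<in> carrier K" using az VK by (auto simp: m_def)
        then have nz: "a \<noteq> \<zero>" "z \<noteq> \<zero>" using False by auto
        have "inv (a \<otimes> z) \<notin> V"
        proof
          assume "inv (a \<otimes> z) \<in> V"
          then have "a \<otimes> inv (a \<otimes> z) \<in> V" using az VE(6) by auto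
          moreover have "a \<otimes> inv (a \<otimes> z) = inv z" using c nz by (simp add: dv_simps)
          ultimately show False using az nz by (auto simp: m_def)
        qed
        then show ?thesis using az VE(6) by (auto simp: m_def)
      qed
    qed
    show "\<one> \<notin> m" using VE(3) by (auto simp: m_def)
    show "a \<in> m \<or> b \<in> m" if ab: "a \<in> V" "b \<in> V" "a \<otimes> b \<in> m" for a b
      using ab VK VE(6) by (auto simp: m_def inv_mult')
  qed
  moreover have "y \<in> m" using y nx by (auto simp: m_def)
  moreover have "y \<notin> Q"
  proof
    assume "y \<in> Q"
    then have "dv y (y [^] (2::nat)) \<in> V" unfolding Q_def by blast
    moreover have "dv y (y [^] (2::nat)) = dv \<one> y" using y(2,3) by (simp only: numeral_2_eq_2 nat_pow_Suc nat_pow_0) (simp add: dv_simps)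
    ultimately show False using dvy nx by simp
  qed
  ultimately show False
    using uniq prime_iff[OF sub] r y by (metis singletonD)
qed

end

subsection \<open>The v- and t-operations\<close>

locale domain_in_field = ambient_field +
  fixes D assumes D: "subring D K"
    and fraction: "\<And>x. x \<in> carrier K \<Longrightarrow> \<exists>a\<in>D. \<exists>b\<in>D - {\<zero>}. x = a \<otimes> inv b"
begin

lemmas DE = subringE[OF D]

lemma D_carrier: "d \<in> D \<Longrightarrow> d \<in> carrier K" using DE(1) by auto

lemma denominator:
  assumes "x \<in> carrier K" obtains b where "b \<in> D" "b \<noteq> \<zero>" "b \<otimes> x \<in> D"
proof -
  obtain a b where "a \<in> D" "b \<in> D - {\<zero>}" "x = a \<otimes> inv b" using fraction[OF assms] by auto
  moreover from this have "b \<otimes> x = a" using D_carrier by (simp add: dv_simps)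
  ultimately show ?thesis using that[of b] by auto
qed

lemma ideal_in_closed: "ideal_in D I \<Longrightarrow> x \<in> I \<Longrightarrow> x \<in> carrier K"
  using ideal_inD(1) D_carrier by blast

lemma ideal_in_r: "ideal_in D I \<Longrightarrow> x \<in> I \<Longrightarrow> a \<in> D \<Longrightarrow> x \<otimes> a \<in> I"
  using ideal_inD(4) ideal_in_closed D_carrier m_comm by metis

abbreviation "iv \<equiv> inverse_ideal K D"
abbreviation "vc \<equiv> v_closure K D"
abbreviation "PT \<equiv> proper_t_ideals K D"
abbreviation "loc \<equiv> localization_at K D"

lemma proper_ideals_iff:
  "I \<in> proper_ideals K D \<longleftrightarrow> ideal_in D I \<and> \<one> \<notin> I \<and> (\<exists>a\<in>I. a \<noteq> \<zero>)"
  unfolding proper_ideals_def mem_Collect_eq ideal_iff[OF D]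
  using ideal_in_one[OF D, of I] DE(3) ideal_inD(2)[of D I] by blast

lemma iv_carrier: "iv A \<subseteq> carrier K" by (auto simp: inverse_ideal_def)

lemma vc_carrier: "vc A \<subseteq> carrier K" by (auto simp: v_closure_def inverse_ideal_def)

lemma iv_antimono: "A \<subseteq> B \<Longrightarrow> iv B \<subseteq> iv A" by (auto simp: inverse_ideal_def)

lemma vc_mono: "A \<subseteq> B \<Longrightarrow> vc A \<subseteq> vc B" unfolding v_closure_def by (intro iv_antimono)

lemma vc_extensive: "A \<subseteq> carrier K \<Longrightarrow> A \<subseteq> vc A"
  unfolding v_closure_def inverse_ideal_def by (auto simp: subset_iff) (metis m_comm)

text \<open>Together with \<open>vcI\<close> this replaces the double inverse by a test: an element
  of \<open>K\<close> lies in the v-closure of \<open>A\<close> iff each multiplier carrying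
  \<open>A\<close> into \<open>D\<close> carries it into \<open>D\<close>.\<close>

lemma vc_mult:
  assumes "y \<in> vc A" "z \<in> carrier K" "\<And>a. a \<in> A \<Longrightarrow> z \<otimes> a \<in> D" shows "z \<otimes> y \<in> D"
proof -
  have "z \<in> iv A" using assms by (auto simp: inverse_ideal_def)
  then have "y \<otimes> z \<in> D" "y \<in> carrier K" using assms(1) by (auto simp: v_closure_def inverse_ideal_def)
  then show ?thesis using assms(2) by (simp add: m_comm)
qed

lemma vcI:
  assumes "y \<in> carrier K" "\<And>z. z \<in> carrier K \<Longrightarrow> (\<And>a. a \<in> A \<Longrightarrow> z \<otimes> a \<in> D) \<Longrightarrow> z \<otimes> y \<in> D"
  shows "y \<in> vc A"
  using assms by (auto simp: v_closure_def inverse_ideal_def m_comm)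

lemma vc_least: "A \<subseteq> vc B \<Longrightarrow> vc A \<subseteq> vc B"
proof
  fix y assume AB: "A \<subseteq> vc B" and y: "y \<in> vc A"
  show "y \<in> vc B"
  proof (rule vcI)
    show "y \<in> carrier K" using y vc_carrier by auto
    fix z assume z: "z \<in> carrier K" "\<And>b. b \<in> B \<Longrightarrow> z \<otimes> b \<in> D"
    then have "z \<otimes> a \<in> D" if "a \<in> A" for a using that AB vc_mult[of a B z] by auto
    then show "z \<otimes> y \<in> D" using vc_mult[OF y z(1)] by auto
  qed
qed

lemma vc_scale:
  assumes "x \<in> carrier K" "y \<in> vc A" "A \<subseteq> carrier K" shows "x \<otimes> y \<in> vc ((\<otimes>) x ` A)"
proof (rule vcI)
  have y: "y \<in> carrier K" using assms vc_carrier by auto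
  then show "x \<otimes> y \<in> carrier K" using assms by auto
  fix z assume z: "z \<in> carrier K" "\<And>a. a \<in> (\<otimes>) x ` A \<Longrightarrow> z \<otimes> a \<in> D"
  then have "(z \<otimes> x) \<otimes> y \<in> D" using assms by (intro vc_mult[OF assms(2)]) (auto simp: m_assoc)
  then show "z \<otimes> (x \<otimes> y) \<in> D" using z assms y by (simp add: m_assoc)
qed

lemma vc_subset_D: "A \<subseteq> D \<Longrightarrow> vc A \<subseteq> D"
proof
  fix y assume "A \<subseteq> D" "y \<in> vc A"
  then have "\<one> \<otimes> y \<in> D" using D_carrier by (intro vc_mult[of y A]) auto
  then show "y \<in> D" using \<open>y \<in> vc A\<close> vc_carrier[of A] by (metis l_one subsetD)
qed

lemma vc_ideal: assumes "A \<subseteq> D" shows "ideal_in D (vc A)"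
proof (rule ideal_inI)
  show "vc A \<subseteq> D" using vc_subset_D assms .
  show "\<zero> \<in> vc A" using DE(2) by (intro vcI) auto
  show "x \<oplus> y \<in> vc A" if "x \<in> vc A" "y \<in> vc A" for x y
  proof (rule vcI)
    have c: "x \<in> carrier K" "y \<in> carrier K" using that vc_carrier by auto
    then show "x \<oplus> y \<in> carrier K" by auto
    show "z \<otimes> (x \<oplus> y) \<in> D" if "z \<in> carrier K" "\<And>a. a \<in> A \<Longrightarrow> z \<otimes> a \<in> D" for z
      using that vc_mult[OF \<open>x \<in> vc A\<close>] vc_mult[OF \<open>y \<in> vc A\<close>] c DE(7) by (simp add: r_distr)
  qed
  show "d \<otimes> x \<in> vc A" if "d \<in> D" "x \<in> vc A" for d x
  proof (rule vcI)
    have c: "x \<in> carrier K" "d \<in> carrier K" using that vc_carrier D_carrier by auto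
    then show "d \<otimes> x \<in> carrier K" by auto
    show "z \<otimes> (d \<otimes> x) \<in> D" if z: "z \<in> carrier K" "\<And>a. a \<in> A \<Longrightarrow> z \<otimes> a \<in> D" for z
    proof -
      have "d \<otimes> (z \<otimes> x) \<in> D" using DE(6)[OF \<open>d \<in> D\<close>] z vc_mult[OF \<open>x \<in> vc A\<close>] by auto
      then show ?thesis using c z by (simp add: m_ac)
    qed
  qed
qed

text \<open>
  Finite subsets replace finitely generated ideals here, as both have the same v-closure
  (\<open>vc_prod_D\<close>). For nonzero ideals this is equivalent to \<open>I = t_closure K D I\<close>, see \<open>PT_iff\<close>.
\<close>

definition tclosed :: "'a set \<Rightarrow> bool" where
  "tclosed I \<longleftrightarrow> (\<forall>S. finite S \<and> S \<subseteq> I \<longrightarrow> vc S \<subseteq> I)"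

lemma prod_D_least:
  assumes "\<And>x y. x \<in> B \<Longrightarrow> y \<in> B \<Longrightarrow> x \<oplus> y \<in> B" "\<And>d x. d \<in> A \<Longrightarrow> x \<in> S \<Longrightarrow> d \<otimes> x \<in> B"
  shows "A \<cdot>\<^bsub>K\<^esub> S \<subseteq> B"
proof
  fix x assume "x \<in> A \<cdot>\<^bsub>K\<^esub> S" then show "x \<in> B" by induction (use assms in auto)
qed

lemma prod_D_generators: "S \<subseteq> carrier K \<Longrightarrow> S \<subseteq> D \<cdot>\<^bsub>K\<^esub> S"
  using ideal_prod.prod[of \<one> D _ S K] DE(3) by (metis l_one subsetD subsetI)

lemma vc_prod_D: assumes "S \<subseteq> carrier K" shows "vc (D \<cdot>\<^bsub>K\<^esub> S) = vc S"
proof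
  show "vc S \<subseteq> vc (D \<cdot>\<^bsub>K\<^esub> S)" using vc_mono prod_D_generators[OF assms] .
  show "vc (D \<cdot>\<^bsub>K\<^esub> S) \<subseteq> vc S"
  proof
    fix y assume y: "y \<in> vc (D \<cdot>\<^bsub>K\<^esub> S)"
    show "y \<in> vc S"
    proof (rule vcI)
      show "y \<in> carrier K" using y vc_carrier by auto
      fix z assume z: "z \<in> carrier K" "\<And>a. a \<in> S \<Longrightarrow> z \<otimes> a \<in> D"
      have "D \<cdot>\<^bsub>K\<^esub> S \<subseteq> {x \<in> carrier K. z \<otimes> x \<in> D}"
      proof (rule prod_D_least)
        fix x w assume "x \<in> {x \<in> carrier K. z \<otimes> x \<in> D}" "w \<in> {x \<in> carrier K. z \<otimes> x \<in> D}"
        then show "x \<oplus> w \<in> {x \<in> carrier K. z \<otimes> x \<in> D}" using z DE(7) by (auto simp: r_distr)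
      next
        fix d x assume dx: "d \<in> D" "x \<in> S"
        then have c: "d \<in> carrier K" "x \<in> carrier K" using assms D_carrier by auto
        have "d \<otimes> (z \<otimes> x) \<in> D" using dx z DE(6) by auto
        then have "z \<otimes> (d \<otimes> x) \<in> D" using c z by (simp add: m_ac)
        then show "d \<otimes> x \<in> {x \<in> carrier K. z \<otimes> x \<in> D}" using c by auto
      qed
      then show "z \<otimes> y \<in> D" by (intro vc_mult[OF y]) (use z in auto)
    qed
  qed
qed

lemma fg_prod_D:
  assumes "finite S" "S \<subseteq> D" "b \<in> S" "b \<noteq> \<zero>" shows "fg_fractional_ideal K D (D \<cdot>\<^bsub>K\<^esub> S)"
proof -
  have SK: "S \<subseteq> carrier K" using assms D_carrier by auto
  have sub: "D \<cdot>\<^bsub>K\<^esub> S \<subseteq> D" using assms DE by (intro prod_D_least) auto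
  have dm: "d \<otimes> x \<in> D \<cdot>\<^bsub>K\<^esub> S" if "d \<in> D" "x \<in> D \<cdot>\<^bsub>K\<^esub> S" for d x
    using that(2)
  proof induction
    case (prod i j)
    then have "(d \<otimes> i) \<otimes> j \<in> D \<cdot>\<^bsub>K\<^esub> S" using that DE(6) by (intro ideal_prod.prod) auto
    then show ?case using that prod SK D_carrier by (metis m_assoc subsetD)
  next
    case (sum s1 s2)
    then have "d \<otimes> s1 \<oplus> d \<otimes> s2 \<in> D \<cdot>\<^bsub>K\<^esub> S" by (intro ideal_prod.sum)
    then show ?case using that sum sub D_carrier by (metis r_distr subsetD)
  qed
  have bS: "b \<in> D \<cdot>\<^bsub>K\<^esub> S" using prod_D_generators[OF SK] assms by auto
  have zS: "\<zero> \<in> D \<cdot>\<^bsub>K\<^esub> S" using dm[OF DE(2) bS] assms SK by auto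
  have "additive_subgroup (D \<cdot>\<^bsub>K\<^esub> S) K"
  proof (intro additive_subgroupI add.subgroupI)
    show "D \<cdot>\<^bsub>K\<^esub> S \<subseteq> carrier K" using sub DE(1) by auto
    show "D \<cdot>\<^bsub>K\<^esub> S \<noteq> {}" using bS by auto
    show "\<ominus> a \<in> D \<cdot>\<^bsub>K\<^esub> S" if "a \<in> D \<cdot>\<^bsub>K\<^esub> S" for a
      using dm[OF _ that, of "\<ominus> \<one>"] DE(3,5) subring_minus_one[OF D, of a] sub that by auto
    show "a \<oplus> c \<in> D \<cdot>\<^bsub>K\<^esub> S" if "a \<in> D \<cdot>\<^bsub>K\<^esub> S" "c \<in> D \<cdot>\<^bsub>K\<^esub> S" for a c
      using that by (rule ideal_prod.sum)
  qed
  moreover have "\<exists>d\<in>D - {\<zero>}. \<forall>x\<in>D \<cdot>\<^bsub>K\<^esub> S. d \<otimes> x \<in> D"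
    using DE(3,6) sub by (intro bexI[of _ \<one>]) auto
  ultimately show ?thesis
    unfolding fg_fractional_ideal_def fractional_ideal_def using dm bS assms SK by blast
qed

text \<open>\<open>t_closure\<close> ranges over nonzero ideals, hence the nonzero \<open>b\<close>.
  A set without such an element is first enlarged by one, and its v-closure can only grow.\<close>

lemma t_closureI:
  assumes "finite S" "S \<subseteq> A" "A \<subseteq> D" "b \<in> S" "b \<noteq> \<zero>" "D \<cdot>\<^bsub>K\<^esub> S \<subseteq> A" "x \<in> vc S"
  shows "x \<in> t_closure K D A"
proof -
  have "x \<in> vc (D \<cdot>\<^bsub>K\<^esub> S)" using vc_prod_D[of S] assms D_carrier by blast
  then show ?thesis using fg_prod_D[of S b] assms by (auto simp: t_closure_def)
qed

lemma t_closureE: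
  assumes "x \<in> t_closure K D A"
  obtains S where "finite S" "S \<subseteq> A" "x \<in> vc S"
proof -
  obtain J where J: "x \<in> vc J" "fg_fractional_ideal K D J" "J \<subseteq> A"
    using assms by (auto simp: t_closure_def)
  then obtain S where S: "finite S" "S \<subseteq> carrier K" "J = D \<cdot>\<^bsub>K\<^esub> S"
    by (auto simp: fg_fractional_ideal_def)
  then show ?thesis using that[of S] J prod_D_generators[of S] vc_prod_D[of S] by auto
qed

lemma ideal_prod_D: "ideal_in D I \<Longrightarrow> S \<subseteq> I \<Longrightarrow> D \<cdot>\<^bsub>K\<^esub> S \<subseteq> I"
  using ideal_inD by (intro prod_D_least) auto

lemma PT_iff:
  "I \<in> PT \<longleftrightarrow> ideal_in D I \<and> \<one> \<notin> I \<and> (\<exists>a\<in>I. a \<noteq> \<zero>) \<and> tclosed I"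
proof (cases "I \<in> proper_ideals K D")
  case False then show ?thesis unfolding proper_t_ideals_def using proper_ideals_iff by auto
next
  case True
  then obtain a where I: "ideal_in D I" "\<one> \<notin> I" "a \<in> I" "a \<noteq> \<zero>" using proper_ideals_iff by auto
  have ID: "I \<subseteq> D" using ideal_inD(1)[OF I(1)] .
  have "I = t_closure K D I \<longleftrightarrow> tclosed I"
  proof
    assume t: "I = t_closure K D I"
    show "tclosed I" unfolding tclosed_def
    proof (intro allI impI subsetI)
      fix S x assume S: "finite S \<and> S \<subseteq> I" "x \<in> vc S"
      then have "x \<in> vc (insert a S)" using vc_mono[of S "insert a S"] by auto
      then show "x \<in> I" using S I ID ideal_prod_D[OF I(1), of "insert a S"]
        by (subst t, intro t_closureI[of "insert a S" _ a]) auto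
    qed
  next
    assume t: "tclosed I"
    show "I = t_closure K D I"
    proof
      show "t_closure K D I \<subseteq> I" using t by (auto simp: tclosed_def elim!: t_closureE)
      show "I \<subseteq> t_closure K D I"
      proof
        fix x assume x: "x \<in> I"
        have "{a,x} \<subseteq> carrier K" using x I ID D_carrier by auto
        then have "x \<in> vc {a,x}" using vc_extensive[of "{a,x}"] by auto
        then show "x \<in> t_closure K D I" using x I ID ideal_prod_D[OF I(1), of "{a,x}"]
          by (intro t_closureI[of "{a,x}" _ a]) auto
      qed
    qed
  qed
  then show ?thesis using True I unfolding proper_t_ideals_def by auto
qed

lemma divisorial_tclosed: "vc I = I \<Longrightarrow> tclosed I"
  using vc_mono by (auto simp: tclosed_def)

text \<open>
  With \<open>f S = {}\<close> this yields maximal ideals, with \<open>f S = v_closure K D S\<close> maximal t-ideals.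
\<close>

lemma exists_maximal_closed:
  fixes f :: "'a set \<Rightarrow> 'a set"
  assumes I: "ideal_in D I" "\<one> \<notin> I" "\<And>S. finite S \<Longrightarrow> S \<subseteq> I \<Longrightarrow> f S \<subseteq> I"
  obtains M where "I \<subseteq> M" "ideal_in D M" "\<one> \<notin> M" "\<And>S. finite S \<Longrightarrow> S \<subseteq> M \<Longrightarrow> f S \<subseteq> M"
    "\<And>J. M \<subseteq> J \<Longrightarrow> ideal_in D J \<Longrightarrow> \<one> \<notin> J \<Longrightarrow> (\<And>S. finite S \<Longrightarrow> S \<subseteq> J \<Longrightarrow> f S \<subseteq> J) \<Longrightarrow> J = M"
proof -
  define F where "F = {I. ideal_in D I \<and> \<one> \<notin> I \<and> (\<forall>S. finite S \<and> S \<subseteq> I \<longrightarrow> f S \<subseteq> I)}"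
  define G where "G = {J \<in> F. I \<subseteq> J}"
  have "\<exists>M\<in>G. \<forall>N\<in>G. M \<subseteq> N \<longrightarrow> N = M"
  proof (rule subset_Zorn_nonempty)
    show "G \<noteq> {}" using I by (auto simp: G_def F_def)
    fix C assume C: "C \<noteq> {}" "subset.chain G C"
    then have CG: "C \<subseteq> G" and tot: "\<And>A B. A \<in> C \<Longrightarrow> B \<in> C \<Longrightarrow> A \<subseteq> B \<or> B \<subseteq> A"
      by (auto simp: subset.chain_def)
    have id: "ideal_in D A" if "A \<in> C" for A using that CG by (auto simp: G_def F_def)
    have "ideal_in D (\<Union>C)"
    proof (rule ideal_inI)
      show "\<Union>C \<subseteq> D" using id ideal_inD(1) by blast
      show "\<zero> \<in> \<Union>C" using id ideal_inD(2) C by blast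
      show "x \<oplus> y \<in> \<Union>C" if xy: "x \<in> \<Union>C" "y \<in> \<Union>C" for x y
      proof -
        obtain A B where A: "x \<in> A" "A \<in> C" and B: "y \<in> B" "B \<in> C" using xy by auto
        then show ?thesis using tot[OF A(2) B(2)] ideal_inD(3)[OF id[OF A(2)]] ideal_inD(3)[OF id[OF B(2)]]
          by blast
      qed
      show "a \<otimes> x \<in> \<Union>C" if "a \<in> D" "x \<in> \<Union>C" for a x
        using that id ideal_inD(4) by blast
    qed
    moreover have "\<one> \<notin> \<Union>C" using CG by (auto simp: G_def F_def)
    moreover have "I \<subseteq> \<Union>C" using CG C(1) unfolding G_def by blast
    moreover have "f S \<subseteq> \<Union>C" if "finite S" "S \<subseteq> \<Union>C" for S
    proof -
      \<comment> \<open>A finite subset of the union of a chain lies in one member. For this reason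
        the closure conditions are imposed on finite sets; the union of a chain of divisorial ideals
        need not be divisorial.\<close>
      obtain A where "A \<in> C" "S \<subseteq> A"
        using finite_subset_Union_chain[OF \<open>finite S\<close> \<open>S \<subseteq> \<Union>C\<close> C] by blast
      moreover from this have "f S \<subseteq> A" using CG that(1) by (auto simp: G_def F_def)
      ultimately show ?thesis by auto
    qed
    ultimately show "\<Union>C \<in> G" by (auto simp: G_def F_def)
  qed
  then obtain M where M: "M \<in> G" and max: "\<And>J. J \<in> G \<Longrightarrow> M \<subseteq> J \<Longrightarrow> J = M" by blast
  show ?thesis
  proof (rule that[of M])
    show "J = M" if "M \<subseteq> J" "ideal_in D J" "\<one> \<notin> J" "\<And>S. finite S \<Longrightarrow> S \<subseteq> J \<Longrightarrow> f S \<subseteq> J" for J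
      using max[of J] that M by (auto simp: G_def F_def)
  qed (use M in \<open>auto simp: G_def F_def\<close>)
qed

lemma exists_maximal:
  assumes "ideal_in D I" "\<one> \<notin> I" obtains M where "maximal_in D M" "I \<subseteq> M"
proof -
  obtain M where M: "I \<subseteq> M" "ideal_in D M" "\<one> \<notin> M"
    "\<And>J. M \<subseteq> J \<Longrightarrow> ideal_in D J \<Longrightarrow> \<one> \<notin> J \<Longrightarrow> J = M"
    by (rule exists_maximal_closed[of I "\<lambda>_. {}"]) (use assms in auto)
  then have "maximal_in D M" unfolding maximal_in_def by simp
  then show ?thesis using M(1) by (rule that)
qed

section \<open>Maximal t-ideals\<close>

definition t_maximal :: "'a set \<Rightarrow> bool" where
  "t_maximal M \<longleftrightarrow> M \<in> PT \<and> (\<forall>J\<in>PT. M \<subseteq> J \<longrightarrow> J = M)"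

lemma exists_t_maximal:
  assumes "I \<in> PT" obtains M where "t_maximal M" "I \<subseteq> M"
proof -
  have I: "ideal_in D I" "\<one> \<notin> I" "\<And>S. finite S \<Longrightarrow> S \<subseteq> I \<Longrightarrow> vc S \<subseteq> I" "\<exists>a\<in>I. a \<noteq> \<zero>"
    using assms by (auto simp: PT_iff tclosed_def)
  obtain M where M: "I \<subseteq> M" "ideal_in D M" "\<one> \<notin> M" "\<And>S. finite S \<Longrightarrow> S \<subseteq> M \<Longrightarrow> vc S \<subseteq> M"
    "\<And>J. M \<subseteq> J \<Longrightarrow> ideal_in D J \<Longrightarrow> \<one> \<notin> J \<Longrightarrow> (\<And>S. finite S \<Longrightarrow> S \<subseteq> J \<Longrightarrow> vc S \<subseteq> J) \<Longrightarrow> J = M"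
    by (rule exists_maximal_closed[of I vc]) (use I in auto)
  have "J = M" if "J \<in> PT" "M \<subseteq> J" for J
    using M(5)[of J] that by (auto simp: PT_iff tclosed_def)
  moreover have "M \<in> PT" using M I(4) by (auto simp: PT_iff tclosed_def)
  ultimately show ?thesis using that[of M] M(1) by (auto simp: t_maximal_def)
qed

text \<open>For \<open>J = D\<close> these are the denominators of \<open>x\<close>; an element
  outside \<open>D\<close> is detected at any maximal ideal containing them.\<close>

lemma colon_ideal:
  assumes J: "ideal_in D J" and x: "x \<in> carrier K" shows "ideal_in D {d \<in> D. d \<otimes> x \<in> J}"
proof (rule ideal_inI)
  show "\<zero> \<in> {d \<in> D. d \<otimes> x \<in> J}" using x DE(2) ideal_inD(2)[OF J] by auto
  show "a \<oplus> b \<in> {d \<in> D. d \<otimes> x \<in> J}" if "a \<in> {d \<in> D. d \<otimes> x \<in> J}" "b \<in> {d \<in> D. d \<otimes> x \<in> J}" for a b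
    using that ideal_inD(3)[OF J] DE(7) D_carrier x by (auto simp: l_distr)
  show "a \<otimes> b \<in> {d \<in> D. d \<otimes> x \<in> J}" if "a \<in> D" "b \<in> {d \<in> D. d \<otimes> x \<in> J}" for a b
    using that ideal_inD(4)[OF J] DE(6) D_carrier x by (auto simp: m_assoc)
qed auto

text \<open>Multiplication by \<open>x\<close> carries the v-closure of \<open>S\<close> into that
  of the finite set of all \<open>x \<otimes> s\<close>, which is contained in
  \<open>J\<close>.\<close>

lemma colon_tclosed:
  assumes J: "J \<subseteq> D" and t: "tclosed J" and x: "x \<in> carrier K" shows "tclosed {d \<in> D. d \<otimes> x \<in> J}"
  unfolding tclosed_def
proof (intro allI impI subsetI)
  fix S y assume S: "finite S \<and> S \<subseteq> {d \<in> D. d \<otimes> x \<in> J}" and y: "y \<in> vc S"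
  have SK: "S \<subseteq> carrier K" using S D_carrier by auto
  have yD: "y \<in> D" using vc_subset_D[of S] S y by auto
  have "(\<otimes>) x ` S \<subseteq> J" using S SK x by (auto simp: m_comm[of x] subset_iff)
  then have "vc ((\<otimes>) x ` S) \<subseteq> J" using t S by (auto simp: tclosed_def)
  then have "x \<otimes> y \<in> J" using vc_scale[OF x y SK] by auto
  then show "y \<in> {d \<in> D. d \<otimes> x \<in> J}" using yD D_carrier x by (auto simp: m_comm)
qed

lemma D_ideal: "ideal_in D D" using DE by (intro ideal_inI) auto

lemma D_tclosed: "tclosed D" using vc_subset_D by (auto simp: tclosed_def)

text \<open>For \<open>b\<close> outside \<open>M\<close>, the elements that multiply
  \<open>b\<close> into \<open>M\<close> form a proper t-ideal containing \<open>M\<close>, hence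
  \<open>M\<close> itself. The colon ideal is t-closed at once, whereas \<open>M + bD\<close> would
  first need a closure.\<close>

lemma t_maximal_prime: assumes M: "t_maximal M" shows "prime_in D M"
proof -
  have MP: "ideal_in D M" "\<one> \<notin> M" "\<exists>a\<in>M. a \<noteq> \<zero>" "tclosed M" using M by (auto simp: t_maximal_def PT_iff)
  have "a \<in> M \<or> b \<in> M" if ab: "a \<in> D" "b \<in> D" "a \<otimes> b \<in> M" for a b
  proof (rule disjCI)
    assume b: "b \<notin> M"
    have bK: "b \<in> carrier K" using ab D_carrier by auto
    let ?J = "{d \<in> D. d \<otimes> b \<in> M}"
    have sub: "M \<subseteq> ?J" using ideal_in_r[OF MP(1) _ ab(2)] ideal_inD(1)[OF MP(1)] by auto
    have "?J \<in> PT" unfolding PT_iff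
      using colon_ideal[OF MP(1) bK] colon_tclosed[OF ideal_inD(1)[OF MP(1)] MP(4) bK] b bK MP(3) sub by auto
    then have "?J = M" using M sub by (auto simp: t_maximal_def)
    then show "a \<in> M" using ab by auto
  qed
  then show ?thesis using MP by (auto simp: prime_in_def)
qed

subsection \<open>Localizations\<close>

lemma loc_iff:
  assumes P: "prime_in D P" shows "x \<in> loc P \<longleftrightarrow> x \<in> carrier K \<and> (\<exists>s\<in>D - P. s \<otimes> x \<in> D)"
proof -
  have nz: "s \<noteq> \<zero>" if "s \<in> D - P" for s using that P ideal_inD(2)[of D P] by (auto simp: prime_in_def)
  show ?thesis
  proof
    assume "x \<in> loc P"
    then obtain a s where as: "a \<in> D" "s \<in> D - P" "x = a \<otimes> inv s" by (auto simp: localization_at_def)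
    then have "s \<otimes> x = a" "x \<in> carrier K" using nz D_carrier by (auto simp: dv_simps)
    then show "x \<in> carrier K \<and> (\<exists>s\<in>D - P. s \<otimes> x \<in> D)"
      using as(1,2) by (intro conjI bexI[of _ s]) simp_all
  next
    assume "x \<in> carrier K \<and> (\<exists>s\<in>D - P. s \<otimes> x \<in> D)"
    then obtain s where s: "x \<in> carrier K" "s \<in> D - P" "s \<otimes> x \<in> D" by auto
    then have "x = (s \<otimes> x) \<otimes> inv s" using nz D_carrier by (simp add: dv_simps)
    then show "x \<in> loc P" using s unfolding localization_at_def by blast
  qed
qed

lemma prime_mult: "prime_in D P \<Longrightarrow> s \<in> D - P \<Longrightarrow> t \<in> D - P \<Longrightarrow> s \<otimes> t \<in> D - P"
  using DE(6) by (auto simp: prime_in_def)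

lemma loc_carrier: "prime_in D P \<Longrightarrow> x \<in> loc P \<Longrightarrow> x \<in> carrier K" using loc_iff by auto

lemma D_loc: assumes "prime_in D P" "x \<in> D" shows "x \<in> loc P"
  using assms DE(3) D_carrier by (auto simp: loc_iff prime_in_def intro!: bexI[of _ \<one>])

lemma loc_subring: assumes P: "prime_in D P" shows "subring (loc P) K"
proof (rule subringI)
  show "loc P \<subseteq> carrier K" using loc_iff[OF P] by auto
  show "\<one> \<in> loc P" using D_loc[OF P DE(3)] .
  have m: "x \<otimes> y \<in> loc P" if xy: "x \<in> loc P" "y \<in> loc P" for x y
  proof -
    obtain s t where s: "s \<in> D - P" "s \<otimes> x \<in> D" and t: "t \<in> D - P" "t \<otimes> y \<in> D"
      and c: "x \<in> carrier K" "y \<in> carrier K"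
      using xy loc_iff[OF P] by auto
    have "(s \<otimes> t) \<otimes> (x \<otimes> y) = (s \<otimes> x) \<otimes> (t \<otimes> y)" using s t c D_carrier by (auto simp: m_ac)
    then have "(s \<otimes> t) \<otimes> (x \<otimes> y) \<in> D" using s(2) t(2) DE(6) by simp
    then show ?thesis using prime_mult[OF P s(1) t(1)] c unfolding loc_iff[OF P] by blast
  qed
  show "x \<otimes> y \<in> loc P" if xy: "x \<in> loc P" "y \<in> loc P" for x y using m[OF that] .
  show "x \<oplus> y \<in> loc P" if xy: "x \<in> loc P" "y \<in> loc P" for x y
  proof -
    obtain s t where s: "s \<in> D - P" "s \<otimes> x \<in> D" and t: "t \<in> D - P" "t \<otimes> y \<in> D"
      and c: "x \<in> carrier K" "y \<in> carrier K"
      using xy loc_iff[OF P] by auto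
    have "(s \<otimes> t) \<otimes> (x \<oplus> y) = t \<otimes> (s \<otimes> x) \<oplus> s \<otimes> (t \<otimes> y)"
      using s t c D_carrier by (auto simp: m_ac r_distr)
    then have "(s \<otimes> t) \<otimes> (x \<oplus> y) \<in> D" using s t DE(6,7) by simp
    then show ?thesis using prime_mult[OF P s(1) t(1)] c unfolding loc_iff[OF P] by blast
  qed
  show "\<ominus> x \<in> loc P" if "x \<in> loc P" for x
  proof -
    have "\<ominus> \<one> \<otimes> x \<in> loc P" using D_loc[OF P DE(5)[OF DE(3)]] that m by blast
    then show ?thesis using loc_carrier[OF P that] by (simp add: l_minus)
  qed
qed

lemma loc_inv_iff: assumes P: "prime_in D P" and d: "d \<in> D" "d \<noteq> \<zero>" shows "inv d \<in> loc P \<longleftrightarrow> d \<notin> P"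
proof
  assume "inv d \<in> loc P"
  then obtain s where s: "s \<in> D - P" "s \<otimes> inv d \<in> D" using loc_iff[OF P] by auto
  have "(s \<otimes> inv d) \<otimes> d = s" using s d D_carrier by (simp add: dv_simps)
  moreover have "(s \<otimes> inv d) \<otimes> d \<in> P" if "d \<in> P" using s that P ideal_inD(4) by (auto simp: prime_in_def)
  ultimately show "d \<notin> P" using s by auto
next
  assume "d \<notin> P"
  then show "inv d \<in> loc P" using d D_carrier DE(3) by (auto simp: loc_iff[OF P] intro!: bexI[of _ d])
qed

lemma loc_mono: "prime_in D P \<Longrightarrow> prime_in D Q \<Longrightarrow> P \<subseteq> Q \<Longrightarrow> loc Q \<subseteq> loc P"
  by (simp add: subset_iff loc_iff) blast

lemma common_denominator:
  assumes P: "prime_in D P" and "finite S" "S \<subseteq> loc P"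
  shows "\<exists>s\<in>D - P. \<forall>x\<in>S. s \<otimes> x \<in> D"
  using assms(2,3)
proof induction
  case empty then show ?case using P DE(3) by (auto simp: prime_in_def)
next
  case (insert y S)
  then obtain s t where s: "s \<in> D - P" "\<And>x. x \<in> S \<Longrightarrow> s \<otimes> x \<in> D" and t: "t \<in> D - P" "t \<otimes> y \<in> D"
    using loc_iff[OF P] by auto
  have "(s \<otimes> t) \<otimes> x \<in> D" if "x \<in> insert y S" for x
  proof -
    have x: "x \<in> carrier K" using that insert loc_carrier[OF P] by auto
    have "(s \<otimes> t) \<otimes> x = s \<otimes> (t \<otimes> x)" "(s \<otimes> t) \<otimes> x = t \<otimes> (s \<otimes> x)" 
      using x s t D_carrier by (auto simp: m_ac)
    then show ?thesis using that s t DE(6) by (metis DiffD1 insertE)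
  qed
  then show ?case using prime_mult[OF P s(1) t(1)] by blast
qed

text \<open>The denominators of an \<open>x\<close> outside \<open>D\<close> form a proper t-ideal,
  so some maximal t-ideal contains all of them, and \<open>x\<close> is not in the localization
  there.\<close>

lemma D_inter_t_maximal:
  assumes x: "x \<in> carrier K" and loc: "\<And>M. t_maximal M \<Longrightarrow> x \<in> loc M" shows "x \<in> D"
proof (rule ccontr)
  assume "x \<notin> D"
  let ?J = "{d \<in> D. d \<otimes> x \<in> D}"
  obtain b where "b \<in> D" "b \<noteq> \<zero>" "b \<otimes> x \<in> D" using denominator[OF x] by blast
  then have "?J \<in> PT" unfolding PT_iff
    using colon_ideal[OF D_ideal x] colon_tclosed[OF _ D_tclosed x] x \<open>x \<notin> D\<close> by auto
  then obtain M where "t_maximal M" "?J \<subseteq> M" using exists_t_maximal by blast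
  then show False using loc[of M] loc_iff[OF t_maximal_prime] by auto
qed

lemma D_inter_maximal:
  assumes x: "x \<in> carrier K" and loc: "\<And>M. maximal_in D M \<Longrightarrow> x \<in> loc M" shows "x \<in> D"
proof (rule ccontr)
  assume "x \<notin> D"
  let ?J = "{d \<in> D. d \<otimes> x \<in> D}"
  obtain M where "maximal_in D M" "?J \<subseteq> M"
    using exists_maximal[OF colon_ideal[OF D_ideal x]] x \<open>x \<notin> D\<close> by auto
  then show False using loc[of M] loc_iff[OF maximal_prime[OF D]] by auto
qed


subsection \<open>Krull domains\<close>

abbreviation "cic \<equiv> completely_integrally_closed K D"

lemma cicD:
  assumes "cic" "x \<in> carrier K" "r \<in> D" "r \<noteq> \<zero>" "\<And>n::nat. r \<otimes> x [^] n \<in> D"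
  shows "x \<in> D"
  using assms unfolding completely_integrally_closed_def by blast

section \<open>From divisorial maximal t-ideals to the Krull property\<close>

lemma not_multiplier:
  assumes c: cic and I: "ideal_in D I" "\<one> \<notin> I" "\<exists>a\<in>I. a \<noteq> \<zero>" "vc I = I"
  obtains x m where "x \<in> iv I" "m \<in> I" "x \<otimes> m \<notin> I"
proof -
  have "\<exists>x\<in>iv I. \<exists>m\<in>I. x \<otimes> m \<notin> I"
  proof (rule ccontr)
    assume "\<not> ?thesis"
    then have *: "x \<otimes> m \<in> I" if "x \<in> iv I" "m \<in> I" for x m using that by auto
    obtain a where a: "a \<in> I" "a \<noteq> \<zero>" using I by auto
    have ac: "a \<in> carrier K" "a \<in> D" using a ideal_in_closed[OF I(1)] ideal_inD(1)[OF I(1)] by auto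
    have "x \<in> D" if x: "x \<in> iv I" for x
    proof -
      have xc: "x \<in> carrier K" using x iv_carrier by auto
      have "a \<otimes> x [^] n \<in> I" for n :: nat
      proof (induction n)
        case 0 then show ?case using a ac by simp
      next
        case (Suc n)
        have "a \<otimes> x [^] Suc n = x \<otimes> (a \<otimes> x [^] n)" using ac xc by (simp add: m_ac)
        then show ?case using *[OF x Suc] by simp
      qed
      then show ?thesis using cicD[OF c xc ac(2) a(2)] ideal_inD(1)[OF I(1)] by auto
    qed
    \<comment> \<open>Every multiplier of \<open>I\<close> into \<open>D\<close> now lies in
      \<open>D\<close>, that is, it also carries \<open>\<one>\<close> into
      \<open>D\<close>.\<close>
    then have "\<one> \<in> vc I" using iv_carrier by (intro vcI) (auto simp: inverse_ideal_def)
    then show False using I by simp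
  qed
  then show ?thesis using that by blast
qed

text \<open>The pivot of all the equivalences: it is equivalent to the Krull property, and for
  completely integrally closed \<open>D\<close> each of the containment conditions on t-ideals
  implies it.\<close>

definition t_maximal_divisorial :: bool where
  "t_maximal_divisorial \<longleftrightarrow> cic \<and> (\<forall>M. t_maximal M \<longrightarrow> vc M = M)"

lemma t_maximalD:
  assumes "t_maximal M"
  shows "prime_in D M" "ideal_in D M" "\<one> \<notin> M" "\<exists>a\<in>M. a \<noteq> \<zero>" "tclosed M" "M \<in> PT"
    "\<And>J. ideal_in D J \<Longrightarrow> \<one> \<notin> J \<Longrightarrow> tclosed J \<Longrightarrow> M \<subseteq> J \<Longrightarrow> J = M"
proof -
  show "prime_in D M" using t_maximal_prime[OF assms] .
  show "ideal_in D M" "\<one> \<notin> M" "\<exists>a\<in>M. a \<noteq> \<zero>" "tclosed M" "M \<in> PT"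
    using assms by (auto simp: t_maximal_def PT_iff)
  show "J = M" if "ideal_in D J" "\<one> \<notin> J" "tclosed J" "M \<subseteq> J" for J
  proof -
    obtain a where "a \<in> M" "a \<noteq> \<zero>" using assms unfolding t_maximal_def PT_iff by blast
    then have "J \<in> PT" unfolding PT_iff using that by blast
    then show ?thesis using assms that(4) unfolding t_maximal_def by blast
  qed
qed

text \<open>Choose \<open>m \<in> M\<close> with \<open>x \<otimes> m\<close> in \<open>D\<close>
  but outside \<open>M\<close>. Then \<open>x \<otimes> m\<close> is a denominator of
  \<open>inv x\<close>, while a denominator of \<open>x\<close> outside \<open>M\<close> would put a
  product of two elements outside \<open>M\<close> into \<open>M\<close>. If
  \<open>a \<otimes> x [^] n\<close> never left \<open>M\<close>, then all these elements would stay
  in \<open>D\<close> and \<open>x\<close> would be almost integral.\<close>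

lemma uniformizing:
  assumes g: t_maximal_divisorial and M: "t_maximal M"
  obtains x where "x \<in> carrier K" "x \<noteq> \<zero>" "x \<notin> loc M" "inv x \<in> loc M" "\<And>m. m \<in> M \<Longrightarrow> x \<otimes> m \<in> D"
    "\<And>a. a \<in> D \<Longrightarrow> a \<noteq> \<zero> \<Longrightarrow> \<exists>n::nat. a \<otimes> x [^] n \<in> D - M"
proof -
  note MD = t_maximalD[OF M]
  have c: cic using g by (simp add: t_maximal_divisorial_def)
  obtain x m where xm: "x \<in> iv M" "m \<in> M" "x \<otimes> m \<notin> M"
    using not_multiplier[OF c MD(2,3,4)] g M by (auto simp: t_maximal_divisorial_def)
  have x: "x \<in> carrier K" "\<And>m. m \<in> M \<Longrightarrow> x \<otimes> m \<in> D" using xm by (auto simp: inverse_ideal_def)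
  have m: "m \<in> D" "m \<in> carrier K" using xm ideal_inD(1)[OF MD(2)] D_carrier by auto
  have x0: "x \<noteq> \<zero>" using xm m ideal_inD(2)[OF MD(2)] by auto
  have nloc: "x \<notin> loc M"
  proof
    assume "x \<in> loc M"
    then obtain s where s: "s \<in> D - M" "s \<otimes> x \<in> D" using loc_iff[OF MD(1)] by auto
    have "s \<otimes> (x \<otimes> m) = (s \<otimes> x) \<otimes> m" using s x m D_carrier by (auto simp: m_assoc)
    then have "s \<otimes> (x \<otimes> m) \<in> M" using ideal_inD(4)[OF MD(2) s(2) xm(2)] by simp
    then show False using MD(1) s(1) xm x(2) unfolding prime_in_def by blast
  qed
  have "(x \<otimes> m) \<otimes> inv x = m" using x x0 m by (simp add: dv_simps)
  then have iloc: "inv x \<in> loc M" using xm x x0 m loc_iff[OF MD(1)] by (metis Diff_iff inv_closed_nonzero)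
  have "\<exists>n::nat. a \<otimes> x [^] n \<in> D - M" if a: "a \<in> D" "a \<noteq> \<zero>" for a
  proof (rule ccontr)
    assume *: "\<not> ?thesis"
    have "a \<otimes> x [^] n \<in> D" for n :: nat
    proof (induction n)
      case 0 then show ?case using a D_carrier by simp
    next
      case (Suc n)
      then have "a \<otimes> x [^] n \<in> M" using * by auto
      then have "x \<otimes> (a \<otimes> x [^] n) \<in> D" using x by auto
      then show ?case using a x D_carrier by (simp add: m_ac)
    qed
    then have "x \<in> D" using cicD[OF c x(1) a] by auto
    then show False using nloc D_loc[OF MD(1)] by auto
  qed
  then show ?thesis using that x x0 nloc iloc by blast
qed

text \<open>Suitable powers of \<open>x\<close> turn numerator and denominator of a fraction into
  elements of \<open>D\<close> outside \<open>M\<close>, that is, into units of the localization.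
  Their quotient is the unit that \<open>dvr_intro\<close> asks for.\<close>

lemma t_maximal_dvr: assumes g: t_maximal_divisorial and M: "t_maximal M" shows "dvr (loc M)"
proof -
  note MP = t_maximal_prime[OF M]
  obtain x where x: "x \<in> carrier K" "x \<noteq> \<zero>" "x \<notin> loc M" "inv x \<in> loc M"
    and gen: "\<And>a. a \<in> D \<Longrightarrow> a \<noteq> \<zero> \<Longrightarrow> \<exists>n::nat. a \<otimes> x [^] n \<in> D - M"
    using uniformizing[OF g M] by metis
  note sub = loc_subring[OF MP]
  show ?thesis
  proof (rule dvr_intro[OF sub x])
    fix z assume z: "z \<in> carrier K" "z \<noteq> \<zero>"
    then obtain a b where ab: "a \<in> D" "b \<in> D" "b \<noteq> \<zero>" "z = a \<otimes> inv b" using fraction by blast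
    then have a0: "a \<noteq> \<zero>" using z D_carrier by auto
    obtain i j :: nat where ij: "a \<otimes> x [^] i \<in> D - M" "b \<otimes> x [^] j \<in> D - M" using gen ab a0 by metis
    have nz: "a \<otimes> x [^] i \<noteq> \<zero>" "b \<otimes> x [^] j \<noteq> \<zero>" using ab a0 x D_carrier by auto
    define u where "u = (a \<otimes> x [^] i) \<otimes> inv (b \<otimes> x [^] j)"
    have "inv u = inv (a \<otimes> x [^] i) \<otimes> (b \<otimes> x [^] j)"
      using ab a0 x D_carrier by (simp add: u_def dv_simps)
    then have "u \<in> loc M" "inv u \<in> loc M"
      using loc_inv_iff[OF MP _ nz(1)] loc_inv_iff[OF MP _ nz(2)] ij D_loc[OF MP] subringE(6)[OF sub]
      by (auto simp: u_def)
    moreover have "u \<noteq> \<zero>" using nz ij D_carrier by (auto simp: u_def)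
    moreover have "z \<otimes> x [^] i = u \<otimes> x [^] j" using ab a0 x D_carrier by (simp add: u_def dv_simps)
    ultimately show "\<exists>(i::nat) (j::nat) u. u \<in> loc M \<and> u \<noteq> \<zero> \<and> inv u \<in> loc M \<and> z \<otimes> x [^] i = u \<otimes> x [^] j"
      by blast
  qed
qed

lemma t_maximal_finite:
  assumes g: t_maximal_divisorial and d: "d \<in> D" "d \<noteq> \<zero>" shows "finite {M. t_maximal M \<and> d \<in> M}"
proof -
  define I where "I = {x \<in> D. finite {M. t_maximal M \<and> dv x d \<notin> loc M}}"
  have dK: "d \<in> carrier K" using d D_carrier by auto
  have "ideal_in D I"
  proof (rule ideal_inI)
    show "I \<subseteq> D" by (auto simp: I_def)
    have "dv \<zero> d \<in> loc M" if "t_maximal M" for M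
      using subringE(2)[OF loc_subring[OF t_maximal_prime[OF that]]] dK d by simp
    then show "\<zero> \<in> I" using DE(2) by (auto simp: I_def intro: finite_subset[of _ "{}"])
    show "x \<oplus> y \<in> I" if xy: "x \<in> I" "y \<in> I" for x y
    proof -
      have c: "x \<in> carrier K" "y \<in> carrier K" using xy D_carrier by (auto simp: I_def)
      have "{M. t_maximal M \<and> dv (x \<oplus> y) d \<notin> loc M} \<subseteq>
        {M. t_maximal M \<and> dv x d \<notin> loc M} \<union> {M. t_maximal M \<and> dv y d \<notin> loc M}"
        using subringE(7)[OF loc_subring[OF t_maximal_prime]] dv_add[OF c dK d(2)] by auto
      then have "finite {M. t_maximal M \<and> dv (x \<oplus> y) d \<notin> loc M}"
        using xy by (auto simp: I_def intro: finite_subset)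
      then show ?thesis using xy DE(7) by (auto simp: I_def)
    qed
    show "a \<otimes> x \<in> I" if ax: "a \<in> D" "x \<in> I" for a x
    proof -
      have c: "a \<in> carrier K" "x \<in> carrier K" using ax D_carrier by (auto simp: I_def)
      have "{M. t_maximal M \<and> dv (a \<otimes> x) d \<notin> loc M} \<subseteq> {M. t_maximal M \<and> dv x d \<notin> loc M}"
      proof (intro subsetI CollectI, elim CollectE conjE, intro conjI notI)
        fix M assume M: "t_maximal M" "dv (a \<otimes> x) d \<notin> loc M" "dv x d \<in> loc M"
        then show False
          using subringE(6)[OF loc_subring[OF t_maximal_prime[OF M(1)]] D_loc[OF t_maximal_prime[OF M(1)] ax(1)] M(3)]
            mult_dv[OF c dK d(2)] by simp
      qed
      then have "finite {M. t_maximal M \<and> dv (a \<otimes> x) d \<notin> loc M}"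
        using ax by (auto simp: I_def intro: finite_subset)
      then show ?thesis using ax DE(6) by (auto simp: I_def)
    qed
  qed
  moreover have "d \<in> I"
  proof -
    have "dv d d \<in> loc M" if "t_maximal M" for M
      using subringE(3)[OF loc_subring[OF t_maximal_prime[OF that]]] dK d by simp
    then show ?thesis using d by (auto simp: I_def intro: finite_subset[of _ "{}"])
  qed
  moreover have "tclosed I"
    unfolding tclosed_def
  proof (intro allI impI subsetI)
    fix S x assume S: "finite S \<and> S \<subseteq> I" and x: "x \<in> vc S"
    have SD: "S \<subseteq> D" using S by (auto simp: I_def)
    have xD: "x \<in> D" using vc_subset_D[OF SD] x by auto
    \<comment> \<open>As \<open>S\<close> is finite, one \<open>t\<close> outside \<open>M\<close>
      clears the denominators of all \<open>dv s d\<close>. Then \<open>dv t d\<close> carries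
      \<open>S\<close> into \<open>D\<close>, hence also its v-closure. So only those
      \<open>M\<close> are exceptional for \<open>x\<close> that are exceptional for a member of
      \<open>S\<close>.\<close>
    have "dv x d \<in> loc M" if M: "t_maximal M" "\<And>s. s \<in> S \<Longrightarrow> dv s d \<in> loc M" for M
    proof -
      note MP = t_maximal_prime[OF M(1)]
      obtain t where t: "t \<in> D - M" "\<And>s. s \<in> S \<Longrightarrow> t \<otimes> dv s d \<in> D"
      proof -
        have "(\<lambda>s. dv s d) ` S \<subseteq> loc M" using M(2) by auto
        then have "\<exists>t\<in>D - M. \<forall>x\<in>(\<lambda>s. dv s d) ` S. t \<otimes> x \<in> D"
          using common_denominator[OF MP, of "(\<lambda>s. dv s d) ` S"] S by blast
        then show ?thesis using that by blast
      qed
      have tK: "t \<in> carrier K" using t D_carrier by auto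
      have "dv t d \<otimes> x \<in> D"
      proof (rule vc_mult[OF x])
        show "dv t d \<in> carrier K" using tK dK d by auto
        show "dv t d \<otimes> s \<in> D" if "s \<in> S" for s
          using t(2)[OF that] that SD D_carrier tK dK d by (simp add: mult_dv dv_mult subset_iff)
      qed
      then have "t \<otimes> dv x d \<in> D" using xD D_carrier tK dK d by (simp add: mult_dv dv_mult)
      then show ?thesis using loc_iff[OF MP] t(1) xD D_carrier dK d by auto
    qed
    then have "{M. t_maximal M \<and> dv x d \<notin> loc M} \<subseteq> (\<Union>s\<in>S. {M. t_maximal M \<and> dv s d \<notin> loc M})" by auto
    moreover have "finite (\<Union>s\<in>S. {M. t_maximal M \<and> dv s d \<notin> loc M})" using S by (auto simp: I_def)
    ultimately show "x \<in> I" using xD finite_subset by (auto simp: I_def)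
  qed
  ultimately have "I \<in> PT" if "\<one> \<notin> I" using that d by (auto simp: PT_iff)
  moreover have False if IPT: "I \<in> PT"
  proof -
    obtain N where N: "t_maximal N" "I \<subseteq> N" using exists_t_maximal[OF IPT] by blast
    note ND = t_maximalD[OF N(1)]
    obtain x where x: "x \<in> carrier K" "\<And>m. m \<in> N \<Longrightarrow> x \<otimes> m \<in> D"
      and gen: "\<And>a. a \<in> D \<Longrightarrow> a \<noteq> \<zero> \<Longrightarrow> \<exists>n::nat. a \<otimes> x [^] n \<in> D - N"
      using uniformizing[OF g N(1)] by metis
    obtain n :: nat where n: "d \<otimes> x [^] n \<in> D - N" using gen d by blast
    \<comment> \<open>Away from \<open>N\<close>, the element \<open>x\<close> lies in the
      localization: any \<open>p\<close> in \<open>N\<close> outside \<open>M\<close> is a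
      denominator of it. So \<open>N\<close> is the only possible exception.\<close>
    have "dv (d \<otimes> x [^] n) d \<in> loc M" if M: "t_maximal M" "M \<noteq> N" for M
    proof -
      note MD = t_maximalD[OF M(1)]
      have "\<not> N \<subseteq> M" using ND(7)[OF MD(2,3,5)] M by auto
      then obtain p where p: "p \<in> N" "p \<notin> M" by auto
      moreover from this have "x \<otimes> p = p \<otimes> x" using x ideal_in_closed[OF ND(2)] by (intro m_comm) auto
      ultimately have "p \<in> D - M" "p \<otimes> x \<in> D" using x(2)[of p] ideal_inD(1)[OF ND(2)] by auto
      then have "x \<in> loc M" using loc_iff[OF MD(1)] x by auto
      moreover have "dv (d \<otimes> x [^] n) d = x [^] n" using dK d x by (simp add: dv_simps)
      ultimately show ?thesis using subring_pow[OF loc_subring[OF MD(1)]] by simp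
    qed
    then have "{M. t_maximal M \<and> dv (d \<otimes> x [^] n) d \<notin> loc M} \<subseteq> {N}" by auto
    then have "d \<otimes> x [^] n \<in> I" using n finite_subset by (auto simp: I_def)
    then show False using n N by auto
  qed
  ultimately have "\<one> \<in> I" by blast
  then have "finite {M. t_maximal M \<and> dv \<one> d \<notin> loc M}" by (auto simp: I_def)
  moreover have "{M. t_maximal M \<and> d \<in> M} = {M. t_maximal M \<and> dv \<one> d \<notin> loc M}"
    using loc_inv_iff[OF t_maximal_prime d] inv_dv[OF dK d(2)] by auto
  ultimately show ?thesis by simp
qed

lemma t_maximal_divisorial_krull: assumes g: t_maximal_divisorial shows "krull_domain K D"
proof -
  let ?F = "loc ` {M. t_maximal M}"
  have 1: "\<forall>V\<in>?F. dvr V" using t_maximal_dvr[OF g] by auto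
  have 2: "D = {x \<in> carrier K. \<forall>V\<in>?F. x \<in> V}"
    using D_carrier D_loc[OF t_maximal_prime] D_inter_t_maximal by auto
  have 3: "finite {V \<in> ?F. d \<notin> Units (K\<lparr>carrier := V\<rparr>)}" if d: "d \<in> D - {\<zero>}" for d
  proof (rule finite_subset)
    show "finite (loc ` {M. t_maximal M \<and> d \<in> M})" using t_maximal_finite[OF g] d by auto
    show "{V \<in> ?F. d \<notin> Units (K\<lparr>carrier := V\<rparr>)} \<subseteq> loc ` {M. t_maximal M \<and> d \<in> M}"
    proof
      fix V assume "V \<in> {V \<in> ?F. d \<notin> Units (K\<lparr>carrier := V\<rparr>)}"
      then obtain M where M: "t_maximal M" "V = loc M" "d \<notin> Units (K\<lparr>carrier := V\<rparr>)" by blast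
      note MP = t_maximal_prime[OF M(1)]
      have "d \<in> M" using M(3) D_loc[OF MP] loc_inv_iff[OF MP, of d] d
        unfolding M(2) units_iff[OF loc_subring[OF MP]] by blast
      then show "V \<in> loc ` {M. t_maximal M \<and> d \<in> M}" using M by blast
    qed
  qed
  show ?thesis unfolding krull_domain_def by (intro exI[of _ ?F] conjI ballI 1[rule_format] 2 3)
qed

section \<open>Consequences of the Krull property\<close>

text \<open>Stated for an arbitrary Krull domain \<open>A\<close>, since it is applied to
  \<open>D\<close> and also to localizations of \<open>D\<close>.\<close>

lemma krull_almost_integral:
  assumes k: "krull_domain K A" and x: "x \<in> carrier K" "r \<in> carrier K" "r \<noteq> \<zero>"
    and *: "\<And>n::nat. n \<ge> 1 \<Longrightarrow> r \<otimes> x [^] n \<in> A"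
  shows "x \<in> A"
proof -
  obtain F where F: "\<forall>V\<in>F. dvr V" "A = {x \<in> carrier K. \<forall>V\<in>F. x \<in> V}"
    using k by (auto simp: krull_domain_def)
  have "x \<in> V" if "V \<in> F" for V
  proof (rule dvr_cic[OF _ x])
    show "dvr V" using F(1) that by auto
    show "r \<otimes> x [^] n \<in> V" if "n \<ge> 1" for n :: nat using *[OF that] F(2) \<open>V \<in> F\<close> by blast
  qed
  then show "x \<in> A" unfolding F(2) using x by auto
qed

lemma cicI:
  assumes "\<And>x r. x \<in> carrier K \<Longrightarrow> r \<in> carrier K \<Longrightarrow> r \<noteq> \<zero> \<Longrightarrow>
    (\<And>n::nat. n \<ge> 1 \<Longrightarrow> r \<otimes> x [^] n \<in> D) \<Longrightarrow> x \<in> D"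
  shows cic
  unfolding completely_integrally_closed_def
proof (intro ballI impI)
  fix x r assume "x \<in> carrier K" "r \<in> D - {\<zero>}" "\<forall>n::nat. n \<ge> 1 \<longrightarrow> r \<otimes> x [^] n \<in> D"
  then show "x \<in> D" using assms[of x r] D_carrier by blast
qed

lemma krull_cic: "krull_domain K D \<Longrightarrow> cic"
  by (rule cicI) (rule krull_almost_integral)

lemma krull_divisorial: assumes k: "krull_domain K D" and I: "I \<in> PT" shows "vc I = I"
proof -
  obtain F where F: "\<And>V. V \<in> F \<Longrightarrow> dvr V" "D = {x \<in> carrier K. \<forall>V\<in>F. x \<in> V}"
    "\<And>d. d \<in> D \<Longrightarrow> d \<noteq> \<zero> \<Longrightarrow> finite {V \<in> F. d \<notin> Units (K\<lparr>carrier := V\<rparr>)}"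
    using k by (auto simp: krull_domain_def)
  obtain a where a: "a \<in> I" "a \<noteq> \<zero>" and Ii: "ideal_in D I" "tclosed I" using I by (auto simp: PT_iff)
  have ID: "I \<subseteq> D" using ideal_inD(1)[OF Ii(1)] .
  have IK: "q \<in> carrier K" if "q \<in> I" for q using that ID D_carrier by auto
  have DV: "D \<subseteq> V" if "V \<in> F" for V using that F(2) by auto
  \<comment> \<open>Local finiteness makes \<open>E\<close> finite. Outside \<open>E\<close> the
    element \<open>a\<close> is a unit and so already has minimal value on \<open>I\<close>; at each
    \<open>V \<in> E\<close> an element \<open>b V\<close> of minimal value is added to the finite
    set.\<close>
  define E where "E = {V \<in> F. a \<notin> Units (K\<lparr>carrier := V\<rparr>)}"
  have "\<exists>b\<in>I. b \<noteq> \<zero> \<and> (\<forall>q\<in>I. dv q b \<in> V)" if "V \<in> E" for V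
  proof -
    have "V \<in> F" using that by (simp add: E_def)
    then show ?thesis using dvr_min[OF F(1), of V I a] a ID DV by (metis order_trans)
  qed
  then obtain b where b: "\<And>V. V \<in> E \<Longrightarrow> b V \<in> I \<and> b V \<noteq> \<zero> \<and> (\<forall>q\<in>I. dv q (b V) \<in> V)" by metis
  define S where "S = insert a (b ` E)"
  have "finite S" using F(3)[of a] a ID by (auto simp: S_def E_def)
  moreover have "S \<subseteq> I" using a b by (auto simp: S_def)
  ultimately have "vc S \<subseteq> I" using Ii(2) by (auto simp: tclosed_def)
  moreover have "vc I \<subseteq> vc S"
  proof (rule vc_least, rule subsetI, rule vcI)
    fix q assume q: "q \<in> I"
    show qK: "q \<in> carrier K" using IK q .
    fix z assume z: "z \<in> carrier K" "\<And>s. s \<in> S \<Longrightarrow> z \<otimes> s \<in> D"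
    have "z \<otimes> q \<in> V" if V: "V \<in> F" for V
    proof (cases "V \<in> E")
      case True
      note bV = b[OF True]
      have "(z \<otimes> b V) \<otimes> dv q (b V) \<in> V"
        using z(2)[of "b V"] True DV[OF V] bV q subringE(6)[OF dvr_subring[OF F(1)[OF V]]] by (auto simp: S_def)
      moreover have "(z \<otimes> b V) \<otimes> dv q (b V) = z \<otimes> q"
        using bV IK qK z by (simp add: dv_simps)
      ultimately show ?thesis by simp
    next
      case False
      then have "inv a \<in> V" using V units_iff[OF dvr_subring[OF F(1)[OF V]]] by (auto simp: E_def)
      moreover have "z \<otimes> a \<in> V" "q \<in> V" using z(2)[of a] DV[OF V] q ID by (auto simp: S_def)
      ultimately have "(z \<otimes> a) \<otimes> (inv a \<otimes> q) \<in> V"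
        using subringE(6)[OF dvr_subring[OF F(1)[OF V]]] by simp
      moreover have "(z \<otimes> a) \<otimes> (inv a \<otimes> q) = z \<otimes> q" using a IK qK z by (simp add: dv_simps)
      ultimately show ?thesis by simp
    qed
    then show "z \<otimes> q \<in> D" using F(2) z qK by auto
  qed
  moreover have "I \<subseteq> vc I" using vc_extensive IK by auto
  ultimately show ?thesis by auto
qed

text \<open>For a maximal t-ideal, the divisorial \<open>J\<close> above it is the ideal
  itself.\<close>

lemma t_maximal_divisorialI:
  assumes c: cic and P: "\<And>I. I \<in> PT \<Longrightarrow> \<exists>J\<in>PT. I \<subseteq> J \<and> vc J = J"
  shows t_maximal_divisorial
  using assms unfolding t_maximal_divisorial_def t_maximal_def by metis

lemma krull_iff_divisorial:
  assumes c: cic shows "krull_domain K D \<longleftrightarrow> PT \<triangleleft> proper_divisorial_ideal K D"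
proof
  assume k: "krull_domain K D"
  have "proper_divisorial_ideal K D I" if "I \<in> PT" for I
    using krull_divisorial[OF k that] that unfolding proper_divisorial_ideal_def proper_t_ideals_def by simp
  then show "PT \<triangleleft> proper_divisorial_ideal K D" unfolding each_contained_in_def by blast
next
  assume "PT \<triangleleft> proper_divisorial_ideal K D"
  then have "\<exists>J\<in>PT. I \<subseteq> J \<and> vc J = J" if "I \<in> PT" for I
    using that unfolding each_contained_in_def proper_divisorial_ideal_def by metis
  then have t_maximal_divisorial by (rule t_maximal_divisorialI[OF c])
  then show "krull_domain K D" by (rule t_maximal_divisorial_krull)
qed

lemma krull_t_maximal_divisorial: "krull_domain K D \<Longrightarrow> t_maximal_divisorial"
  using krull_cic krull_divisorial by (auto simp: t_maximal_divisorial_def t_maximal_def)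

section \<open>Invertible and t-invertible ideals\<close>

lemma ideal_prod_inverse:
  assumes I: "ideal_in D I" shows "ideal_in D (I \<cdot>\<^bsub>K\<^esub> iv I)" "I \<subseteq> I \<cdot>\<^bsub>K\<^esub> iv I"
proof -
  let ?A = "I \<cdot>\<^bsub>K\<^esub> iv I"
  have one: "\<one> \<in> iv I" using ideal_inD(1)[OF I] D_carrier by (auto simp: inverse_ideal_def)
  have sub: "?A \<subseteq> D"
  proof (rule prod_D_least)
    show "x \<oplus> y \<in> D" if "x \<in> D" "y \<in> D" for x y using that DE(7) by auto
    show "d \<otimes> x \<in> D" if "d \<in> I" "x \<in> iv I" for d x
      using that ideal_in_closed[OF I] by (auto simp: inverse_ideal_def m_comm)
  qed
  show "I \<subseteq> ?A"
  proof
    fix x assume x: "x \<in> I"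
    then have "x \<otimes> \<one> \<in> ?A" using one by (intro ideal_prod.prod)
    then show "x \<in> ?A" using x ideal_in_closed[OF I] by simp
  qed
  then show "ideal_in D ?A"
  proof (intro ideal_inI)
    show "\<zero> \<in> ?A" using \<open>I \<subseteq> ?A\<close> ideal_inD(2)[OF I] by auto
    show "x \<oplus> y \<in> ?A" if "x \<in> ?A" "y \<in> ?A" for x y using that by (rule ideal_prod.sum)
    show "d \<otimes> x \<in> ?A" if "d \<in> D" "x \<in> ?A" for d x
      using that(2)
    proof induction
      case (prod i j)
      then have "(d \<otimes> i) \<otimes> j \<in> ?A" using that ideal_inD(4)[OF I] by (intro ideal_prod.prod) auto
      moreover have "(d \<otimes> i) \<otimes> j = d \<otimes> (i \<otimes> j)"
        using prod that D_carrier ideal_in_closed[OF I] iv_carrier by (intro m_assoc) auto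
      ultimately show ?case by simp
    next
      case (sum s1 s2)
      then have "d \<otimes> s1 \<oplus> d \<otimes> s2 \<in> ?A" by (intro ideal_prod.sum)
      then show ?case using that sum sub D_carrier by (metis r_distr subsetD)
    qed
  qed (use sub in auto)
qed

lemma vc_prod:
  assumes I: "ideal_in D I" and x: "x \<in> vc I" and s: "s \<in> I \<cdot>\<^bsub>K\<^esub> iv I" shows "x \<otimes> s \<in> I"
proof -
  have xK: "x \<in> carrier K" using x vc_carrier by auto
  have "I \<cdot>\<^bsub>K\<^esub> iv I \<subseteq> {s \<in> carrier K. x \<otimes> s \<in> I}"
  proof (rule prod_D_least)
    show "s \<oplus> r \<in> {s \<in> carrier K. x \<otimes> s \<in> I}"
      if "s \<in> {s \<in> carrier K. x \<otimes> s \<in> I}" "r \<in> {s \<in> carrier K. x \<otimes> s \<in> I}" for s r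
      using that ideal_inD(3)[OF I] xK by (auto simp: r_distr)
    show "i \<otimes> y \<in> {s \<in> carrier K. x \<otimes> s \<in> I}" if iy: "i \<in> I" "y \<in> iv I" for i y
    proof -
      have c: "i \<in> carrier K" "y \<in> carrier K" using iy ideal_in_closed[OF I] iv_carrier by auto
      have "y \<otimes> x \<in> D" using iy by (intro vc_mult[OF x c(2)]) (auto simp: inverse_ideal_def)
      then have "(y \<otimes> x) \<otimes> i \<in> I" using ideal_inD(4)[OF I] iy by auto
      then show ?thesis using c xK by (simp add: m_ac)
    qed
  qed
  then show ?thesis using s by auto
qed

text \<open>The t-invertibility gives a finite \<open>S\<close> in the product with
  \<open>\<one> \<in> vc S\<close>. Scaling by \<open>x \<in> vc I\<close> moves \<open>S\<close>
  into \<open>I\<close> by \<open>vc_prod\<close>, and the t-closedness of \<open>I\<close> brings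
  in \<open>x\<close>.\<close>

lemma t_invertible_divisorial:
  assumes I: "I \<in> PT" and t: "t_closure K D (I \<cdot>\<^bsub>K\<^esub> iv I) = D" shows "vc I = I"
proof -
  have Ii: "ideal_in D I" "tclosed I" using I by (auto simp: PT_iff)
  have "\<one> \<in> t_closure K D (I \<cdot>\<^bsub>K\<^esub> iv I)" using t DE(3) by simp
  then obtain S where S: "finite S" "S \<subseteq> I \<cdot>\<^bsub>K\<^esub> iv I" "\<one> \<in> vc S" by (rule t_closureE)
  have SK: "S \<subseteq> carrier K" using S ideal_prod_inverse(1)[OF Ii(1)] ideal_in_closed by blast
  have "x \<in> I" if x: "x \<in> vc I" for x
  proof -
    have xK: "x \<in> carrier K" using x vc_carrier by auto
    have "(\<otimes>) x ` S \<subseteq> I" using S vc_prod[OF Ii(1) x] by auto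
    then have "vc ((\<otimes>) x ` S) \<subseteq> I" using Ii(2) S by (auto simp: tclosed_def)
    then show ?thesis using vc_scale[OF xK S(3) SK] xK by auto
  qed
  moreover have "I \<subseteq> vc I" using vc_extensive ideal_in_closed[OF Ii(1)] by auto
  ultimately show ?thesis by auto
qed

lemma invertible_divisorial:
  assumes I: "ideal_in D I" and t: "I \<cdot>\<^bsub>K\<^esub> iv I = D" shows "vc I = I"
proof
  show "I \<subseteq> vc I" using vc_extensive ideal_in_closed[OF I] by auto
  show "vc I \<subseteq> I" using vc_prod[OF I, of _ \<one>] t DE(3) vc_carrier[of I] by (metis r_one subsetD subsetI)
qed

text \<open>The union is directed: finitely many finite subsets of \<open>A\<close> merge into one.
  Hence a finite subset of \<open>T\<close> already lies in a single \<open>vc U\<close>, which is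
  an ideal and is closed under the v-operation.\<close>

lemma tclosed_union:
  assumes A: "ideal_in D A"
  defines "T \<equiv> \<Union>{vc S | S. finite S \<and> S \<subseteq> A}"
  shows "ideal_in D T" "tclosed T" "A \<subseteq> T"
proof -
  have AD: "A \<subseteq> D" using ideal_inD(1)[OF A] .
  have join: "\<exists>U. finite U \<and> U \<subseteq> A \<and> S \<subseteq> vc U" if "finite S" "S \<subseteq> T" for S
    using that
  proof induction
    case empty then show ?case by auto
  next
    case (insert x S)
    then obtain U W where "finite U" "U \<subseteq> A" "S \<subseteq> vc U" "finite W" "W \<subseteq> A" "x \<in> vc W"
      by (auto simp: T_def)
    then show ?case using vc_mono[of U "U \<union> W"] vc_mono[of W "U \<union> W"]
      by (intro exI[of _ "U \<union> W"]) auto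
  qed
  show AT: "A \<subseteq> T"
  proof
    fix x assume x: "x \<in> A"
    then have "x \<in> vc {x}" using vc_extensive[of "{x}"] AD D_carrier by auto
    then show "x \<in> T" unfolding T_def using x by blast
  qed
  show "ideal_in D T"
  proof (rule ideal_inI)
    show "T \<subseteq> D" using vc_subset_D AD by (auto simp: T_def)
    show "\<zero> \<in> T" using AT ideal_inD(2)[OF A] by auto
    show "x \<oplus> y \<in> T" if xy: "x \<in> T" "y \<in> T" for x y
    proof -
      obtain U where U: "finite U" "U \<subseteq> A" "{x,y} \<subseteq> vc U" using join[of "{x,y}"] xy by auto
      then have "x \<oplus> y \<in> vc U" using vc_ideal[of U] AD ideal_inD(3) by (metis insert_subset order_trans)
      then show ?thesis using U by (auto simp: T_def)
    qed
    show "a \<otimes> x \<in> T" if ax: "a \<in> D" "x \<in> T" for a x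
    proof -
      obtain U where U: "finite U" "U \<subseteq> A" "x \<in> vc U" using ax by (auto simp: T_def)
      then have "a \<otimes> x \<in> vc U" using ideal_inD(4)[OF vc_ideal[of U] ax(1)] AD by auto
      then show ?thesis using U by (auto simp: T_def)
    qed
  qed
  show "tclosed T" unfolding tclosed_def
  proof (intro allI impI)
    fix S assume "finite S \<and> S \<subseteq> T"
    then obtain U where U: "finite U" "U \<subseteq> A" "S \<subseteq> vc U" using join[of S] by auto
    then have "vc S \<subseteq> vc U" using vc_least by auto
    then show "vc S \<subseteq> T" using U by (auto simp: T_def)
  qed
qed

text \<open>The product of \<open>M\<close> with its inverse contains \<open>M\<close> and also the
  element outside \<open>M\<close> given by \<open>not_multiplier\<close>. Its t-closure is
  therefore strictly above \<open>M\<close>, and maximality forces \<open>\<one>\<close> into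
  it.\<close>

lemma t_maximal_t_invertible:
  assumes g: t_maximal_divisorial and M: "t_maximal M" shows "proper_t_invertible_t_ideal K D M"
proof -
  note MD = t_maximalD[OF M]
  let ?A = "M \<cdot>\<^bsub>K\<^esub> iv M"
  note A = ideal_prod_inverse[OF MD(2)]
  define T where "T = \<Union>{vc S | S. finite S \<and> S \<subseteq> ?A}"
  note T = tclosed_union[OF A(1), folded T_def]
  obtain x m where xm: "x \<in> iv M" "m \<in> M" "x \<otimes> m \<notin> M"
  proof (rule not_multiplier[OF _ MD(2,3,4)])
    show cic "vc M = M" using g M by (auto simp: t_maximal_divisorial_def)
  qed
  have "m \<otimes> x \<in> ?A" using xm by (intro ideal_prod.prod)
  moreover have "m \<otimes> x = x \<otimes> m"
    using xm(1,2) iv_carrier ideal_in_closed[OF MD(2)] by (intro m_comm) auto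
  ultimately have "x \<otimes> m \<in> T" using T(3) by auto
  then have "\<one> \<in> T" using MD(7)[OF T(1) _ T(2)] A(2) T(3) xm(3) by auto
  then obtain S where S: "finite S" "S \<subseteq> ?A" "\<one> \<in> vc S" by (auto simp: T_def)
  obtain b where b: "b \<in> M" "b \<noteq> \<zero>" using MD(4) by auto
  have AD: "?A \<subseteq> D" using ideal_inD(1)[OF A(1)] .
  have SD: "insert b S \<subseteq> ?A" using S b A(2) by auto
  then have bsD: "insert b S \<subseteq> D" using AD by auto
  have "\<one> \<in> vc (insert b S)" using S vc_mono[of S "insert b S"] by auto
  then have one: "vc (insert b S) = D" using ideal_in_one[OF D vc_ideal[OF bsD]] by auto
  have "D \<subseteq> t_closure K D ?A"
    using t_closureI[of "insert b S" ?A b] S SD AD b ideal_prod_D[OF A(1) SD] one by auto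
  moreover have "t_closure K D ?A \<subseteq> D"
  proof
    fix y assume "y \<in> t_closure K D ?A"
    then obtain S where "S \<subseteq> ?A" "y \<in> vc S" by (rule t_closureE)
    then show "y \<in> D" using vc_subset_D[of S] AD by auto
  qed
  ultimately show ?thesis using MD(6) by (auto simp: proper_t_invertible_t_ideal_def)
qed

lemma krull_iff_t_invertible:
  assumes c: cic shows "krull_domain K D \<longleftrightarrow> PT \<triangleleft> proper_t_invertible_t_ideal K D"
proof
  assume "krull_domain K D"
  then have g: t_maximal_divisorial by (rule krull_t_maximal_divisorial)
  show "PT \<triangleleft> proper_t_invertible_t_ideal K D"
    unfolding each_contained_in_def
    using exists_t_maximal t_maximal_t_invertible[OF g] by (metis t_maximal_def)
next
  assume "PT \<triangleleft> proper_t_invertible_t_ideal K D"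
  then have "\<exists>J\<in>PT. I \<subseteq> J \<and> vc J = J" if "I \<in> PT" for I
    using that t_invertible_divisorial
    unfolding each_contained_in_def proper_t_invertible_t_ideal_def by metis
  then have t_maximal_divisorial by (rule t_maximal_divisorialI[OF c])
  then show "krull_domain K D" by (rule t_maximal_divisorial_krull)
qed


subsection \<open>Locally factorial Krull domains\<close>

lemma prime_pow: "prime_in D P \<Longrightarrow> s \<in> D - P \<Longrightarrow> s [^] (k::nat) \<in> D - P"
  by (induction k) (use DE(3) prime_mult in \<open>auto simp: prime_in_def\<close>)

lemma prime_nonzero: "prime_in D P \<Longrightarrow> s \<in> D - P \<Longrightarrow> s \<noteq> \<zero>"
  using ideal_inD(2) by (auto simp: prime_in_def)

lemma prime_ideal: "prime_in D P \<Longrightarrow> ideal_in D P"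
  by (simp add: prime_in_def)

text \<open>For \<open>q \<in> M\<close>, a power of \<open>q\<close> is divisible by
  \<open>a\<close> in \<open>loc M\<close>. So some \<open>t\<close> outside \<open>M\<close> puts
  \<open>t \<otimes> q [^] k\<close> into \<open>Q\<close>; as \<open>t\<close> is outside
  \<open>Q\<close> as well, \<open>q\<close> is in \<open>Q\<close>.\<close>

lemma dvr_height_one:
  assumes M: "prime_in D M" "dvr (loc M)" and Q: "prime_in D Q" "Q \<subseteq> M" "a \<in> Q" "a \<noteq> \<zero>"
  shows "Q = M"
proof
  show "M \<subseteq> Q"
  proof
    fix q assume q: "q \<in> M"
    show "q \<in> Q"
    proof (cases "q = \<zero>")
      case True then show ?thesis using ideal_inD(2)[OF prime_ideal[OF Q(1)]] by simp
    next
      case False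
      have qD: "q \<in> D" using q ideal_inD(1)[OF prime_ideal[OF M(1)]] by auto
      have aK: "a \<in> carrier K" using Q ideal_in_closed[OF prime_ideal[OF Q(1)]] by auto
      have "inv q \<notin> loc M" using loc_inv_iff[OF M(1) qD False] q by auto
      then obtain k :: nat where k: "dv (q [^] k) a \<in> loc M"
        using dvr_archimedean[OF M(2) D_loc[OF M(1) qD] False _ aK Q(4)] by blast
      then obtain t where t: "t \<in> D - M" "t \<otimes> dv (q [^] k) a \<in> D" using loc_iff[OF M(1)] by auto
      have c: "t \<in> carrier K" "q \<in> carrier K" using t qD D_carrier by auto
      have "(t \<otimes> dv (q [^] k) a) \<otimes> a \<in> Q" using ideal_inD(4)[OF prime_ideal[OF Q(1)] t(2) Q(3)] .
      moreover have "(t \<otimes> dv (q [^] k) a) \<otimes> a = t \<otimes> q [^] k"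
        using c aK Q(4) by (simp add: mult_dv dv_mult dv_eq_iff)
      ultimately have "t \<otimes> q [^] k \<in> Q" by simp
      moreover have "t \<in> D - Q" using t Q by auto
      ultimately have "q [^] k \<notin> D - Q" using prime_mult[OF Q(1)] by blast
      then show ?thesis using prime_pow[OF Q(1)] qD by blast
    qed
  qed
qed (rule Q(2))

text \<open>Each \<open>P \<in> E\<close> contributes a factor: a power of some \<open>p\<close> in
  \<open>P\<close> outside \<open>N\<close>, high enough to be divisible by \<open>d\<close> at
  \<open>P\<close>. The product avoids \<open>N\<close> because \<open>N\<close> is prime.\<close>

lemma avoiding_multiple:
  assumes g: t_maximal_divisorial and N: "prime_in D N" and d: "d \<in> D" "d \<noteq> \<zero>"
    and "finite E" "\<And>P. P \<in> E \<Longrightarrow> t_maximal P \<and> \<not> P \<subseteq> N"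
  shows "\<exists>t\<in>D - N. \<forall>P\<in>E. dv t d \<in> loc P"
  using assms(5,6)
proof induction
  case empty then show ?case using N DE(3) by (auto simp: prime_in_def)
next
  case (insert P E)
  then obtain t where t: "t \<in> D - N" "\<And>P. P \<in> E \<Longrightarrow> dv t d \<in> loc P" by auto
  have P: "t_maximal P" "\<not> P \<subseteq> N" using insert by auto
  note PP = t_maximal_prime[OF P(1)]
  obtain p where p: "p \<in> P" "p \<notin> N" using P by auto
  have pD: "p \<in> D" using p ideal_inD(1)[OF prime_ideal[OF PP]] by auto
  have p0: "p \<noteq> \<zero>" using prime_nonzero[OF N] p pD by auto
  have "inv p \<notin> loc P" using loc_inv_iff[OF PP pD p0] p by auto
  then obtain k :: nat where k: "dv (p [^] k) d \<in> loc P"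
    using dvr_archimedean[OF t_maximal_dvr[OF g P(1)] D_loc[OF PP pD] p0 _ D_carrier[OF d(1)] d(2)] by blast
  have c: "t \<in> carrier K" "p \<in> carrier K" "d \<in> carrier K" using t pD d D_carrier by auto
  have pk: "p [^] k \<in> D - N" using prime_pow[OF N] p pD by auto
  have "dv (t \<otimes> p [^] k) d \<in> loc R" if R: "R \<in> insert P E" for R
  proof -
    have RP: "prime_in D R" using R insert t_maximal_prime by auto
    have "dv (t \<otimes> p [^] k) d = t \<otimes> dv (p [^] k) d" "dv (t \<otimes> p [^] k) d = dv t d \<otimes> p [^] k"
      using c d by (simp_all add: mult_dv dv_mult)
    moreover have "t \<in> loc R" "p [^] k \<in> loc R" using t pk D_loc[OF RP] by auto
    ultimately show ?thesis using R k t(2)[of R] subringE(6)[OF loc_subring[OF RP]] by (metis insertE)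
  qed
  then show ?case using prime_mult[OF N t(1) pk] by blast
qed

text \<open>Otherwise \<open>avoiding_multiple\<close> gives a \<open>t\<close> outside
  \<open>N\<close> divisible by \<open>d\<close> at all maximal t-ideals containing
  \<open>d\<close>. At the remaining ones \<open>d\<close> is a unit, so \<open>d\<close> divides
  \<open>t\<close> in \<open>D\<close> and \<open>t\<close> is in \<open>N\<close>.\<close>

lemma exists_t_maximal_below:
  assumes g: t_maximal_divisorial and N: "prime_in D N" and d: "d \<in> N" "d \<noteq> \<zero>"
  shows "\<exists>P. t_maximal P \<and> P \<subseteq> N \<and> d \<in> P"
proof (rule ccontr)
  assume *: "\<not> ?thesis"
  have dD: "d \<in> D" using d ideal_inD(1)[OF prime_ideal[OF N]] by auto
  obtain t where t: "t \<in> D - N" "\<And>P. t_maximal P \<Longrightarrow> d \<in> P \<Longrightarrow> dv t d \<in> loc P"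
    using avoiding_multiple[OF g N dD d(2) t_maximal_finite[OF g dD d(2)]] * by blast
  have c: "t \<in> carrier K" "d \<in> carrier K" using t dD D_carrier by auto
  have "dv t d \<in> D"
  proof (rule D_inter_t_maximal)
    show "dv t d \<in> carrier K" using c d by auto
    show "dv t d \<in> loc P" if P: "t_maximal P" for P
    proof (cases "d \<in> P")
      case False
      then have "inv d \<in> loc P" using loc_inv_iff[OF t_maximal_prime[OF P] dD d(2)] by simp
      then show ?thesis using D_loc[OF t_maximal_prime[OF P]] t(1) subringE(6)[OF loc_subring[OF t_maximal_prime[OF P]]]
        by (simp add: dv_def)
    qed (use t P in auto)
  qed
  then have "dv t d \<otimes> d \<in> N" using ideal_inD(4)[OF prime_ideal[OF N] _ d(1)] by blast
  moreover have "dv t d \<otimes> d = t" using c d by (simp add: dv_mult dv_eq_iff)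
  ultimately show False using t by auto
qed

text \<open>Products of \<open>P\<close> and \<open>iv P\<close> cannot all lie in \<open>N\<close>.
  If \<open>p \<otimes> y\<close> does not, then \<open>p\<close> generates \<open>P\<close> locally
  at \<open>N\<close>, as each \<open>q \<in> P\<close> is \<open>p\<close> times the fraction of
  \<open>y \<otimes> q \<in> D\<close> over \<open>p \<otimes> y\<close>.\<close>

lemma invertible_local_generator:
  assumes P: "ideal_in D P" "P \<cdot>\<^bsub>K\<^esub> iv P = D" and N: "prime_in D N"
  obtains p y where "p \<in> P" "y \<in> iv P" "p \<otimes> y \<in> D - N"
proof -
  have "\<exists>p\<in>P. \<exists>y\<in>iv P. p \<otimes> y \<notin> N"
  proof (rule ccontr)
    assume "\<not> ?thesis"
    then have "P \<cdot>\<^bsub>K\<^esub> iv P \<subseteq> N" using ideal_inD(3)[OF prime_ideal[OF N]] by (intro prod_D_least) auto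
    then show False using P(2) DE(3) N by (auto simp: prime_in_def)
  qed
  then obtain p y where "p \<in> P" "y \<in> iv P" "p \<otimes> y \<notin> N" by blast
  moreover from this have "p \<otimes> y \<in> D" using ideal_prod.prod[of p P y "iv P" K] P(2) by simp
  ultimately show ?thesis using that by blast
qed

section \<open>Unique factorization in localizations\<close>

lemma subring_domain: "subring A K \<Longrightarrow> domain (K\<lparr>carrier := A\<rparr>)"
  using subdomain_is_domain[OF subdomainI'] by blast

lemma loc_domain: "prime_in D N \<Longrightarrow> domain (K\<lparr>carrier := loc N\<rparr>)"
  using subring_domain[OF loc_subring] .

lemma factor_mult_of_iff:
  assumes A: "subring A K" and xy: "x \<in> A - {\<zero>}" "y \<in> A - {\<zero>}"
  shows "x divides\<^bsub>mult_of (K\<lparr>carrier := A\<rparr>)\<^esub> y \<longleftrightarrow> dv y x \<in> A"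
proof -
  have c: "x \<in> carrier K" "y \<in> carrier K" "x \<noteq> \<zero>" "y \<noteq> \<zero>" using xy subringE(1)[OF A] by auto
  show ?thesis
  proof
    assume "x divides\<^bsub>mult_of (K\<lparr>carrier := A\<rparr>)\<^esub> y"
    then obtain z where z: "z \<in> A" "y = x \<otimes> z" by (auto simp: factor_def)
    moreover from this have "z \<in> carrier K" using subringE(1)[OF A] by auto
    ultimately have "dv y x = z" using c by (simp add: dv_simps)
    then show "dv y x \<in> A" using z by simp
  next
    assume "dv y x \<in> A"
    moreover have "y = x \<otimes> dv y x" using c by (simp add: mult_dv eq_dv_iff m_comm)
    moreover have "dv y x \<noteq> \<zero>" using c by simp
    ultimately show "x divides\<^bsub>mult_of (K\<lparr>carrier := A\<rparr>)\<^esub> y" by (auto simp: factor_def)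
  qed
qed

lemma units_mult_of_iff:
  assumes A: "subring A K" and x: "x \<in> A - {\<zero>}"
  shows "x \<in> Units (mult_of (K\<lparr>carrier := A\<rparr>)) \<longleftrightarrow> inv x \<in> A"
proof -
  interpret R: domain "K\<lparr>carrier := A\<rparr>" using subring_domain[OF A] .
  show ?thesis using R.Units_mult_eq_Units units_iff[OF A, of x] x by auto
qed

text \<open>Nonunits at \<open>N\<close> are visible at a maximal t-ideal below \<open>N\<close>:
  clear the denominator of \<open>c\<close> by \<open>s\<close>, take such an ideal containing
  \<open>s \<otimes> c \<in> N\<close>, and note that \<open>s\<close> is a unit there.\<close>

lemma loc_nonunit:
  assumes g: t_maximal_divisorial and N: "prime_in D N" and c: "c \<in> loc N" "c \<noteq> \<zero>" "inv c \<notin> loc N"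
  obtains P s where "t_maximal P" "P \<subseteq> N" "s \<in> D - N" "s \<otimes> c \<in> P" "inv c \<notin> loc P"
proof -
  obtain s where s: "s \<in> D - N" "s \<otimes> c \<in> D" using loc_iff[OF N] c by auto
  have k: "s \<in> carrier K" "c \<in> carrier K" "s \<noteq> \<zero>"
    using s D_carrier loc_carrier[OF N c(1)] prime_nonzero[OF N] by auto
  have sc: "s \<otimes> c \<noteq> \<zero>" using k c by simp
  have e: "inv c = s \<otimes> inv (s \<otimes> c)" "inv (s \<otimes> c) = inv s \<otimes> inv c"
    using k c by (simp_all add: dv_simps)
  have "s \<otimes> c \<in> N"
  proof (rule ccontr)
    assume "s \<otimes> c \<notin> N"
    then have "inv (s \<otimes> c) \<in> loc N" using loc_inv_iff[OF N s(2) sc] by simp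
    then have "inv c \<in> loc N" using e(1) D_loc[OF N] s(1) subringE(6)[OF loc_subring[OF N]] by auto
    then show False using c by simp
  qed
  then obtain P where P: "t_maximal P" "P \<subseteq> N" "s \<otimes> c \<in> P" using exists_t_maximal_below[OF g N _ sc] by blast
  note PP = t_maximal_prime[OF P(1)]
  have "inv c \<notin> loc P"
  proof
    assume "inv c \<in> loc P"
    moreover have "inv s \<in> loc P" using loc_inv_iff[OF PP _ k(3)] s P by auto
    ultimately have "inv (s \<otimes> c) \<in> loc P" using e(2) subringE(6)[OF loc_subring[OF PP]] by simp
    then show False using loc_inv_iff[OF PP s(2) sc] P by simp
  qed
  then show ?thesis using that P s by blast
qed

text \<open>
  The sum of the values at the maximal t-ideals below \<open>N\<close> decreases along proper divisors.
\<close>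

lemma loc_divisor_chain:
  assumes g: t_maximal_divisorial and N: "prime_in D N"
  shows "wf {(x, y). x \<in> loc N - {\<zero>} \<and> y \<in> loc N - {\<zero>} \<and> dv y x \<in> loc N \<and> dv x y \<notin> loc N}"
    (is "wf ?R")
proof -
  note sub = loc_subring[OF N]
  define T where "T = {P. t_maximal P \<and> P \<subseteq> N}"
  have "\<exists>v. discrete_valuation K v \<and> (\<forall>x\<in>carrier K. x \<noteq> \<zero> \<longrightarrow> (x \<in> loc P \<longleftrightarrow> 0 \<le> v x))" if "P \<in> T" for P
    using dvrE[OF t_maximal_dvr[OF g]] that unfolding T_def by (metis mem_Collect_eq)
  then obtain v where v: "\<And>P. P \<in> T \<Longrightarrow> discrete_valuation K (v P)"
    and vL: "\<And>P x. P \<in> T \<Longrightarrow> x \<in> carrier K \<Longrightarrow> x \<noteq> \<zero> \<Longrightarrow> x \<in> loc P \<longleftrightarrow> 0 \<le> v P x"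
    by metis
  have LP: "loc N \<subseteq> loc P" if "P \<in> T" for P
    using that loc_mono[OF t_maximal_prime N] by (auto simp: T_def)
  have fin: "finite {P \<in> T. v P z \<noteq> 0}" if z: "z \<in> loc N - {\<zero>}" for z
  proof -
    obtain s where s: "s \<in> D - N" "s \<otimes> z \<in> D" "z \<in> carrier K" "z \<noteq> \<zero>" using loc_iff[OF N] z by auto
    have k: "s \<in> carrier K" "s \<noteq> \<zero>" using s D_carrier prime_nonzero[OF N] by auto
    have "s \<otimes> z \<in> P" if P: "P \<in> T" "v P z \<noteq> 0" for P
    proof (rule ccontr)
      assume sz: "s \<otimes> z \<notin> P"
      have PP: "prime_in D P" "P \<subseteq> N" using P t_maximal_prime by (auto simp: T_def)
      have "inv (s \<otimes> z) \<in> loc P" using loc_inv_iff[OF PP(1) s(2)] sz k s by simp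
      moreover have "inv z = s \<otimes> inv (s \<otimes> z)" using k s by (simp add: dv_simps)
      moreover have "s \<in> loc P" using D_loc[OF PP(1)] s by simp
      ultimately have "inv z \<in> loc P" using subringE(6)[OF loc_subring[OF PP(1)]] by simp
      then have "0 \<le> - v P z" using vL[OF P(1), of "inv z"] discrete_valuation_facts(3)[OF v[OF P(1)], of z] s by simp
      moreover have "0 \<le> v P z" using vL[OF P(1), of z] LP[OF P(1)] s z by auto
      ultimately show False using P by simp
    qed
    then have "{P \<in> T. v P z \<noteq> 0} \<subseteq> {P. t_maximal P \<and> s \<otimes> z \<in> P}" by (auto simp: T_def)
    then show ?thesis using t_maximal_finite[OF g s(2)] k s finite_subset by simp
  qed
  \<comment> \<open>On nonzero elements of \<open>loc N\<close> the values are nonnegative and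
    almost all zero, by \<open>fin\<close>, so summing over the support with \<open>nat\<close>
    gives the true sum.\<close>
  define \<delta> where "\<delta> z = (\<Sum>P | P \<in> T \<and> v P z \<noteq> 0. nat (v P z))" for z
  have "\<delta> x < \<delta> y" if xy: "(x, y) \<in> ?R" for x y
  proof -
    have x: "x \<in> loc N - {\<zero>}" and y: "y \<in> loc N - {\<zero>}" and c: "dv y x \<in> loc N" "dv x y \<notin> loc N"
      using xy by auto
    have k: "x \<in> carrier K" "y \<in> carrier K" "x \<noteq> \<zero>" "y \<noteq> \<zero>" using x y loc_carrier[OF N] by auto
    have i: "inv (dv y x) = dv x y" using k by (simp add: dv_simps)
    have vdv: "v P (dv y x) = v P y - v P x" if "P \<in> T" for P
      using discrete_valuation_facts(4)[OF v[OF that]] k by simp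
    have nn: "0 \<le> v P x" "v P x \<le> v P y" if "P \<in> T" for P
    proof -
      show "0 \<le> v P x" using vL[OF that, of x] LP[OF that] k x by auto
      have "0 \<le> v P (dv y x)" using vL[OF that, of "dv y x"] LP[OF that] k c by auto
      then show "v P x \<le> v P y" using vdv[OF that] by simp
    qed
    \<comment> \<open>The quotient is a nonunit of \<open>loc N\<close>, so at least one valuation
      drops strictly.\<close>
    obtain P where P: "t_maximal P" "P \<subseteq> N" "inv (dv y x) \<notin> loc P"
      using loc_nonunit[OF g N c(1)] k i c by (metis dv_eq_zero)
    then have PT: "P \<in> T" by (simp add: T_def)
    have "v P x < v P y"
    proof -
      have "\<not> 0 \<le> v P (dv x y)" using vL[OF PT, of "dv x y"] P i k by simp
      then show ?thesis using discrete_valuation_facts(4)[OF v[OF PT]] k by simp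
    qed
    \<comment> \<open>The support of \<open>y\<close> contains that of \<open>x\<close>, as
      \<open>0 \<le> v P x \<le> v P y\<close>; it serves as index set for both sums.\<close>
    let ?A = "{P \<in> T. v P y \<noteq> 0}"
    have "\<delta> x = (\<Sum>P\<in>?A. nat (v P x))" unfolding \<delta>_def
    proof (rule sum.mono_neutral_left)
      show "finite ?A" using fin[OF y] .
      show "{P. P \<in> T \<and> v P x \<noteq> 0} \<subseteq> ?A" using nn by (force)
    qed auto
    also have "\<dots> < (\<Sum>P\<in>?A. nat (v P y))"
    proof (rule sum_strict_mono_ex1)
      show "finite ?A" using fin[OF y] .
      show "\<forall>P\<in>?A. nat (v P x) \<le> nat (v P y)" using nn by (auto intro!: nat_mono)
      show "\<exists>P\<in>?A. nat (v P x) < nat (v P y)"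
        using PT \<open>v P x < v P y\<close> nn(1)[OF PT] by (intro bexI[of _ P]) auto
    qed
    finally show ?thesis by (simp add: \<delta>_def)
  qed
  then have "?R \<subseteq> measure \<delta>" by (auto simp: in_measure)
  then show ?thesis using wf_subset[OF wf_measure] by blast
qed

text \<open>An irreducible \<open>c\<close> lies in the extension of some maximal t-ideal
  \<open>P\<close> below \<open>N\<close>, and \<open>P\<close> has a local generator
  \<open>p\<close> at \<open>N\<close>. So \<open>c\<close> is \<open>p\<close> times some
  \<open>w\<close>, irreducibility makes \<open>w\<close> a unit, and \<open>c\<close> generates the
  same prime ideal as \<open>p\<close>.\<close>

lemma loc_irreducible_prime:
  assumes g: t_maximal_divisorial and inv: "\<And>P. t_maximal P \<Longrightarrow> P \<cdot>\<^bsub>K\<^esub> iv P = D" and N: "prime_in D N"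
  defines "G \<equiv> mult_of (K\<lparr>carrier := loc N\<rparr>)"
  assumes c: "c \<in> carrier G" "irreducible G c" shows "prime G c"
proof -
  note sub = loc_subring[OF N]
  have cN: "c \<in> loc N - {\<zero>}" using c by (simp add: G_def)
  have ck: "c \<in> carrier K" "c \<noteq> \<zero>" using cN loc_carrier[OF N] by auto
  have cu: "c \<notin> Units G" using c by (simp add: irreducible_def)
  then have "inv c \<notin> loc N" using units_mult_of_iff[OF sub cN] by (simp add: G_def)
  then obtain P s where P: "t_maximal P" "P \<subseteq> N" "s \<in> D - N" "s \<otimes> c \<in> P"
    using loc_nonunit[OF g N] cN by blast
  note PD = t_maximalD[OF P(1)]
  obtain p y where py: "p \<in> P" "y \<in> iv P" "p \<otimes> y \<in> D - N"
    using invertible_local_generator[OF PD(2) inv[OF P(1)] N] by blast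
  have pD: "p \<in> D" using py ideal_inD(1)[OF PD(2)] by auto
  have k: "p \<in> carrier K" "y \<in> carrier K" "p \<otimes> y \<noteq> \<zero>"
    using pD D_carrier py iv_carrier prime_nonzero[OF N] by auto
  then have p0: "p \<noteq> \<zero>" "y \<noteq> \<zero>" by auto
  have pN: "p \<in> loc N - {\<zero>}" using D_loc[OF N pD] p0 by simp
  \<comment> \<open>The element \<open>p\<close> generates \<open>P\<close> at \<open>N\<close>: the
    denominator \<open>s \<otimes> (p \<otimes> y)\<close> turns \<open>dv a p\<close> into
    \<open>y \<otimes> (s \<otimes> a)\<close>, which lies in \<open>D\<close> because
    \<open>y \<in> iv P\<close>.\<close>
  have div: "dv a p \<in> loc N" if a: "a \<in> carrier K" "s \<in> D - N" "s \<otimes> a \<in> P" for a s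
  proof -
    have s: "s \<in> carrier K" "s \<noteq> \<zero>" using a D_carrier prime_nonzero[OF N] by auto
    have yD: "y \<otimes> (s \<otimes> a) \<in> D" using py a by (auto simp: inverse_ideal_def)
    have "(s \<otimes> (p \<otimes> y)) \<otimes> dv a p = y \<otimes> (s \<otimes> a)" using a(1) s k p0 by (simp add: dv_simps)
    then have "(s \<otimes> (p \<otimes> y)) \<otimes> dv a p \<in> D" using yD by simp
    moreover have "dv a p \<in> carrier K" using a(1) k p0 by auto
    ultimately show ?thesis using prime_mult[OF N a(2) py(3)] unfolding loc_iff[OF N] by blast
  qed
  define w where "w = dv c p"
  have w: "w \<in> loc N" "w \<in> carrier K" "w \<noteq> \<zero>" using div[OF ck(1) P(3,4)] ck k p0 by (simp_all add: w_def)
  have iw: "inv w = dv p c" using ck k p0 by (simp add: w_def dv_simps)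
  \<comment> \<open>Otherwise \<open>p\<close> would be a proper divisor of the irreducible
    \<open>c\<close>, hence a unit, although \<open>p \<in> P \<subseteq> N\<close>.\<close>
  have "inv w \<in> loc N"
  proof (rule ccontr)
    assume "inv w \<notin> loc N"
    then have "properfactor G p c"
      using factor_mult_of_iff[OF sub pN cN] factor_mult_of_iff[OF sub cN pN] w iw
      by (simp add: properfactor_def G_def w_def)
    then have "p \<in> Units G" using c pN unfolding irreducible_def G_def by auto
    then have "inv p \<in> loc N" using units_mult_of_iff[OF sub pN] by (simp add: G_def)
    then show False using loc_inv_iff[OF N pD p0(1)] py P by auto
  qed
  have dvc: "dv a c \<in> loc N" if a: "a \<in> loc N" "s \<in> D - N" "s \<otimes> a \<in> P" for a s
  proof -
    have ak: "a \<in> carrier K" using loc_carrier[OF N a(1)] .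
    have "dv a c = dv a p \<otimes> inv w" using ak ck k p0 by (simp add: w_def dv_simps)
    then show ?thesis using div[OF ak a(2,3)] \<open>inv w \<in> loc N\<close> subringE(6)[OF sub] by simp
  qed
  show ?thesis
    unfolding prime_def
  proof (intro conjI ballI impI)
    show "c \<notin> Units G" using cu .
    fix a b assume ab: "a \<in> carrier G" "b \<in> carrier G" "c divides\<^bsub>G\<^esub> (a \<otimes>\<^bsub>G\<^esub> b)"
    have aN: "a \<in> loc N - {\<zero>}" and bN: "b \<in> loc N - {\<zero>}" using ab by (auto simp: G_def)
    have abk: "a \<in> carrier K" "b \<in> carrier K" "a \<noteq> \<zero>" "b \<noteq> \<zero>" using aN bN loc_carrier[OF N] by auto
    have abN: "a \<otimes> b \<in> loc N - {\<zero>}" using aN bN abk subringE(6)[OF sub] by auto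
    have "dv (a \<otimes> b) c \<in> loc N" using ab(3) factor_mult_of_iff[OF sub cN abN] by (simp add: G_def)
    then have "dv (a \<otimes> b) c \<otimes> w \<in> loc N" using w subringE(6)[OF sub] by blast
    moreover have "dv (a \<otimes> b) c \<otimes> w = dv (a \<otimes> b) p" using abk ck k p0 by (simp add: w_def dv_simps)
    ultimately obtain t where t: "t \<in> D - N" "t \<otimes> dv (a \<otimes> b) p \<in> D" using loc_iff[OF N] by auto
    obtain s1 s2 where s: "s1 \<in> D - N" "s1 \<otimes> a \<in> D" "s2 \<in> D - N" "s2 \<otimes> b \<in> D"
      using loc_iff[OF N] aN bN by auto
    have tk: "t \<in> carrier K" "s1 \<in> carrier K" "s2 \<in> carrier K" using t s D_carrier by auto
    have "((s1 \<otimes> s2) \<otimes> (t \<otimes> dv (a \<otimes> b) p)) \<otimes> p \<in> P"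
      using DE(6) s t py ideal_inD(4)[OF PD(2)] by auto
    moreover have "((s1 \<otimes> s2) \<otimes> (t \<otimes> dv (a \<otimes> b) p)) \<otimes> p = t \<otimes> ((s1 \<otimes> a) \<otimes> (s2 \<otimes> b))"
      using tk abk k p0 by (simp add: dv_simps)
    ultimately have "t \<otimes> ((s1 \<otimes> a) \<otimes> (s2 \<otimes> b)) \<in> P" by simp
    then have "s1 \<otimes> a \<in> P \<or> s2 \<otimes> b \<in> P"
      using prime_mult[OF PD(1)] t(1) s(2,4) P(2) by blast
    then have "dv a c \<in> loc N \<or> dv b c \<in> loc N" using dvc aN bN s by blast
    then show "c divides\<^bsub>G\<^esub> a \<or> c divides\<^bsub>G\<^esub> b"
      using factor_mult_of_iff[OF sub cN aN] factor_mult_of_iff[OF sub cN bN] by (simp add: G_def)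
  qed
qed

lemma loc_factorial:
  assumes g: t_maximal_divisorial and inv: "\<And>P. t_maximal P \<Longrightarrow> P \<cdot>\<^bsub>K\<^esub> iv P = D" and N: "prime_in D N"
  shows "factorial_domain (K\<lparr>carrier := loc N\<rparr>)"
proof -
  let ?R = "K\<lparr>carrier := loc N\<rparr>"
  note sub = loc_subring[OF N]
  interpret R: domain ?R using loc_domain[OF N] .
  have "divisor_chain_condition_monoid (mult_of ?R)"
  proof (intro divisor_chain_condition_monoid.intro divisor_chain_condition_monoid_axioms.intro)
    show "comm_monoid_cancel (mult_of ?R)" by (rule R.mult_of.comm_monoid_cancel_axioms)
    show "wf {(x, y). x \<in> carrier (mult_of ?R) \<and> y \<in> carrier (mult_of ?R) \<and> properfactor (mult_of ?R) x y}"
      by (rule wf_subset[OF loc_divisor_chain[OF g N]])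
        (auto simp: properfactor_def factor_mult_of_iff[OF sub])
  qed
  moreover have "primeness_condition_monoid (mult_of ?R)"
    using loc_irreducible_prime[OF g inv N]
    by (intro primeness_condition_monoid.intro primeness_condition_monoid_axioms.intro
        R.mult_of.comm_monoid_cancel_axioms) auto
  ultimately have "factorial_monoid (mult_of ?R)" using factorial_condition_one by blast
  then show ?thesis by (intro factorial_domain.intro R.domain_axioms)
qed

section \<open>From factorial localizations to invertible maximal t-ideals\<close>

text \<open>Factor \<open>m\<close> into irreducibles of \<open>loc N\<close>. The extension
  \<open>MN\<close> of \<open>M\<close> behaves like a prime ideal, so it contains one of the
  factors, and irreducible elements of a factorial monoid are prime.\<close>

lemma local_prime_element:
  assumes N: "prime_in D N" and f: "factorial_domain (K\<lparr>carrier := loc N\<rparr>)"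
    and M: "prime_in D M" "M \<subseteq> N" "m \<in> M" "m \<noteq> \<zero>"
  defines "G \<equiv> mult_of (K\<lparr>carrier := loc N\<rparr>)"
  obtains \<pi> s where "\<pi> \<in> loc N - {\<zero>}" "s \<in> D - N" "s \<otimes> \<pi> \<in> M" "prime G \<pi>"
proof -
  note sub = loc_subring[OF N]
  interpret F: factorial_domain "K\<lparr>carrier := loc N\<rparr>" by fact
  have G: "factorial_monoid G" unfolding G_def by (rule F.factorial_monoid_axioms)
  have cG: "carrier G = loc N - {\<zero>}" by (simp add: G_def)
  define MN where "MN = {z \<in> loc N. \<exists>s\<in>D - N. s \<otimes> z \<in> M}"
  have mD: "m \<in> D" using M ideal_inD(1)[OF prime_ideal[OF M(1)]] by auto
  have "m \<in> carrier G" using D_loc[OF N mD] M by (simp add: G_def)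
  then obtain fs where fs: "set fs \<subseteq> carrier G" "wfactors G fs m"
    using factorial_monoid.wfactors_exist[OF G] by blast
  \<comment> \<open>The factors multiply to \<open>m\<close> only up to a unit, so membership in
    \<open>MN\<close> has to be passed from \<open>m\<close> to their actual product.\<close>
  let ?m = "foldr (\<otimes>) fs \<one>"
  have "m divides\<^bsub>G\<^esub> ?m" using fs(2) by (auto simp: wfactors_def associated_def G_def)
  then obtain l where l: "l \<in> loc N" "?m = m \<otimes> l" by (auto simp: factor_def G_def)
  then obtain t where t: "t \<in> D - N" "t \<otimes> l \<in> D" "l \<in> carrier K" using loc_iff[OF N] by auto
  have "(t \<otimes> l) \<otimes> m \<in> M" using ideal_inD(4)[OF prime_ideal[OF M(1)] t(2) M(3)] .
  moreover have "(t \<otimes> l) \<otimes> m = t \<otimes> (m \<otimes> l)" using t mD D_carrier by (simp add: m_ac)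
  ultimately have "t \<otimes> ?m \<in> M" using l by simp
  moreover have "?m \<in> loc N" using l D_loc[OF N mD] subringE(6)[OF sub] by simp
  ultimately have "?m \<in> MN" using t by (auto simp: MN_def)
  then have "\<exists>f\<in>set fs. f \<in> MN"
    using fs(1)
  proof (induction fs)
    case Nil
    then obtain s where "s \<in> D - N" "s \<otimes> \<one> \<in> M" by (auto simp: MN_def)
    then show ?case using M(2) D_carrier by auto
  next
    case (Cons f fs)
    let ?r = "foldr (\<otimes>) fs \<one>"
    have f: "f \<in> loc N" using Cons by (simp add: cG)
    have "set fs \<subseteq> loc N" using Cons by (auto simp: cG)
    then have r: "?r \<in> loc N" by (induction fs) (use subringE(3,6)[OF sub] in auto)
    obtain s where s: "s \<in> D - N" "s \<otimes> (f \<otimes> ?r) \<in> M" using Cons(2) by (auto simp: MN_def)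
    obtain a b where ab: "a \<in> D - N" "a \<otimes> f \<in> D" "b \<in> D - N" "b \<otimes> ?r \<in> D"
      using f r loc_iff[OF N] by auto
    have k: "f \<in> carrier K" "?r \<in> carrier K" "a \<in> carrier K" "b \<in> carrier K" "s \<in> carrier K"
      using f r loc_carrier[OF N] ab s D_carrier by auto
    have "(a \<otimes> b) \<otimes> (s \<otimes> (f \<otimes> ?r)) \<in> M"
      using ideal_inD(4)[OF prime_ideal[OF M(1)]] DE(6) ab s by auto
    moreover have "(a \<otimes> b) \<otimes> (s \<otimes> (f \<otimes> ?r)) = s \<otimes> ((a \<otimes> f) \<otimes> (b \<otimes> ?r))" using k by (simp add: m_ac)
    ultimately have "s \<otimes> ((a \<otimes> f) \<otimes> (b \<otimes> ?r)) \<in> M" by simp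
    then have "a \<otimes> f \<in> M \<or> b \<otimes> ?r \<in> M" using prime_mult[OF M(1)] s(1) ab M(2) by blast
    then have "f \<in> MN \<or> ?r \<in> MN" using f r ab by (auto simp: MN_def)
    then show ?case using Cons by auto
  qed
  then obtain \<pi> where \<pi>: "\<pi> \<in> set fs" "\<pi> \<in> MN" by blast
  then have "irreducible G \<pi>" "\<pi> \<in> carrier G" using fs by (auto simp: wfactors_def)
  then have "prime G \<pi>" using factorial_monoid.irreducible_prime[OF G] by blast
  then show ?thesis using that \<pi> \<open>\<pi> \<in> carrier G\<close> by (auto simp: MN_def cG)
qed

text \<open>
  If \<open>M M\<^sup>-\<^sup>1\<close> lies in a maximal ideal \<open>N\<close>, then \<open>M\<close> is generated locally at \<open>N\<close> by some \<open>a \<in> M\<close>, as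
  \<open>M\<close> has height one. None of the other maximal t-ideals containing \<open>a\<close> lies in \<open>N\<close>, which
  gives \<open>t \<notin> N\<close> with \<open>t a\<^sup>-\<^sup>1 \<in> M\<^sup>-\<^sup>1\<close>, contradicting \<open>t \<in> M M\<^sup>-\<^sup>1\<close>.
\<close>

lemma factorial_invertible:
  assumes g: t_maximal_divisorial and f: "\<And>N. maximal_in D N \<Longrightarrow> factorial_domain (K\<lparr>carrier := loc N\<rparr>)"
    and M: "t_maximal M" shows "M \<cdot>\<^bsub>K\<^esub> iv M = D"
proof (rule ccontr)
  note MD = t_maximalD[OF M]
  let ?A = "M \<cdot>\<^bsub>K\<^esub> iv M"
  note A = ideal_prod_inverse[OF MD(2)]
  assume "?A \<noteq> D"
  then have "\<one> \<notin> ?A" using ideal_in_one[OF D A(1)] by blast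
  then obtain N where N: "maximal_in D N" "?A \<subseteq> N" using exists_maximal[OF A(1)] by blast
  note NP = maximal_prime[OF D N(1)]
  note sub = loc_subring[OF NP]
  let ?G = "mult_of (K\<lparr>carrier := loc N\<rparr>)"
  have MN: "M \<subseteq> N" using N A by auto
  obtain m where "m \<in> M" "m \<noteq> \<zero>" using MD by auto
  then obtain \<pi> s where \<pi>: "\<pi> \<in> loc N - {\<zero>}" "s \<in> D - N" "s \<otimes> \<pi> \<in> M" "prime ?G \<pi>"
    using local_prime_element[OF NP f[OF N(1)] MD(1) MN] by metis
  have k: "\<pi> \<in> carrier K" "\<pi> \<noteq> \<zero>" "s \<in> carrier K" "s \<noteq> \<zero>"
    using \<pi> loc_carrier[OF NP] D_carrier prime_nonzero[OF NP] by auto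
  \<comment> \<open>Multiplication by the unit \<open>s\<close> of \<open>loc N\<close> moves the
    prime element into \<open>M\<close> without changing the ideal it generates there.\<close>
  define a where "a = s \<otimes> \<pi>"
  have a: "a \<in> M" "a \<in> D" "a \<noteq> \<zero>" "a \<in> carrier K"
    using \<pi> ideal_inD(1)[OF MD(2)] k by (auto simp: a_def)
  \<comment> \<open>The contraction to \<open>D\<close> of the ideal generated by
    \<open>\<pi>\<close> in \<open>loc N\<close>. Up to denominators outside \<open>N\<close> its
    elements are multiples of \<open>a\<close> (\<open>key\<close>), so any prime ideal inside
    \<open>N\<close> that contains \<open>a\<close> contains \<open>Q\<close>
    (\<open>below\<close>).\<close>
  define Q where "Q = {d \<in> D. dv d \<pi> \<in> loc N}"
  have Qi: "ideal_in D Q"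
  proof (rule ideal_inI)
    show "Q \<subseteq> D" by (auto simp: Q_def)
    show "\<zero> \<in> Q" using DE(2) k subringE(2)[OF sub] by (simp add: Q_def)
    show "x \<oplus> y \<in> Q" if "x \<in> Q" "y \<in> Q" for x y
      using that DE(7) subringE(7)[OF sub] D_carrier k by (auto simp: Q_def dv_add)
    show "d \<otimes> x \<in> Q" if "d \<in> D" "x \<in> Q" for d x
      using that DE(6) subringE(6)[OF sub] D_loc[OF NP] D_carrier k by (auto simp: Q_def mult_dv[symmetric])
  qed
  have QP: "prime_in D Q" unfolding prime_in_def
  proof (intro conjI ballI impI Qi)
    have "\<pi> \<notin> Units ?G" using \<pi> by (simp add: prime_def)
    then show "\<one> \<notin> Q" using units_mult_of_iff[OF sub \<pi>(1)] k by (simp add: Q_def inv_dv)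
    show "d \<in> Q \<or> e \<in> Q" if de: "d \<in> D" "e \<in> D" "d \<otimes> e \<in> Q" for d e
    proof (cases "d = \<zero> \<or> e = \<zero>")
      case True then show ?thesis using ideal_inD(2)[OF Qi] by auto
    next
      case False
      have dN: "d \<in> loc N - {\<zero>}" and eN: "e \<in> loc N - {\<zero>}" using de False D_loc[OF NP] by auto
      have deN: "d \<otimes> e \<in> loc N - {\<zero>}" using de False D_carrier DE(6) D_loc[OF NP] by auto
      have "\<pi> divides\<^bsub>?G\<^esub> (d \<otimes>\<^bsub>?G\<^esub> e)"
        using factor_mult_of_iff[OF sub \<pi>(1) deN] de by (simp add: Q_def)
      then have "\<pi> divides\<^bsub>?G\<^esub> d \<or> \<pi> divides\<^bsub>?G\<^esub> e" using \<pi>(4) dN eN by (simp add: prime_def)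
      then show ?thesis
        using factor_mult_of_iff[OF sub \<pi>(1) dN] factor_mult_of_iff[OF sub \<pi>(1) eN] de by (auto simp: Q_def)
    qed
  qed
  have key: "\<exists>u\<in>D - N. \<exists>e\<in>D. u \<otimes> d = e \<otimes> a" if d: "d \<in> Q" for d
  proof -
    have dk: "d \<in> carrier K" using d D_carrier by (auto simp: Q_def)
    obtain t where t: "t \<in> D - N" "t \<otimes> dv d \<pi> \<in> D" using d loc_iff[OF NP] by (auto simp: Q_def)
    have tk: "t \<in> carrier K" using t D_carrier by auto
    have "(s \<otimes> t) \<otimes> d = (t \<otimes> dv d \<pi>) \<otimes> a" using dk tk k by (simp add: a_def dv_simps)
    then show ?thesis using prime_mult[OF NP \<pi>(2) t(1)] t(2) by blast
  qed
  have below: "Q \<subseteq> P" if P: "prime_in D P" "P \<subseteq> N" "a \<in> P" for P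
  proof
    fix d assume d: "d \<in> Q"
    then obtain u e where u: "u \<in> D - N" "e \<in> D" "u \<otimes> d = e \<otimes> a" using key by blast
    then have "u \<otimes> d \<in> P" using ideal_inD(4)[OF prime_ideal[OF P(1)]] P(3) by simp
    then show "d \<in> P" using prime_mult[OF P(1), of u d] u(1) P(2) d by (auto simp: Q_def)
  qed
  have aQ: "a \<in> Q"
  proof -
    have "dv a \<pi> = s" using k by (simp add: a_def dv_simps)
    then show ?thesis using a D_loc[OF NP] \<pi>(2) by (simp add: Q_def)
  qed
  have QM: "Q = M" using dvr_height_one[OF MD(1) t_maximal_dvr[OF g M] QP below[OF MD(1) MN a(1)] aQ a(3)] .
  define E where "E = {P. t_maximal P \<and> a \<in> P} - {M}"
  have "finite E" using t_maximal_finite[OF g a(2,3)] by (simp add: E_def)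
  moreover have "t_maximal P \<and> \<not> P \<subseteq> N" if P: "P \<in> E" for P
  proof -
    have mP: "t_maximal P" "a \<in> P" "P \<noteq> M" using P by (auto simp: E_def)
    have "\<not> M \<subseteq> P" using MD(7)[of P] t_maximalD[OF mP(1)] mP(3) by blast
    then show ?thesis using below[OF t_maximal_prime[OF mP(1)] _ mP(2)] QM mP by blast
  qed
  ultimately obtain t where t: "t \<in> D - N" "\<And>P. P \<in> E \<Longrightarrow> dv t a \<in> loc P"
    using avoiding_multiple[OF g NP a(2,3), of E] by blast
  have tk: "t \<in> carrier K" using t D_carrier by auto
  have "dv t a \<otimes> q \<in> D" if q: "q \<in> M" for q
  proof (rule D_inter_t_maximal)
    have qD: "q \<in> D" using q ideal_inD(1)[OF MD(2)] by auto
    have qk: "q \<in> carrier K" using qD D_carrier by auto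
    show "dv t a \<otimes> q \<in> carrier K" using tk a qk by auto
    fix P assume P: "t_maximal P"
    note PP = t_maximal_prime[OF P]
    note subP = loc_subring[OF PP]
    have tqP: "t \<in> loc P" "q \<in> loc P" using t qD D_loc[OF PP] by auto
    consider "P = M" | "a \<notin> P" | "P \<in> E" using P by (auto simp: E_def)
    then show "dv t a \<otimes> q \<in> loc P"
    proof cases
      \<comment> \<open>By \<open>key\<close>, \<open>q\<close> is a multiple of \<open>a\<close> up
        to a denominator outside \<open>N\<close>; as \<open>M \<subseteq> N\<close>, that
        denominator is admissible at \<open>M\<close> too.\<close>
      case 1
      obtain u e where u: "u \<in> D - N" "e \<in> D" "u \<otimes> q = e \<otimes> a" using key QM q by blast
      have uk: "u \<in> carrier K" "u \<noteq> \<zero>" "e \<in> carrier K" using u D_carrier prime_nonzero[OF NP] by auto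
      have "u \<otimes> (dv t a \<otimes> q) = dv t a \<otimes> (u \<otimes> q)" using uk qk tk a by (simp add: m_ac)
      also have "\<dots> = t \<otimes> e" unfolding u(3) using uk tk a by (simp add: dv_simps)
      finally have "u \<otimes> (dv t a \<otimes> q) \<in> D" using t u DE(6) by simp
      then show ?thesis using 1 u(1) MN loc_iff[OF PP] tk a qk by auto
    next
      case 2
      then have "inv a \<in> loc P" using loc_inv_iff[OF PP a(2,3)] by simp
      then show ?thesis using tqP subringE(6)[OF subP] by (simp add: dv_def)
    next
      case 3
      then show ?thesis using t(2) tqP subringE(6)[OF subP] by simp
    qed
  qed
  then have "dv t a \<in> iv M" using tk a by (auto simp: inverse_ideal_def)
  then have "a \<otimes> dv t a \<in> ?A" using a(1) by (intro ideal_prod.prod)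
  moreover have "a \<otimes> dv t a = t" using a tk by (simp add: mult_dv dv_eq_iff m_comm)
  ultimately show False using N t by auto
qed

lemma locally_factorial_krull_iff:
  assumes c: cic
  shows "locally_factorial K D \<and> krull_domain K D \<longleftrightarrow> PT \<triangleleft> proper_invertible_ideal K D"
proof
  assume "locally_factorial K D \<and> krull_domain K D"
  then have g: t_maximal_divisorial and f: "\<And>N. maximal_in D N \<Longrightarrow> factorial_domain (K\<lparr>carrier := loc N\<rparr>)"
    using krull_t_maximal_divisorial by (auto simp: locally_factorial_def maximal_iff[OF D])
  have "proper_invertible_ideal K D M" if "t_maximal M" for M
    using factorial_invertible[OF g f that] that
    by (simp add: proper_invertible_ideal_def t_maximal_def proper_t_ideals_def)
  then show "PT \<triangleleft> proper_invertible_ideal K D"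
    unfolding each_contained_in_def using exists_t_maximal by (metis t_maximal_def)
next
  assume *: "PT \<triangleleft> proper_invertible_ideal K D"
  then have ex: "\<exists>J\<in>PT. I \<subseteq> J \<and> J \<cdot>\<^bsub>K\<^esub> iv J = D" if "I \<in> PT" for I
    using that unfolding each_contained_in_def proper_invertible_ideal_def by metis
  then have g: t_maximal_divisorial using invertible_divisorial PT_iff by (intro t_maximal_divisorialI[OF c]) metis
  have inv: "P \<cdot>\<^bsub>K\<^esub> iv P = D" if "t_maximal P" for P
    using ex[of P] that by (auto simp: t_maximal_def)
  show "locally_factorial K D \<and> krull_domain K D"
    unfolding locally_factorial_def maximal_iff[OF D]
    using loc_factorial[OF g inv maximal_prime[OF D]] t_maximal_divisorial_krull[OF g] by simp
qed


subsection \<open>Locally Krull and almost Dedekind domains\<close>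

text \<open>Almost integral elements lie in each localization at a maximal ideal, and these
  intersect in \<open>D\<close>.\<close>

lemma locally_krull_cic: assumes "locally_krull K D" shows cic
proof (rule cicI)
  fix x r assume x: "x \<in> carrier K" "r \<in> carrier K" "r \<noteq> \<zero>" "\<And>n::nat. n \<ge> 1 \<Longrightarrow> r \<otimes> x [^] n \<in> D"
  have "x \<in> loc M" if M: "maximal_in D M" for M
    using krull_almost_integral[OF _ x(1-3)] D_loc[OF maximal_prime[OF D M]] x(4) assms M
    unfolding locally_krull_def maximal_iff[OF D] by blast
  then show "x \<in> D" using D_inter_maximal x(1) by blast
qed

lemma rank_one_intersection_cic:
  assumes "intersection_of_rank_one_valuation_domains K D" shows cic
proof (rule cicI)
  fix x r assume x: "x \<in> carrier K" "r \<in> carrier K" "r \<noteq> \<zero>" "\<And>n::nat. n \<ge> 1 \<Longrightarrow> r \<otimes> x [^] n \<in> D"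
  obtain F where F: "\<forall>V\<in>F. rank_one_valuation_domain K V" "D = {x \<in> carrier K. \<forall>V\<in>F. x \<in> V}"
    using assms unfolding intersection_of_rank_one_valuation_domains_def by blast
  have "x \<in> V" if "V \<in> F" for V
  proof (rule rank_one_cic[OF _ x(1-3)])
    show "rank_one_valuation_domain K V" using F(1) that by auto
    show "r \<otimes> x [^] n \<in> V" if "n \<ge> 1" for n :: nat using x(4)[OF that] F(2) \<open>V \<in> F\<close> by blast
  qed
  then show "x \<in> D" unfolding F(2) using x(1) by auto
qed

section \<open>Almost Dedekind domains\<close>

lemma almost_dedekind_dvr:
  assumes "almost_dedekind_domain K D" "maximal_in D M" shows "dvr (loc M)"
  using assms by (auto simp: almost_dedekind_domain_def maximal_iff[OF D])

lemma almost_dedekind_cic: assumes "almost_dedekind_domain K D" shows cic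
proof (rule cicI)
  fix x r assume x: "x \<in> carrier K" "r \<in> carrier K" "r \<noteq> \<zero>" "\<And>n::nat. n \<ge> 1 \<Longrightarrow> r \<otimes> x [^] n \<in> D"
  have "x \<in> loc M" if M: "maximal_in D M" for M
    using dvr_cic[OF almost_dedekind_dvr[OF assms M] x(1-3)] D_loc[OF maximal_prime[OF D M]] x(4) by blast
  then show "x \<in> D" using D_inter_maximal x(1) by blast
qed

text \<open>If \<open>x\<close> is outside \<open>V\<close>, its inverse \<open>y\<close> is in
  \<open>V\<close>. Multiplying an integral equation of degree \<open>Suc k\<close> by
  \<open>y [^] k\<close> isolates \<open>x\<close> and leaves the lower terms in
  \<open>V\<close>.\<close>

lemma dvr_integral:
  assumes V: "dvr V" and x: "x \<in> carrier K"
    and p: "p \<noteq> []" "set p \<subseteq> V" "lead_coeff p = \<one>" "eval p x = \<zero>"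
  shows "x \<in> V"
proof (rule ccontr)
  assume nx: "x \<notin> V"
  note sub = dvr_subring[OF V]
  have VK: "a \<in> carrier K" if "a \<in> V" for a using that subringE(1)[OF sub] by auto
  have x0: "x \<noteq> \<zero>" using nx subringE(2)[OF sub] by auto
  define y where "y = inv x"
  have y: "y \<in> V" "y \<in> carrier K" "x \<otimes> y = \<one>" using dvr_total[OF V x x0 nx] x x0 by (auto simp: y_def)
  have xy: "x [^] k \<otimes> y [^] k = \<one>" for k :: nat
    using nat_pow_distrib[OF x y(2), of k] y(3) nat_pow_one by simp
  \<comment> \<open>A list of \<open>Suc k\<close> coefficients has degree at most \<open>k\<close>,
    so \<open>y [^] k\<close> absorbs every power of \<open>x\<close>.\<close>
  have *: "eval cs x \<otimes> y [^] k \<in> V" if "set cs \<subseteq> V" "length cs = Suc k" for cs k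
    using that
  proof (induction k arbitrary: cs)
    case 0
    then obtain c where "cs = [c]" by (cases cs) auto
    then show ?case using 0 VK x by simp
  next
    case (Suc k)
    then obtain c ds where cs: "cs = c # ds" "length ds = Suc k" "c \<in> V" "set ds \<subseteq> V" by (cases cs) auto
    have cK: "c \<in> carrier K" "eval ds x \<in> carrier K"
      using cs VK x eval_in_carrier[of ds x] by auto
    have "eval cs x \<otimes> y [^] Suc k = c \<otimes> (x [^] Suc k \<otimes> y [^] Suc k) \<oplus> (eval ds x \<otimes> y [^] k) \<otimes> y"
      using cK x y(2) cs by (simp add: l_distr m_assoc)
    also have "\<dots> = c \<oplus> (eval ds x \<otimes> y [^] k) \<otimes> y" unfolding xy using cK by simp
    finally show ?case using Suc.IH[OF cs(4,2)] cs(3) y(1) subringE(6,7)[OF sub] by simp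
  qed
  obtain cs where cs: "p = \<one> # cs" using p by (cases p) auto
  have csV: "set cs \<subseteq> V" "eval cs x \<in> carrier K" using p cs VK x eval_in_carrier[of cs x] by auto
  have e: "x [^] length cs \<oplus> eval cs x = \<zero>" using p(4) cs x by simp
  show False
  proof (cases "length cs")
    case 0 then show ?thesis using e by simp
  next
    case (Suc k)
    have "(x [^] length cs \<oplus> eval cs x) \<otimes> y [^] k = x \<otimes> (x [^] k \<otimes> y [^] k) \<oplus> eval cs x \<otimes> y [^] k"
      using csV x y(2) Suc by (simp add: l_distr) (simp add: m_ac)
    then have "x \<oplus> eval cs x \<otimes> y [^] k = \<zero>" unfolding xy using e x y(2) by simp
    then have "x = \<ominus> (eval cs x \<otimes> y [^] k)"
      using x csV(2) y(2) by (metis m_closed minus_equality nat_pow_closed)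
    then have "x \<in> V" using *[OF csV(1) Suc] subringE(5)[OF sub] by metis
    then show ?thesis using nx by simp
  qed
qed

lemma almost_dedekind_integrally_closed:
  assumes "almost_dedekind_domain K D" shows "integrally_closed K D"
  unfolding integrally_closed_def
proof (intro ballI impI, elim exE conjE)
  fix x p assume x: "x \<in> carrier K" and p: "p \<noteq> []" "set p \<subseteq> D" "lead_coeff p = \<one>" "eval p x = \<zero>"
  have "x \<in> loc M" if M: "maximal_in D M" for M
    using dvr_integral[OF almost_dedekind_dvr[OF assms M] x p(1) _ p(3,4)]
      D_loc[OF maximal_prime[OF D M]] p(2) by blast
  then show "x \<in> D" using D_inter_maximal x by blast
qed

text \<open>Let \<open>b\<close> generate \<open>N\<close> locally. As \<open>N\<close> is finitely
  generated, one \<open>s\<close> outside \<open>N\<close> makes \<open>dv s b\<close> a multiplier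
  of \<open>N\<close> into \<open>D\<close>. If \<open>\<one>\<close> were in the v-closure, this
  quotient would be in \<open>D\<close>, and \<open>s\<close>, its product with \<open>b\<close>, in
  \<open>N\<close>.\<close>

lemma noetherian_maximal_divisorial:
  assumes ad: "almost_dedekind_domain K D" and noeth: "noetherian_domain (K\<lparr>carrier := D\<rparr>)"
    and N: "maximal_in D N" and nz: "a \<in> N" "a \<noteq> \<zero>"
  shows "vc N = N"
proof -
  let ?R = "K\<lparr>carrier := D\<rparr>"
  interpret R: noetherian_domain ?R by fact
  note NP = maximal_prime[OF D N]
  note Ni = prime_ideal[OF NP]
  have ND: "N \<subseteq> D" using ideal_inD(1)[OF Ni] .
  obtain A where A: "A \<subseteq> D" "finite A" "N = genideal ?R A"
    using R.finetely_gen[of N] ideal_iff[OF D] Ni by auto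
  have AN: "A \<subseteq> N" using R.genideal_self[of A] A by auto
  have "N \<subseteq> loc N" using D_loc[OF NP] ND by auto
  then obtain b where b: "b \<in> N" "b \<noteq> \<zero>" "\<And>q. q \<in> N \<Longrightarrow> dv q b \<in> loc N"
    using dvr_min[OF almost_dedekind_dvr[OF ad N] _ nz] by metis
  have bK: "b \<in> carrier K" using b ideal_in_closed[OF Ni] by auto
  have "(\<lambda>q. dv q b) ` A \<subseteq> loc N" using b(3) AN by auto
  then obtain s where s: "s \<in> D - N" "\<And>q. q \<in> A \<Longrightarrow> s \<otimes> dv q b \<in> D"
    using common_denominator[OF NP, of "(\<lambda>q. dv q b) ` A"] A(2) by (metis finite_imageI imageI)
  have sK: "s \<in> carrier K" using s D_carrier by auto
  define y where "y = dv s b"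
  have y: "y \<in> carrier K" using sK bK b by (simp add: y_def)
  let ?J = "{d \<in> D. d \<otimes> y \<in> D}"
  have "ideal_in D ?J" using colon_ideal[OF D_ideal y] .
  moreover have "A \<subseteq> ?J"
  proof
    fix q assume q: "q \<in> A"
    then have qK: "q \<in> carrier K" using A D_carrier by auto
    have "q \<otimes> y = s \<otimes> dv q b" using qK sK bK b by (simp add: y_def mult_dv m_comm)
    then show "q \<in> ?J" using s(2)[OF q] q A by auto
  qed
  ultimately have NJ: "N \<subseteq> ?J" using R.genideal_minimal[of ?J A] ideal_iff[OF D] A(3) by auto
  have "\<one> \<notin> vc N"
  proof
    assume "\<one> \<in> vc N"
    moreover have "y \<otimes> q \<in> D" if "q \<in> N" for q
      using NJ that m_comm[OF y ideal_in_closed[OF Ni that]] by auto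
    ultimately have "y \<otimes> \<one> \<in> D" using vc_mult[OF _ y] by blast
    then have "y \<otimes> b \<in> N" using ideal_inD(4)[OF Ni _ b(1)] y by simp
    moreover have "y \<otimes> b = s" using sK bK b by (simp add: y_def dv_mult dv_eq_iff)
    ultimately show False using s by simp
  qed
  moreover have "N \<subseteq> vc N" using vc_extensive ideal_in_closed[OF Ni] by auto
  ultimately show ?thesis using N vc_ideal[OF ND] unfolding maximal_in_def by blast
qed

text \<open>By \<open>max\<close> the finite character of maximal t-ideals applies to maximal
  ideals, so only finitely many contain a given nonzero \<open>a \<in> I\<close>. A local generator
  of \<open>I\<close> at each of them, together with \<open>a\<close>, generates
  \<open>I\<close>.\<close>

lemma almost_dedekind_noetherian:
  assumes ad: "almost_dedekind_domain K D" and g: t_maximal_divisorial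
    and max: "\<And>N a. maximal_in D N \<Longrightarrow> a \<in> N \<Longrightarrow> a \<noteq> \<zero> \<Longrightarrow> t_maximal N"
  shows "noetherian_domain (K\<lparr>carrier := D\<rparr>)"
proof -
  let ?R = "K\<lparr>carrier := D\<rparr>"
  interpret R: domain ?R using subring_domain[OF D] .
  have "\<exists>S\<subseteq>carrier ?R. finite S \<and> I = genideal ?R S" if "ideal I ?R" for I
  proof -
    have I: "ideal_in D I" using that ideal_iff[OF D] by simp
    have ID: "I \<subseteq> D" using ideal_inD(1)[OF I] .
    show ?thesis
    proof (cases "\<exists>a\<in>I. a \<noteq> \<zero>")
      case False
      then have I0: "I = {\<zero>}" using ideal_inD(2)[OF I] by blast
      have "genideal ?R I = I"
        using R.genideal_minimal[OF that order_refl] R.genideal_self[of I] ID by auto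
      then show ?thesis using I0 ID by (intro exI[of _ I]) auto
    next
      case True
      then obtain a where a: "a \<in> I" "a \<noteq> \<zero>" by blast
      define E where "E = {N. maximal_in D N \<and> a \<in> N}"
      have "E \<subseteq> {M. t_maximal M \<and> a \<in> M}" using max a by (auto simp: E_def)
      then have fin: "finite E" using t_maximal_finite[OF g _ a(2)] a ID finite_subset by blast
      have "\<exists>b\<in>I. b \<noteq> \<zero> \<and> (\<forall>q\<in>I. dv q b \<in> loc N)" if "N \<in> E" for N
      proof -
        have N: "maximal_in D N" using that by (simp add: E_def)
        have "I \<subseteq> loc N" using ID D_loc[OF maximal_prime[OF D N]] by auto
        then show ?thesis using dvr_min[OF almost_dedekind_dvr[OF ad N] _ a] by metis
      qed
      then obtain b where b: "\<And>N. N \<in> E \<Longrightarrow> b N \<in> I \<and> b N \<noteq> \<zero> \<and> (\<forall>q\<in>I. dv q (b N) \<in> loc N)" by metis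
      define S where "S = insert a (b ` E)"
      define J where "J = genideal ?R S"
      have S: "finite S" "S \<subseteq> I" using fin a b by (auto simp: S_def)
      have SJ: "S \<subseteq> J" unfolding J_def using R.genideal_self[of S] S ID by auto
      have J: "ideal_in D J" unfolding J_def using R.genideal_ideal[of S] S ID ideal_iff[OF D] by auto
      have "x \<in> J" if x: "x \<in> I" for x
      proof -
        have xK: "x \<in> carrier K" "x \<in> D" using x ID D_carrier by auto
        let ?C = "{d \<in> D. d \<otimes> x \<in> J}"
        note C = colon_ideal[OF J xK(1)]
        \<comment> \<open>No maximal ideal \<open>N\<close> contains \<open>?C\<close>: if
          \<open>a\<close> is outside \<open>N\<close>, then \<open>a\<close> is in
          \<open>?C\<close>; otherwise a denominator of \<open>dv x (b N)\<close> outside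
          \<open>N\<close> is.\<close>
        have "\<one> \<in> ?C"
        proof (rule ccontr)
          assume "\<one> \<notin> ?C"
          then obtain N where N: "maximal_in D N" "?C \<subseteq> N" using exists_maximal[OF C] by blast
          note NP = maximal_prime[OF D N(1)]
          show False
          proof (cases "a \<in> N")
            case False
            have "x \<otimes> a \<in> J" using ideal_inD(4)[OF J xK(2)] SJ by (auto simp: S_def)
            moreover have "x \<otimes> a = a \<otimes> x" using xK a ID D_carrier by (intro m_comm) auto
            ultimately have "a \<otimes> x \<in> J" by metis
            then have "a \<in> ?C" using a ID by auto
            then show ?thesis using N False by auto
          next
            case True
            then have NE: "N \<in> E" using N by (simp add: E_def)
            have bK: "b N \<in> carrier K" "b N \<noteq> \<zero>" using b[OF NE] ID D_carrier by auto
            obtain s where s: "s \<in> D - N" "s \<otimes> dv x (b N) \<in> D" using b[OF NE] x loc_iff[OF NP] by blast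
            have sK: "s \<in> carrier K" using s D_carrier by auto
            have "(s \<otimes> dv x (b N)) \<otimes> b N \<in> J"
              using ideal_inD(4)[OF J s(2)] SJ NE by (auto simp: S_def)
            moreover have "(s \<otimes> dv x (b N)) \<otimes> b N = s \<otimes> x"
              using sK bK xK by (simp add: mult_dv dv_mult dv_eq_iff)
            ultimately have "s \<in> ?C" using s by simp
            then show ?thesis using N s by auto
          qed
        qed
        then show ?thesis using xK by simp
      qed
      moreover have "J \<subseteq> I" unfolding J_def using R.genideal_minimal[OF that S(2)] .
      ultimately have "I = J" by auto
      then show ?thesis using S ID unfolding J_def by (intro exI[of _ S]) auto
    qed
  qed
  then have "noetherian_ring ?R" by (rule R.noetherian_ringI)
  then show ?thesis by (intro noetherian_domain.intro R.domain_axioms)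
qed

lemma dedekind_iff_divisorial:
  assumes ad: "almost_dedekind_domain K D"
  shows "dedekind_domain K D \<longleftrightarrow> proper_ideals K D \<triangleleft> proper_divisorial_ideal K D"
proof
  assume "dedekind_domain K D"
  then have noeth: "noetherian_domain (K\<lparr>carrier := D\<rparr>)" by (simp add: dedekind_domain_def)
  show "proper_ideals K D \<triangleleft> proper_divisorial_ideal K D"
    unfolding each_contained_in_def
  proof
    fix I assume "I \<in> proper_ideals K D"
    then obtain a where I: "ideal_in D I" "\<one> \<notin> I" "a \<in> I" "a \<noteq> \<zero>" by (auto simp: proper_ideals_iff)
    obtain N where N: "maximal_in D N" "I \<subseteq> N" using exists_maximal[OF I(1,2)] by blast
    have a: "a \<in> N" using I N by auto
    have "vc N = N" using noetherian_maximal_divisorial[OF ad noeth N(1) a I(4)] .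
    moreover have "N \<in> proper_ideals K D"
      using N(1) a I(4) unfolding proper_ideals_iff maximal_in_def by blast
    ultimately show "\<exists>\<gamma>\<in>proper_ideals K D. I \<subseteq> \<gamma> \<and> proper_divisorial_ideal K D \<gamma>"
      using N(2) unfolding proper_divisorial_ideal_def by metis
  qed
next
  assume *: "proper_ideals K D \<triangleleft> proper_divisorial_ideal K D"
  have ex: "\<exists>J\<in>PT. I \<subseteq> J \<and> vc J = J" if "I \<in> proper_ideals K D" for I
  proof -
    obtain J where J: "J \<in> proper_ideals K D" "I \<subseteq> J" "proper_divisorial_ideal K D J"
      using * \<open>I \<in> proper_ideals K D\<close> unfolding each_contained_in_def by blast
    from J(3) have J': "vc J = J" unfolding proper_divisorial_ideal_def by metis
    with J have "J \<in> PT" using divisorial_tclosed[OF J'] by (simp add: PT_iff proper_ideals_iff)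
    then show ?thesis using J(2) J' by blast
  qed
  have PTI: "I \<in> proper_ideals K D" if "I \<in> PT" for I using that by (simp add: proper_t_ideals_def)
  have g: t_maximal_divisorial using ex PTI by (intro t_maximal_divisorialI[OF almost_dedekind_cic[OF ad]]) blast
  \<comment> \<open>A nonzero maximal ideal equals the proper divisorial ideal above it. It is
    therefore a t-ideal, and as such it is maximal. This uses the condition for all ideals, not only
    for t-ideals.\<close>
  have max: "t_maximal N" if N: "maximal_in D N" "a \<in> N" "a \<noteq> \<zero>" for N a
  proof -
    have "N \<in> proper_ideals K D" using N unfolding proper_ideals_iff maximal_in_def by blast
    then obtain J where J: "J \<in> PT" "N \<subseteq> J" using ex by blast
    have "J' = N" if "J' \<in> PT" "N \<subseteq> J'" for J'
      using that N(1) unfolding maximal_in_def PT_iff by blast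
    then show ?thesis using J unfolding t_maximal_def by metis
  qed
  show "dedekind_domain K D"
    unfolding dedekind_domain_def
  proof (intro conjI allI impI)
    show "noetherian_domain (K\<lparr>carrier := D\<rparr>)" using almost_dedekind_noetherian[OF ad g max] .
    show "integrally_closed K D" using almost_dedekind_integrally_closed[OF ad] .
    fix P assume P: "primeideal P (K\<lparr>carrier := D\<rparr>) \<and> P \<noteq> {\<zero>}"
    then have PP: "prime_in D P" using prime_iff[OF D] by simp
    then obtain a where a: "a \<in> P" "a \<noteq> \<zero>" using P ideal_inD(2)[OF prime_ideal[OF PP]] by blast
    obtain N where N: "maximal_in D N" "P \<subseteq> N"
      using exists_maximal[OF prime_ideal[OF PP]] PP by (auto simp: prime_in_def)
    have "P = N"
      using dvr_height_one[OF maximal_prime[OF D N(1)] almost_dedekind_dvr[OF ad N(1)] PP N(2) a] .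
    then show "maximalideal P (K\<lparr>carrier := D\<rparr>)" using N maximal_iff[OF D] by simp
  qed
qed

end

theorem proposition3:
  fixes K :: "('a, 'b) ring_scheme" and D :: "'a set"
  assumes "quotient_field K D"
    and "\<not> field (K\<lparr>carrier := D\<rparr>)"
  shows
    "(completely_integrally_closed K D \<longrightarrow>
        (krull_domain K D \<longleftrightarrow> proper_t_ideals K D \<triangleleft> proper_divisorial_ideal K D) \<and>
        (locally_factorial K D \<and> krull_domain K D \<longleftrightarrow>
           proper_t_ideals K D \<triangleleft> proper_invertible_ideal K D) \<and>
        (krull_domain K D \<longleftrightarrow> proper_t_ideals K D \<triangleleft> proper_t_invertible_t_ideal K D)) \<and>
     (locally_krull K D \<longrightarrow>
        (krull_domain K D \<longleftrightarrow> proper_t_ideals K D \<triangleleft> proper_divisorial_ideal K D)) \<and>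
     (intersection_of_rank_one_valuation_domains K D \<longrightarrow>
        (krull_domain K D \<longleftrightarrow> proper_t_ideals K D \<triangleleft> proper_divisorial_ideal K D)) \<and>
     (almost_dedekind_domain K D \<longrightarrow>
        (dedekind_domain K D \<longleftrightarrow> proper_ideals K D \<triangleleft> proper_divisorial_ideal K D))"
proof -
  interpret domain_in_field K D
    using assms(1) unfolding quotient_field_def
    by (intro domain_in_field.intro ambient_field.intro domain_in_field_axioms.intro) blast+
  show ?thesis
    using krull_iff_divisorial locally_factorial_krull_iff krull_iff_t_invertible locally_krull_cic
      rank_one_intersection_cic dedekind_iff_divisorial by blast
qed

end
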